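(* Let $K$ be a field of characteristic $0$, let $n>1$, and let $U=K_n^+=K[x_1,\ldots,x_n]$ with the $n$-ary multiplication $\mathrm{Jac}_n^S(u_1,\ldots,u_n)=\det(\partial_i u_j)$, $\partial_i=\partial/\partial x_i$. Then the $n$-Lie algebra $(U,\mathrm{Jac}_n^S)$ has $1$-dimensional center $\langle1\rangle$. Its factor-algebra $(U/\langle1\rangle,\mathrm{Jac}_n^S)$ is a simple $n$-Lie algebra. It has one outer derivation (up to interior derivations and scalars), namely the class of $$\Delta=\sum_{i=1}^n x_i\partial_i+n(1-n)^{-1}.$$ In particular, $\dim\mathrm{Out}(U,\mathrm{Jac}_n^S)=\dim\mathrm{Out}(U/\langle1\rangle,\mathrm{Jac}_n^S)=1$.
   Context: An $n$-Lie algebra $(A,\omega)$ is a vector space with a skew-symmetric $n$-linear map $\omega:A^n\to A$ such that every $L_{a_1,\ldots,a_{n-1}}:a\mapsto\omega(a_1,\ldots,a_{n-1},a)$ is a derivation of $\omega$. A derivation of $(A,\omega)$ is a linear map $D$ with $D(\omega(a_1,\ldots,a_n))=\sum_i\omega(a_1,\ldots,D(a_i),\ldots,a_n)$; $\mathrm{Der}(A,\omega)$ is the Lie algebra of derivations. $\mathrm{Int}(A,\omega)$ is the space of interior derivations (the linear span of the maps $L_{a_1,\ldots,a_{n-1}}$), and $\mathrm{Out}(A,\omega)=\mathrm{Der}(A,\omega)/\mathrm{Int}(A,\omega)$. The center is $\{z:\omega(z,a_2,\ldots,a_n)=0\ \forall a_i\}$. An ideal is a subspace $J$ with $\omega(J,A,\ldots,A)\subseteq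 J$. $(A,\omega)$ is simple if $\omega\neq0$ and its only ideals are $0$ and $A$. $\langle1\rangle$ is the line spanned by the constant $1$; $\Delta$ is regarded as an operator on $U$ (the constant acting by scalar multiplication) and as the induced operator on $U/\langle1\rangle$. *)

theory Defs
  imports "Jordan_Normal_Form.VS_Connect" "HOL-Library.Poly_Mapping" "HOL-Algebra.QuotRing"
begin

section \<open>Spaces of linear maps and quotient spaces\<close>

text \<open>
  Vector spaces are \<^typ>\<open>('a, 'b) module\<close> records, with dimension and span taken from the
  locales for modules and vector spaces.  As usual for such records, the fields
  \<open>mult\<close> and \<open>one\<close> are irrelevant for a vector space and left undefined.
\<close>

text \<open>
  Linear maps are taken extensional, i.e. \<^const>\<open>undefined\<close> outside the carrier, so that two
  of them are equal iff they agree on the carrier.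
\<close>

definition End_space ::
    "('a, 'c) ring_scheme \<Rightarrow> ('a, 'b, 'd) module_scheme \<Rightarrow> ('a, 'b \<Rightarrow> 'b) module" where
  "End_space K V =
     \<lparr> carrier = LinearCombinations.module_hom K V V \<inter> extensional (carrier V),
       mult = undefined, one = undefined,
       zero = (\<lambda>v\<in>carrier V. \<zero>\<^bsub>V\<^esub>),
       add = (\<lambda>f g. \<lambda>v\<in>carrier V. f v \<oplus>\<^bsub>V\<^esub> g v),
       smult = (\<lambda>c f. \<lambda>v\<in>carrier V. c \<odot>\<^bsub>V\<^esub> f v) \<rparr>"

definition quot_space :: "('a, 'b, 'd) module_scheme \<Rightarrow> 'b set \<Rightarrow> ('a, 'b set) module" where
  "quot_space V W =
     \<lparr> carrier = a_rcosets\<^bsub>V\<^esub> W,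
       mult = undefined, one = undefined,
       zero = W,
       add = set_add V,
       smult = (\<lambda>c A. \<Union>a\<in>A. W +>\<^bsub>V\<^esub> (c \<odot>\<^bsub>V\<^esub> a)) \<rparr>"

text \<open>
  \<^const>\<open>vectorspace.dim\<close> is a least number and says nothing about spaces without a finite
  generating set, hence the explicit finiteness condition.
\<close>

definition has_dim :: "('a, 'c) ring_scheme \<Rightarrow> ('a, 'b, 'd) module_scheme \<Rightarrow> nat \<Rightarrow> bool" where
  "has_dim K V d \<longleftrightarrow>
     vectorspace K V \<and> vectorspace.fin_dim K V \<and> vectorspace.dim K V = d"


section \<open>\<open>n\<close>-Lie algebras\<close>

text \<open>
  An \<open>n\<close>-ary operation \<open>\<omega>\<close> is a function on lists; only its values on lists of length \<open>n\<close>
  over the carrier matter.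
\<close>

definition args :: "('b, 'c) partial_object_scheme \<Rightarrow> nat \<Rightarrow> 'b list set" where
  "args V n = {as. length as = n \<and> set as \<subseteq> carrier V}"

definition multilinear_op ::
    "('a, 'c) ring_scheme \<Rightarrow> ('a, 'b, 'd) module_scheme \<Rightarrow> nat \<Rightarrow> ('b list \<Rightarrow> 'b) \<Rightarrow> bool" where
  "multilinear_op K V n \<omega> \<longleftrightarrow>
     (\<forall>as\<in>args V n. \<omega> as \<in> carrier V) \<and>
     (\<forall>as\<in>args V n. \<forall>i<n. \<forall>x\<in>carrier V. \<forall>y\<in>carrier V.
        \<omega> (as[i := x \<oplus>\<^bsub>V\<^esub> y]) = \<omega> (as[i := x]) \<oplus>\<^bsub>V\<^esub> \<omega> (as[i := y])) \<and>
     (\<forall>as\<in>args V n. \<forall>i<n. \<forall>c\<in>carrier K. \<forall>x\<in>carrier V.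
        \<omega> (as[i := c \<odot>\<^bsub>V\<^esub> x]) = c \<odot>\<^bsub>V\<^esub> \<omega> (as[i := x]))"

definition skew_symmetric_op ::
    "('a, 'b, 'd) module_scheme \<Rightarrow> nat \<Rightarrow> ('b list \<Rightarrow> 'b) \<Rightarrow> bool" where
  "skew_symmetric_op V n \<omega> \<longleftrightarrow>
     (\<forall>as\<in>args V n. \<forall>i<n. \<forall>j<n. i \<noteq> j \<longrightarrow>
        \<omega> (as[i := as ! j, j := as ! i]) = \<ominus>\<^bsub>V\<^esub> \<omega> as)"

definition derivations ::
    "('a, 'c) ring_scheme \<Rightarrow> ('a, 'b, 'd) module_scheme \<Rightarrow> nat \<Rightarrow> ('b list \<Rightarrow> 'b) \<Rightarrow> ('b \<Rightarrow> 'b) set" where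
  "derivations K V n \<omega> =
     {D \<in> carrier (End_space K V).
        \<forall>as\<in>args V n. D (\<omega> as) = (\<Oplus>\<^bsub>V\<^esub>i\<in>{..<n}. \<omega> (as[i := D (as ! i)]))}"

definition left_mult ::
    "('b, 'c) partial_object_scheme \<Rightarrow> ('b list \<Rightarrow> 'b) \<Rightarrow> 'b list \<Rightarrow> 'b \<Rightarrow> 'b" where
  "left_mult V \<omega> as = (\<lambda>a\<in>carrier V. \<omega> (as @ [a]))"

definition n_lie_algebra ::
    "('a, 'c) ring_scheme \<Rightarrow> ('a, 'b, 'd) module_scheme \<Rightarrow> nat \<Rightarrow> ('b list \<Rightarrow> 'b) \<Rightarrow> bool" where
  "n_lie_algebra K V n \<omega> \<longleftrightarrow>
     vectorspace K V \<and> multilinear_op K V n \<omega> \<and> skew_symmetric_op V n \<omega> \<and>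
     (\<forall>as\<in>args V (n - 1). left_mult V \<omega> as \<in> derivations K V n \<omega>)"

definition Der_space ::
    "('a, 'c) ring_scheme \<Rightarrow> ('a, 'b, 'd) module_scheme \<Rightarrow> nat \<Rightarrow> ('b list \<Rightarrow> 'b)
      \<Rightarrow> ('a, 'b \<Rightarrow> 'b) module" where
  "Der_space K V n \<omega> = (End_space K V)\<lparr>carrier := derivations K V n \<omega>\<rparr>"

definition interior_derivations ::
    "('a, 'c) ring_scheme \<Rightarrow> ('a, 'b, 'd) module_scheme \<Rightarrow> nat \<Rightarrow> ('b list \<Rightarrow> 'b) \<Rightarrow> ('b \<Rightarrow> 'b) set" where
  "interior_derivations K V n \<omega> =
     LinearCombinations.module.span K (End_space K V) (left_mult V \<omega> ` args V (n - 1))"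

definition Out_space ::
    "('a, 'c) ring_scheme \<Rightarrow> ('a, 'b, 'd) module_scheme \<Rightarrow> nat \<Rightarrow> ('b list \<Rightarrow> 'b)
      \<Rightarrow> ('a, ('b \<Rightarrow> 'b) set) module" where
  "Out_space K V n \<omega> = quot_space (Der_space K V n \<omega>) (interior_derivations K V n \<omega>)"

definition outer_class ::
    "('a, 'c) ring_scheme \<Rightarrow> ('a, 'b, 'd) module_scheme \<Rightarrow> nat \<Rightarrow> ('b list \<Rightarrow> 'b)
      \<Rightarrow> ('b \<Rightarrow> 'b) \<Rightarrow> ('b \<Rightarrow> 'b) set" where
  "outer_class K V n \<omega> D = interior_derivations K V n \<omega> +>\<^bsub>Der_space K V n \<omega>\<^esub> D"

definition center :: "('a, 'b, 'd) module_scheme \<Rightarrow> nat \<Rightarrow> ('b list \<Rightarrow> 'b) \<Rightarrow> 'b set" where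
  "center V n \<omega> = {z \<in> carrier V. \<forall>as\<in>args V (n - 1). \<omega> (z # as) = \<zero>\<^bsub>V\<^esub>}"

definition n_lie_ideal ::
    "('a, 'c) ring_scheme \<Rightarrow> ('a, 'b, 'd) module_scheme \<Rightarrow> nat \<Rightarrow> ('b list \<Rightarrow> 'b) \<Rightarrow> 'b set \<Rightarrow> bool" where
  "n_lie_ideal K V n \<omega> J \<longleftrightarrow>
     VectorSpace.subspace K J V \<and> (\<forall>z\<in>J. \<forall>as\<in>args V (n - 1). \<omega> (z # as) \<in> J)"

definition simple_n_lie_algebra ::
    "('a, 'c) ring_scheme \<Rightarrow> ('a, 'b, 'd) module_scheme \<Rightarrow> nat \<Rightarrow> ('b list \<Rightarrow> 'b) \<Rightarrow> bool" where
  "simple_n_lie_algebra K V n \<omega> \<longleftrightarrow>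
     n_lie_algebra K V n \<omega> \<and>
     (\<exists>as\<in>args V n. \<omega> as \<noteq> \<zero>\<^bsub>V\<^esub>) \<and>
     (\<forall>J. n_lie_ideal K V n \<omega> J \<longrightarrow> J = {\<zero>\<^bsub>V\<^esub>} \<or> J = carrier V)"

text \<open>
  Operations and maps induced on cosets, in the style of \<^const>\<open>rcoset_mult\<close>: the union
  runs over all choices of representatives, and is a single coset exactly if the result does
  not depend on that choice.
\<close>

definition factor_op ::
    "('a, 'b, 'd) module_scheme \<Rightarrow> 'b set \<Rightarrow> ('b list \<Rightarrow> 'b) \<Rightarrow> 'b set list \<Rightarrow> 'b set" where
  "factor_op V J \<omega> As = (\<Union>as\<in>listset As. J +>\<^bsub>V\<^esub> \<omega> as)"

definition factor_map ::
    "('a, 'b, 'd) module_scheme \<Rightarrow> 'b set \<Rightarrow> ('b \<Rightarrow> 'b) \<Rightarrow> 'b set \<Rightarrow> 'b set" where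
  "factor_map V J D = (\<lambda>A\<in>a_rcosets\<^bsub>V\<^esub> J. \<Union>a\<in>A. J +>\<^bsub>V\<^esub> D a)"


section \<open>The Jacobian algebra of polynomials\<close>

text \<open>
  A polynomial is a finitely supported map from exponent vectors to coefficients.  The variables
  \<open>x\<^sub>1, \<dots>, x\<^sub>n\<close> are indexed here by \<open>0, \<dots>, n - 1\<close>.
\<close>

type_synonym 'k mpoly = "(nat \<Rightarrow>\<^sub>0 nat) \<Rightarrow>\<^sub>0 'k"

definition const_poly :: "'k::field \<Rightarrow> 'k mpoly" where
  "const_poly c = Poly_Mapping.single 0 c"

definition var_poly :: "nat \<Rightarrow> 'k::field mpoly" where
  "var_poly i = Poly_Mapping.single (Poly_Mapping.single i 1) 1"

definition poly_space :: "nat \<Rightarrow> ('k::field, 'k mpoly) module" where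
  "poly_space n =
     \<lparr> carrier = {p. \<forall>m\<in>Poly_Mapping.keys p. Poly_Mapping.keys m \<subseteq> {..<n}},
       mult = (*), one = 1, zero = 0, add = (+),
       smult = (\<lambda>c p. const_poly c * p) \<rparr>"

text \<open>
  If \<open>x\<^sub>i\<close> does not occur in the monomial \<open>m\<close>, the truncated difference is harmless, since
  the coefficient vanishes.
\<close>

definition pdiff :: "nat \<Rightarrow> 'k::field mpoly \<Rightarrow> 'k mpoly" where
  "pdiff i p =
     (\<Sum>m\<in>Poly_Mapping.keys p.
        Poly_Mapping.single (m - Poly_Mapping.single i 1)
          (of_nat (Poly_Mapping.lookup m i) * Poly_Mapping.lookup p m))"

definition Jac :: "nat \<Rightarrow> 'k::field mpoly list \<Rightarrow> 'k mpoly" where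
  "Jac n us = Determinant.det (mat n n (\<lambda>(i, j). pdiff i (us ! j)))"

definition Delta :: "nat \<Rightarrow> 'k::field mpoly \<Rightarrow> 'k mpoly" where
  "Delta n = (\<lambda>u\<in>carrier (poly_space n).
     (\<Sum>i<n. var_poly i * pdiff i u) + const_poly (of_nat n * inverse (1 - of_nat n)) * u)"

end

theory Submission
  imports Defs
begin

text \<open>
  Write \<open>B\<^sub>i\<^sub>j f u = \<partial>\<^sub>i f \<partial>\<^sub>j u - \<partial>\<^sub>j f \<partial>\<^sub>i u\<close>; up to sign this is left multiplication by \<open>f\<close> and the
  variables other than \<open>x\<^sub>i, x\<^sub>j\<close>.  A vector field \<open>X = \<Sum>s\<^sub>i \<partial>\<^sub>i\<close> satisfies
  \<open>X (Jac u) = \<Sum>\<^sub>j Jac (\<dots>, X u\<^sub>j, \<dots>) - div X \<cdot> Jac u\<close>.  By the Piola identity every left multiplication is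
  a vector field of divergence zero, and integrating one component at a time writes every such field
  as a sum of fields \<open>B\<^sub>i\<^sub>j f\<close>; hence the interior derivations are exactly the polynomial vector fields
  of divergence zero.

  For a linear map \<open>D\<close> that is a derivation modulo constants, evaluating it on \<open>Jac (x\<^sub>1, \<dots>, x\<^sub>n) = 1\<close>
  shows that \<open>\<Sum>\<partial>\<^sub>i (D x\<^sub>i)\<close> is a constant, so after subtracting a vector field and a multiple of \<open>\<Delta>\<close>
  one has \<open>D x\<^sub>i = 0\<close>.  Then \<open>D\<close> commutes with every \<open>\<partial>\<^sub>i\<close> modulo constants; subtracting a constant
  vector field also makes \<open>D (x\<^sub>i\<^sup>2 / 2)\<close> constant, after which \<open>D\<close> commutes with the operators \<open>x\<^sub>i \<partial>\<^sub>j\<close>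
  as well and has only constant values, by induction on the degree.  Derivations of the factor algebra
  lift to derivations modulo constants, so this settles both algebras.  The class of \<open>\<Delta>\<close> is not zero because
  the vector field part of \<open>\<Delta>\<close> has divergence \<open>n\<close>.
\<close>

section \<open>Partial derivatives\<close>

text \<open>The constant in \<Delta> balances two defects. A scalar \<open>c\<close> acts once on a
  Jacobian but \<open>n\<close> times in the sum over its slots, while a vector field misses the
  Leibniz rule by its divergence; so \<open>X + c\<close> is a derivation once
  \<open>div X = (1 - n) c\<close>. The Euler field has divergence \<open>n\<close>, whence
  \<open>c = n / (1 - n)\<close>. The obstacle is the factor algebra: its derivations lift only to
  linear maps that satisfy the Leibniz rule up to constants, and the classification of such maps is
  itself only up to constants. For the factor algebra this is enough. On the polynomials it improves
  to equality, because every polynomial is a Jacobian and a derivation with constant values sends it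
  to a sum of Jacobians with a constant entry, which is 0. Simplicity needs a separate argument: a
  nonconstant representative of an element of an ideal is differentiated down to a nonconstant
  affine polynomial, a bracket extracts a variable from it, and brackets with that variable give all
  polynomials. Characteristic 0 is used to integrate, and to divide by 2, 3 and
  \<open>1 - n\<close>.\<close>

abbreviation polys :: "nat \<Rightarrow> 'k::field mpoly set" where
  "polys n \<equiv> carrier (poly_space n)"

lemma polys_iff: "p \<in> polys n \<longleftrightarrow> (\<forall>m\<in>Poly_Mapping.keys p. Poly_Mapping.keys m \<subseteq> {..<n})"
  by (simp add: poly_space_def)

text \<open>Additivity of maps defined by sums over \<open>keys\<close> compares three different
  supports; this moves all of them to one common index set.\<close>

lemma sum_keys_superset:
  assumes "finite A" "Poly_Mapping.keys p \<subseteq> A" "\<And>m. f m 0 = 0"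
  shows "(\<Sum>m\<in>Poly_Mapping.keys p. f m (Poly_Mapping.lookup p m)) = (\<Sum>m\<in>A. f m (Poly_Mapping.lookup p m))"
  by (rule sum.mono_neutral_left) (use assms in \<open>auto simp: in_keys_iff\<close>)

lemma pdiff_add: "pdiff i (p + q) = pdiff i p + pdiff i q"
proof -
  let ?A = "Poly_Mapping.keys p \<union> Poly_Mapping.keys q"
  let ?f = "\<lambda>m c. Poly_Mapping.single (m - Poly_Mapping.single i 1) (of_nat (Poly_Mapping.lookup m i) * c)"
  have *: "pdiff i r = (\<Sum>m\<in>?A. ?f m (Poly_Mapping.lookup r m))" if "Poly_Mapping.keys r \<subseteq> ?A" for r
    unfolding pdiff_def by (rule sum_keys_superset) (use that in auto)
  show ?thesis
    using keys_add[of p q]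
    by (simp add: * lookup_add distrib_left single_add sum.distrib)
qed

lemma pdiff_single:
  "pdiff i (Poly_Mapping.single m a) =
     Poly_Mapping.single (m - Poly_Mapping.single i 1) (of_nat (Poly_Mapping.lookup m i) * a)"
  by (cases "a = 0") (auto simp: pdiff_def)

lemma poly_sum_monomials:
  "(\<Sum>m\<in>Poly_Mapping.keys p. Poly_Mapping.single m (Poly_Mapping.lookup p m)) = p"
  by (rule poly_mapping_eqI) (auto simp: lookup_sum lookup_single when_def sum.delta in_keys_iff)

text \<open>Every polynomial is a finite sum of monomials. Cancellation in the target supplies
  \<open>f 0 = 0\<close>, so the same lemma serves maps into polynomials and maps into
  coefficients.\<close>

lemma additive_eqI:
  fixes f g :: "'k::field mpoly \<Rightarrow> 'b::cancel_comm_monoid_add"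
  assumes f: "\<And>p q. f (p + q) = f p + f q" and g: "\<And>p q. g (p + q) = g p + g q"
    and single: "\<And>m a. f (Poly_Mapping.single m a) = g (Poly_Mapping.single m a)"
  shows "f p = g p"
proof -
  have 0: "f 0 = 0" "g 0 = 0" using f[of 0 0] g[of 0 0] by auto
  have "f (\<Sum>m\<in>A. h m) = (\<Sum>m\<in>A. f (h m))" "g (\<Sum>m\<in>A. h m) = (\<Sum>m\<in>A. g (h m))"
    for A :: "(nat \<Rightarrow>\<^sub>0 nat) set" and h
    by (induction A rule: infinite_finite_induct) (auto simp: 0 f g)
  from this[of "\<lambda>m. Poly_Mapping.single m (Poly_Mapping.lookup p m)" "Poly_Mapping.keys p"] single
  show ?thesis by (simp add: poly_sum_monomials)
qed

lemma pdiff_0 [simp]: "pdiff i 0 = 0"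
  by (simp add: pdiff_def)

lemma pdiff_sum: "pdiff i (sum f A) = (\<Sum>a\<in>A. pdiff i (f a))"
  by (induction A rule: infinite_finite_induct) (auto simp: pdiff_add)

lemma pdiff_uminus: "pdiff i (- p) = - pdiff i p"
  by (metis (no_types) add.right_inverse add_eq_0_iff pdiff_0 pdiff_add)

lemma pdiff_diff: "pdiff i (p - q) = pdiff i p - pdiff i q"
  using pdiff_add[of i p "- q"] by (simp add: pdiff_uminus)

lemma shift_add_left:
  fixes m k :: "nat \<Rightarrow>\<^sub>0 nat"
  assumes "Poly_Mapping.lookup m i \<noteq> 0"
  shows "m - Poly_Mapping.single i 1 + k = m + k - Poly_Mapping.single i 1"
  using assms by (intro poly_mapping_eqI) (auto simp: lookup_add lookup_minus lookup_single when_def)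

lemma pdiff_mult: "pdiff i (p * q) = pdiff i p * q + p * pdiff i q"
proof (rule additive_eqI[of "\<lambda>p. pdiff i (p * q)" "\<lambda>p. pdiff i p * q + p * pdiff i q"], goal_cases)
  case (3 m a)
  show ?case
  proof (rule additive_eqI[of "\<lambda>q. pdiff i (Poly_Mapping.single m a * q)"
        "\<lambda>q. pdiff i (Poly_Mapping.single m a) * q + Poly_Mapping.single m a * pdiff i q"], goal_cases)
    case (3 k b)
    have 1: "m - Poly_Mapping.single i 1 + k = m + k - Poly_Mapping.single i 1"
      if "Poly_Mapping.lookup m i \<noteq> 0"
      using shift_add_left[OF that] .
    have 2: "m + (k - Poly_Mapping.single i 1) = m + k - Poly_Mapping.single i 1"
      if "Poly_Mapping.lookup k i \<noteq> 0"
      using shift_add_left[OF that, of m] by (simp add: add.commute)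
    \<comment> \<open>If the exponent of \<open>x_i\<close> in a factor is 0, the coefficient
      \<open>of_nat 0\<close> removes the corresponding term; otherwise the truncated subtraction is
      exact and the shift laws apply.\<close>
    show ?case
      unfolding mult_single pdiff_single lookup_add
      using 1 2
      by (cases "Poly_Mapping.lookup m i = 0"; cases "Poly_Mapping.lookup k i = 0")
        (auto simp: single_add[symmetric] algebra_simps)
  qed (simp_all add: distrib_left distrib_right pdiff_add algebra_simps)
qed (simp_all add: distrib_left distrib_right pdiff_add algebra_simps)

lemma pdiff_const_poly [simp]: "pdiff i (const_poly c) = 0"
  by (simp add: const_poly_def pdiff_single)

lemma const_poly_1 [simp]: "const_poly 1 = 1"
  by (simp add: const_poly_def)

lemma const_poly_0 [simp]: "const_poly 0 = 0"
  by (simp add: const_poly_def)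

lemma const_poly_add: "const_poly (a + b) = const_poly a + const_poly b"
  by (simp add: const_poly_def single_add)

lemma const_poly_mult: "const_poly (a * b) = const_poly a * const_poly b"
  by (simp add: const_poly_def mult_single)

lemma const_poly_uminus: "const_poly (- a) = - const_poly a"
  by (simp add: const_poly_def single_uminus)

lemma const_poly_diff: "const_poly (a - b) = const_poly a - const_poly b"
  by (simp add: const_poly_def single_diff)

lemma const_poly_of_nat: "const_poly (of_nat k) = of_nat k"
  by (simp add: const_poly_def single_of_nat)

lemma const_poly_eq_iff [simp]: "const_poly a = const_poly b \<longleftrightarrow> a = b"
  unfolding const_poly_def by (metis lookup_single_eq)

lemma const_poly_eq_0_iff [simp]: "const_poly a = 0 \<longleftrightarrow> a = 0"
  using const_poly_eq_iff[of a 0] by (simp del: const_poly_eq_iff)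

lemma pdiff_1 [simp]: "pdiff i 1 = 0"
  using pdiff_const_poly[of i 1] by simp

lemma pdiff_const_mult: "pdiff i (const_poly c * p) = const_poly c * pdiff i p"
  by (simp add: pdiff_mult)

lemma pdiff_var: "pdiff i (var_poly j) = (if i = j then 1 else 0)"
  by (auto simp: var_poly_def pdiff_single lookup_single)

lemma pdiff_commute: "pdiff i (pdiff j p) = pdiff j (pdiff i p)"
proof (rule additive_eqI[of "\<lambda>p. pdiff i (pdiff j p)" "\<lambda>p. pdiff j (pdiff i p)"], goal_cases)
  case (3 m a)
  have "m - Poly_Mapping.single j 1 - Poly_Mapping.single i 1 =
      m - Poly_Mapping.single i 1 - Poly_Mapping.single j 1"
    by (rule poly_mapping_eqI) (auto simp: lookup_minus)
  then show ?case
    by (cases "i = j") (auto simp: pdiff_single lookup_minus lookup_single algebra_simps)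
qed (simp_all add: pdiff_add)

lemma keys_pdiff:
  "Poly_Mapping.keys (pdiff i p) \<subseteq>
     (\<lambda>m. m - Poly_Mapping.single i 1) ` {m \<in> Poly_Mapping.keys p. Poly_Mapping.lookup m i \<noteq> 0}"
proof
  fix k assume "k \<in> Poly_Mapping.keys (pdiff i p)"
  then have "(\<Sum>m\<in>Poly_Mapping.keys p. Poly_Mapping.lookup
      (Poly_Mapping.single (m - Poly_Mapping.single i 1) (of_nat (Poly_Mapping.lookup m i) * Poly_Mapping.lookup p m)) k) \<noteq> 0"
    by (simp add: pdiff_def in_keys_iff lookup_sum)
  then obtain m where "m \<in> Poly_Mapping.keys p" "Poly_Mapping.lookup
      (Poly_Mapping.single (m - Poly_Mapping.single i 1) (of_nat (Poly_Mapping.lookup m i) * Poly_Mapping.lookup p m)) k \<noteq> 0"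
    by (meson sum.neutral)
  then have "k = m - Poly_Mapping.single i 1" "Poly_Mapping.lookup m i \<noteq> 0"
    by (auto simp: lookup_single when_def split: if_splits intro: ccontr)
  with \<open>m \<in> Poly_Mapping.keys p\<close>
  show "k \<in> (\<lambda>m. m - Poly_Mapping.single i 1) ` {m \<in> Poly_Mapping.keys p. Poly_Mapping.lookup m i \<noteq> 0}"
    by blast
qed

subsection \<open>Closure of the polynomial ring in \<open>n\<close> variables\<close>

lemma polys_0 [simp]: "0 \<in> polys n"
  by (simp add: polys_iff)

lemma polys_const [simp]: "const_poly c \<in> polys n"
  by (simp add: polys_iff const_poly_def)

lemma polys_1 [simp]: "1 \<in> polys n"
  using polys_const[of 1 n] by simp

lemma polys_var [simp]: "i < n \<Longrightarrow> var_poly i \<in> polys n"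
  by (simp add: polys_iff var_poly_def)

lemma polys_add: "p \<in> polys n \<Longrightarrow> q \<in> polys n \<Longrightarrow> p + q \<in> polys n"
  unfolding polys_iff using keys_add[of p q] by blast

lemma polys_mult: "p \<in> polys n \<Longrightarrow> q \<in> polys n \<Longrightarrow> p * q \<in> polys n"
proof -
  assume pq: "p \<in> polys n" "q \<in> polys n"
  show ?thesis
    unfolding polys_iff
  proof
    fix m assume "m \<in> Poly_Mapping.keys (p * q)"
    then obtain a b where "m = a + b" "a \<in> Poly_Mapping.keys p" "b \<in> Poly_Mapping.keys q"
      using keys_mult[of p q] by blast
    with pq keys_add[of a b] show "Poly_Mapping.keys m \<subseteq> {..<n}"
      unfolding polys_iff by blast
  qed
qed

lemma polys_uminus: "p \<in> polys n \<Longrightarrow> - p \<in> polys n"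
  by (simp add: polys_iff in_keys_iff)

lemma polys_diff: "p \<in> polys n \<Longrightarrow> q \<in> polys n \<Longrightarrow> p - q \<in> polys n"
  using polys_add[of p n "- q"] polys_uminus by auto

lemma polys_sum: "(\<And>a. a \<in> A \<Longrightarrow> f a \<in> polys n) \<Longrightarrow> sum f A \<in> polys n"
  by (induction A rule: infinite_finite_induct) (auto intro: polys_add)

lemma polys_prod: "(\<And>a. a \<in> A \<Longrightarrow> f a \<in> polys n) \<Longrightarrow> prod f A \<in> polys n"
  by (induction A rule: infinite_finite_induct) (auto intro: polys_mult)

lemma polys_pdiff: "p \<in> polys n \<Longrightarrow> pdiff i p \<in> polys n"
proof -
  assume p: "p \<in> polys n"
  have "Poly_Mapping.keys (m - Poly_Mapping.single i 1) \<subseteq> Poly_Mapping.keys m" for m :: "nat \<Rightarrow>\<^sub>0 nat"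
    by (auto simp: in_keys_iff lookup_minus)
  with p keys_pdiff[of i p] show ?thesis
    unfolding polys_iff by blast
qed

lemmas polys_closed = polys_add polys_mult polys_uminus polys_diff polys_sum polys_prod polys_pdiff

text \<open>Reading the coefficient at \<open>m\<close> from the one at the raised exponent avoids
  truncated subtraction.\<close>

lemma lookup_pdiff:
  "Poly_Mapping.lookup (pdiff i p) m =
     of_nat (Suc (Poly_Mapping.lookup m i)) * Poly_Mapping.lookup p (m + Poly_Mapping.single i 1)"
proof (rule additive_eqI[of "\<lambda>p. Poly_Mapping.lookup (pdiff i p) m"
      "\<lambda>p. of_nat (Suc (Poly_Mapping.lookup m i)) * Poly_Mapping.lookup p (m + Poly_Mapping.single i 1)"], goal_cases)
  case (3 k a)
  show ?case
  proof (cases "Poly_Mapping.lookup k i = 0")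
    case True
    then have "k \<noteq> m + Poly_Mapping.single i 1" by (auto simp: lookup_add)
    with True show ?thesis by (simp add: pdiff_single lookup_single)
  next
    case False
    then have "k = k - Poly_Mapping.single i 1 + Poly_Mapping.single i 1"
      by (intro poly_mapping_eqI) (auto simp: lookup_add lookup_minus lookup_single when_def)
    then have "k - Poly_Mapping.single i 1 = m \<longleftrightarrow> k = m + Poly_Mapping.single i 1"
      by (metis add_diff_cancel_right')
    then show ?thesis
      by (auto simp: pdiff_single lookup_single when_def lookup_add)
  qed
qed (simp_all add: pdiff_add lookup_add algebra_simps)

lemma const_if_pdiff_0:
  fixes p :: "'k::field_char_0 mpoly"
  assumes "p \<in> polys n" and 0: "\<And>i. i < n \<Longrightarrow> pdiff i p = 0"
  shows "p \<in> range const_poly"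
proof -
  have "Poly_Mapping.lookup p m = 0" if m0: "m \<noteq> 0" for m
  proof (rule ccontr)
    assume m: "Poly_Mapping.lookup p m \<noteq> 0"
    obtain i where i: "i \<in> Poly_Mapping.keys m" using m0 by (auto simp: poly_mapping_eq_iff fun_eq_iff in_keys_iff)
    with m assms(1) have "i < n" unfolding polys_iff by (metis in_keys_iff lessThan_iff subsetD)
    \<comment> \<open>The coefficient of the derivative at the lowered exponent is a positive
      integer times the nonzero coefficient at \<open>m\<close>, hence nonzero in characteristic
      0.\<close>
    let ?k = "m - Poly_Mapping.single i 1"
    have "?k + Poly_Mapping.single i 1 = m"
      using i by (intro poly_mapping_eqI) (auto simp: lookup_add lookup_minus lookup_single when_def in_keys_iff)
    with lookup_pdiff[of i p ?k] 0[OF \<open>i < n\<close>] m show False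
      by (simp del: of_nat_Suc)
  qed
  then have "p = const_poly (Poly_Mapping.lookup p 0)"
    unfolding const_poly_def by (intro poly_mapping_eqI) (auto simp: lookup_single when_def)
  then show ?thesis by blast
qed

subsection \<open>Antiderivatives\<close>

text \<open>The antiderivative in \<open>x_i\<close> all of whose monomials contain
  \<open>x_i\<close>. Fixing the integration constant in this way makes it additive and lets it
  commute with the other partial derivatives.\<close>

definition antideriv :: "nat \<Rightarrow> 'k::field mpoly \<Rightarrow> 'k mpoly" where
  "antideriv i p = (\<Sum>m\<in>Poly_Mapping.keys p. Poly_Mapping.single (m + Poly_Mapping.single i 1)
     (Poly_Mapping.lookup p m / of_nat (Suc (Poly_Mapping.lookup m i))))"

lemma antideriv_single:
  "antideriv i (Poly_Mapping.single m a) =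
     Poly_Mapping.single (m + Poly_Mapping.single i 1) (a / of_nat (Suc (Poly_Mapping.lookup m i)))"
  by (cases "a = 0") (auto simp: antideriv_def)

lemma antideriv_add: "antideriv i (p + q) = antideriv i p + antideriv i q"
proof -
  let ?A = "Poly_Mapping.keys p \<union> Poly_Mapping.keys q"
  let ?f = "\<lambda>m c. Poly_Mapping.single (m + Poly_Mapping.single i 1) (c / of_nat (Suc (Poly_Mapping.lookup m i)))"
  have *: "antideriv i r = (\<Sum>m\<in>?A. ?f m (Poly_Mapping.lookup r m))" if "Poly_Mapping.keys r \<subseteq> ?A" for r
    unfolding antideriv_def by (rule sum_keys_superset) (use that in auto)
  show ?thesis
    using keys_add[of p q]
    by (simp add: * lookup_add add_divide_distrib single_add sum.distrib)
qed

lemma antideriv_0 [simp]: "antideriv i 0 = 0"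
  by (simp add: antideriv_def)

lemma polys_antideriv: "i < n \<Longrightarrow> p \<in> polys n \<Longrightarrow> antideriv i p \<in> polys n"
  unfolding antideriv_def
proof (rule polys_sum, goal_cases)
  case (1 m)
  then show ?case
    using keys_add[of m "Poly_Mapping.single i 1"] by (auto simp: polys_iff split: if_splits)
qed

lemma pdiff_antideriv:
  fixes p :: "'k::field_char_0 mpoly"
  shows "pdiff i (antideriv i p) = p"
proof (rule additive_eqI[of "\<lambda>p. pdiff i (antideriv i p)" "\<lambda>p. p"], goal_cases)
  case (3 m a)
  show ?case by (simp add: antideriv_single pdiff_single lookup_add del: of_nat_Suc)
qed (simp_all add: pdiff_add antideriv_add)

lemma pdiff_antideriv_other:
  assumes "i \<noteq> j"
  shows "pdiff j (antideriv i p) = antideriv i (pdiff j p)"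
proof (rule additive_eqI[of "\<lambda>p. pdiff j (antideriv i p)" "\<lambda>p. antideriv i (pdiff j p)"], goal_cases)
  case (3 m a)
  have *: "m + Poly_Mapping.single i 1 - Poly_Mapping.single j 1 = m - Poly_Mapping.single j 1 + Poly_Mapping.single i 1"
    using assms by (intro poly_mapping_eqI) (auto simp: lookup_add lookup_minus lookup_single when_def)
  have **: "Poly_Mapping.lookup (m + Poly_Mapping.single i 1) j = Poly_Mapping.lookup m j"
    "Poly_Mapping.lookup (m - Poly_Mapping.single j 1) i = Poly_Mapping.lookup m i"
    using assms by (auto simp: lookup_add lookup_minus lookup_single)
  show ?case
    unfolding antideriv_single pdiff_single * ** by simp
qed (simp_all add: pdiff_add antideriv_add)

section \<open>Determinants as functions of their rows\<close>

text \<open>With rows given by a function, replacing a row is a function update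
  \<open>R(i := v)\<close>, and multilinearity can be stated in that form.\<close>

definition rdet :: "nat \<Rightarrow> (nat \<Rightarrow> nat \<Rightarrow> 'a::comm_ring_1) \<Rightarrow> 'a" where
  "rdet n R = Determinant.det (mat n n (\<lambda>(i, j). R i j))"

definition rcof :: "nat \<Rightarrow> (nat \<Rightarrow> nat \<Rightarrow> 'a::comm_ring_1) \<Rightarrow> nat \<Rightarrow> nat \<Rightarrow> 'a" where
  "rcof n R i j = cofactor (mat n n (\<lambda>(i, j). R i j)) i j"

text \<open>As a family of rows this is the identity matrix, so \<open>unit_row(j := w)\<close> is
  the identity with one row replaced.\<close>

definition unit_row :: "nat \<Rightarrow> nat \<Rightarrow> 'a::comm_ring_1" where
  "unit_row i j = (if j = i then 1 else 0)"

lemma rdet_cong: "(\<And>i j. i < n \<Longrightarrow> j < n \<Longrightarrow> R i j = R' i j) \<Longrightarrow> rdet n R = rdet n R'"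
  unfolding rdet_def by (intro arg_cong[where f = Determinant.det] cong_mat) auto

lemma rdet_leibniz:
  "rdet n R = (\<Sum>p | p permutes {0..<n}. signof p * (\<Prod>i = 0..<n. R i (p i)))"
proof -
  have "rdet n R = (\<Sum>p | p permutes {0..<n}. signof p * (\<Prod>i = 0..<n. mat n n (\<lambda>(i, j). R i j) $$ (i, p i)))"
    unfolding rdet_def by (rule det_def') simp
  also have "\<dots> = (\<Sum>p | p permutes {0..<n}. signof p * (\<Prod>i = 0..<n. R i (p i)))"
    by (intro sum.cong refl arg_cong[where f = "\<lambda>x. _ * x"] prod.cong) (auto dest: permutes_in_image)
  finally show ?thesis .
qed

text \<open>The cofactors along row \<open>i\<close> do not see row \<open>i\<close>, so those of
  \<open>R\<close> serve for every replacement \<open>v\<close>. Linearity in a row follows at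
  once.\<close>

lemma rdet_update:
  assumes "i < n"
  shows "rdet n (R(i := v)) = (\<Sum>j<n. v j * rcof n R i j)"
proof -
  let ?A = "mat n n (\<lambda>(k, j). (R(i := v)) k j)"
  have "rdet n (R(i := v)) = (\<Sum>j<n. ?A $$ (i, j) * cofactor ?A i j)"
    unfolding rdet_def by (rule laplace_expansion_row) (use assms in auto)
  also have "\<dots> = (\<Sum>j<n. v j * rcof n R i j)"
  proof (rule sum.cong, goal_cases)
    case (2 j)
    have "mat_delete ?A i j = mat_delete (mat n n (\<lambda>(k, j). R k j)) i j"
      unfolding mat_delete_def by (intro cong_mat) auto
    then show ?case using 2 assms by (simp add: rcof_def cofactor_def)
  qed simp
  finally show ?thesis .
qed

lemma rdet_update_unit:
  assumes "i < n" "j < n"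
  shows "rdet n (R(i := unit_row j)) = rcof n R i j"
proof -
  have "rdet n (R(i := unit_row j)) = (\<Sum>k<n. if k = j then rcof n R i k else 0)"
    unfolding rdet_update[OF assms(1)] by (rule sum.cong) (auto simp: unit_row_def)
  then show ?thesis using assms by simp
qed

lemma rdet_expand:
  assumes "i < n"
  shows "rdet n (R(i := v)) = (\<Sum>j<n. v j * rdet n (R(i := unit_row j)))"
  unfolding rdet_update[OF assms, of R v] by (rule sum.cong) (use assms in \<open>auto simp: rdet_update_unit\<close>)

lemma rdet_update_add:
  "i < n \<Longrightarrow> rdet n (R(i := (\<lambda>j. v j + w j))) = rdet n (R(i := v)) + rdet n (R(i := w))"
  by (simp add: rdet_update sum.distrib distrib_right)

lemma rdet_update_mult:
  "i < n \<Longrightarrow> rdet n (R(i := (\<lambda>j. c * v j))) = c * rdet n (R(i := v))"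
  by (simp add: rdet_update sum_distrib_left mult.assoc)

lemma rdet_update_zero: "i < n \<Longrightarrow> rdet n (R(i := (\<lambda>j. 0))) = 0"
  by (simp add: rdet_update)

lemma rdet_zero_row:
  assumes "i < n" "\<And>j. j < n \<Longrightarrow> R i j = 0"
  shows "rdet n R = 0"
proof -
  have "rdet n R = rdet n (R(i := (\<lambda>j. 0)))" by (rule rdet_cong) (use assms in auto)
  then show ?thesis using assms by (simp add: rdet_update_zero)
qed

lemma rdet_identical:
  assumes "i < n" "j < n" "i \<noteq> j" "\<And>k. k < n \<Longrightarrow> R i k = R j k"
  shows "rdet n R = 0"
  unfolding rdet_def
  by (rule det_identical_rows[of _ n i j]) (use assms in \<open>auto intro!: eq_vecI\<close>)

text \<open>Polarization: the determinant vanishes when rows \<open>i\<close> and \<open>j\<close>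
  both equal \<open>v + w\<close>, and expanding leaves only the two mixed terms.\<close>

lemma rdet_swap:
  assumes ij: "i < n" "j < n" "i \<noteq> j"
  shows "rdet n (R(i := v, j := w)) = - rdet n (R(i := w, j := v))"
proof -
  let ?s = "\<lambda>j. v j + w j"
  have ji: "j \<noteq> i" using ij by simp
  have *: "rdet n (R(i := x, j := x)) = 0" for x
    by (rule rdet_identical[OF ij]) (use ij in auto)
  have "rdet n (R(i := ?s, j := ?s)) =
     rdet n (R(i := v, j := v)) + rdet n (R(i := w, j := v)) + (rdet n (R(i := v, j := w)) + rdet n (R(i := w, j := w)))"
    unfolding rdet_update_add[OF ij(2)]
    unfolding fun_upd_twist[OF ij(3)] rdet_update_add[OF ij(1)] by simp
  then have "rdet n (R(i := w, j := v)) + rdet n (R(i := v, j := w)) = 0"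
    unfolding * by simp
  then show ?thesis by (simp add: add_eq_0_iff)
qed

lemma rdet_unit: "rdet n unit_row = 1"
proof -
  have "mat n n (\<lambda>(i, j). unit_row i j :: 'a) = 1\<^sub>m n" by (rule eq_matI) (auto simp: unit_row_def)
  then show ?thesis by (simp add: rdet_def)
qed

lemma rdet_unit_update:
  fixes w :: "nat \<Rightarrow> 'a::comm_ring_1"
  assumes "j < n"
  shows "rdet n (unit_row(j := w)) = w j"
proof -
  have "rdet n (unit_row(j := unit_row k)) = (if k = j then 1 else (0 :: 'a))" if "k < n" for k
  proof (cases "k = j")
    case True
    then show ?thesis by (simp add: rdet_unit)
  next
    case False
    have "rdet n (unit_row(j := unit_row k)) = (0 :: 'a)"
      by (rule rdet_identical[of j _ k]) (use assms that False in auto)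
    with False show ?thesis by simp
  qed
  then have "rdet n (unit_row(j := w)) = (\<Sum>k<n. if k = j then w k else 0)"
    unfolding rdet_expand[OF assms, of _ w] by (intro sum.cong) auto
  then show ?thesis using assms by simp
qed

text \<open>Expand row \<open>i\<close> over the unit rows. Only \<open>k = i\<close> and
  \<open>k = j\<close> survive, since any other unit row is already present as row \<open>k\<close>;
  the result is a 2 by 2 minor.\<close>

lemma rdet_unit_update2:
  assumes ij: "i < n" "j < n" "i \<noteq> j"
  shows "rdet n (unit_row(i := v, j := w)) = v i * w j - v j * w i"
proof -
  have "rdet n (unit_row(i := v, j := w)) = (\<Sum>k<n. v k * rdet n (unit_row(j := w, i := unit_row k)))"
    unfolding fun_upd_twist[OF ij(3)] rdet_expand[OF ij(1), of _ v] ..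
  also have "\<dots> = (\<Sum>k<n. (if k = i then v i * w j else 0) + (if k = j then - (v j * w i) else 0))"
  proof (rule sum.cong, goal_cases)
    case (2 k)
    consider "k = i" | "k = j" | "k \<noteq> i" "k \<noteq> j" by blast
    then show ?case
    proof cases
      case 1
      then have "unit_row(j := w, i := unit_row k) = unit_row(j := w)" using ij by auto
      with 1 ij show ?thesis by (simp add: rdet_unit_update)
    next
      case 2
      have "rdet n (unit_row(j := w, i := unit_row j)) = - rdet n (unit_row(j := unit_row j, i := w))"
        by (rule rdet_swap) (use ij in auto)
      also have "\<dots> = - w i" using ij by (simp add: rdet_unit_update)
      finally show ?thesis using 2 ij by simp
    next
      case 3
      have "rdet n (unit_row(j := w, i := unit_row k)) = 0"
        by (rule rdet_identical[of i _ k]) (use ij 2 3 in auto)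
      with 3 show ?thesis by simp
    qed
  qed simp
  also have "\<dots> = v i * w j - v j * w i"
    unfolding sum.distrib using ij by simp
  finally show ?thesis .
qed

section \<open>Derivations applied to determinants, and the trace identity\<close>

lemma derivation_prod:
  fixes d :: "'a::comm_ring_1 \<Rightarrow> 'a"
  assumes d1: "d 1 = 0" and mult: "\<And>a b. d (a * b) = d a * b + a * d b" and "finite A"
  shows "d (prod f A) = (\<Sum>i\<in>A. d (f i) * prod f (A - {i}))"
  using \<open>finite A\<close>
proof (induction A rule: finite_induct)
  case (insert x A)
  have "d (prod f (insert x A)) = d (f x) * prod f A + f x * (\<Sum>i\<in>A. d (f i) * prod f (A - {i}))"
    using insert by (simp add: mult)
  also have "f x * (\<Sum>i\<in>A. d (f i) * prod f (A - {i})) = (\<Sum>i\<in>A. d (f i) * prod f (insert x A - {i}))"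
    unfolding sum_distrib_left
  proof (rule sum.cong, goal_cases)
    case (2 i)
    with insert have "insert x A - {i} = insert x (A - {i})" by auto
    with insert show ?case by (simp add: algebra_simps)
  qed simp
  finally show ?case using insert by simp
qed (simp add: d1)

text \<open>The product rule on each term of the Leibniz formula, regrouped by the row that is
  differentiated. The derivation is kept abstract because both \<open>pdiff k\<close> and
  \<open>vfield n s\<close> are substituted for it.\<close>

lemma derivation_rdet:
  fixes d :: "'a::comm_ring_1 \<Rightarrow> 'a"
  assumes add: "\<And>a b. d (a + b) = d a + d b" and mult: "\<And>a b. d (a * b) = d a * b + a * d b"
  shows "d (rdet n R) = (\<Sum>i<n. rdet n (R(i := (\<lambda>j. d (R i j)))))"
proof -
  have d0: "d 0 = 0" using add[of 0 0] by simp
  have d1: "d 1 = 0" using mult[of 1 1] by simp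
  have dm: "d (- a) = - d a" for a using add[of a "- a"] d0 by (simp add: eq_neg_iff_add_eq_0 add.commute)
  have dsum: "d (sum f A) = (\<Sum>a\<in>A. d (f a))" for f and A :: "'c set"
    by (induction A rule: infinite_finite_induct) (auto simp: d0 add)
  \<comment> \<open>A sign is 1 or -1, so additivity of \<open>d\<close> suffices.\<close>
  have dsign: "d (signof p * a) = signof p * d a" for p :: "nat \<Rightarrow> nat" and a
    by (auto simp: sign_def dm)
  have "d (rdet n R) = (\<Sum>p | p permutes {0..<n}. \<Sum>i = 0..<n. signof p * (d (R i (p i)) * (\<Prod>k\<in>{0..<n} - {i}. R k (p k))))"
    unfolding rdet_leibniz dsum dsign
    by (intro sum.cong refl) (simp add: derivation_prod[of d, OF d1 mult] sum_distrib_left)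
  also have "\<dots> = (\<Sum>i = 0..<n. \<Sum>p | p permutes {0..<n}. signof p * (d (R i (p i)) * (\<Prod>k\<in>{0..<n} - {i}. R k (p k))))"
    by (rule sum.swap)
  also have "\<dots> = (\<Sum>i = 0..<n. rdet n (R(i := (\<lambda>j. d (R i j)))))"
  proof (rule sum.cong, goal_cases)
    case (2 i)
    have "(\<Prod>k = 0..<n. (R(i := (\<lambda>j. d (R i j)))) k (p k)) = d (R i (p i)) * (\<Prod>k\<in>{0..<n} - {i}. R k (p k))" for p
    proof -
      have "(\<Prod>k\<in>{0..<n} - {i}. (R(i := (\<lambda>j. d (R i j)))) k (p k)) = (\<Prod>k\<in>{0..<n} - {i}. R k (p k))"
        by (rule prod.cong) auto
      then show ?thesis using 2 by (simp add: prod.remove[of "{0..<n}" i])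
    qed
    then show ?case unfolding rdet_leibniz by (intro sum.cong) auto
  qed simp
  finally show ?thesis by (simp add: lessThan_atLeast0)
qed

text \<open>Expanding along the rows, this is \<open>tr (F adj(R) R) = tr F \<cdot> det R\<close>.\<close>

lemma rdet_trace:
  "(\<Sum>i<n. rdet n (R(i := (\<lambda>j. \<Sum>k<n. F j k * R i k)))) = (\<Sum>j<n. F j j) * rdet n R"
proof -
  let ?A = "mat n n (\<lambda>(i, j). R i j)"
  have adj: "(\<Sum>i<n. rcof n R i j * R i k) = (if j = k then rdet n R else 0)" if "j < n" "k < n" for j k
  proof -
    have "(adj_mat ?A * ?A) $$ (j, k) = (\<Sum>i<n. rcof n R i j * R i k)"
      using that by (simp add: adj_mat_def scalar_prod_def rcof_def lessThan_atLeast0)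
    moreover have "adj_mat ?A * ?A = rdet n R \<cdot>\<^sub>m 1\<^sub>m n"
      unfolding rdet_def by (rule adj_mat) simp
    ultimately show ?thesis using that by auto
  qed
  have "(\<Sum>i<n. rdet n (R(i := (\<lambda>j. \<Sum>k<n. F j k * R i k)))) =
      (\<Sum>i<n. \<Sum>j<n. \<Sum>k<n. F j k * (rcof n R i j * R i k))"
    by (intro sum.cong refl)
      (simp add: rdet_update sum_distrib_right mult.assoc mult.commute[of "rcof _ _ _ _"])
  also have "\<dots> = (\<Sum>j<n. \<Sum>i<n. \<Sum>k<n. F j k * (rcof n R i j * R i k))"
    by (rule sum.swap)
  also have "\<dots> = (\<Sum>j<n. \<Sum>k<n. F j k * (\<Sum>i<n. rcof n R i j * R i k))"
    unfolding sum_distrib_left by (intro sum.cong refl sum.swap)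
  also have "\<dots> = (\<Sum>j<n. \<Sum>k<n. if k = j then F j j * rdet n R else 0)"
    by (intro sum.cong refl) (auto simp: adj)
  also have "\<dots> = (\<Sum>j<n. F j j) * rdet n R"
    by (simp add: sum_distrib_right)
  finally show ?thesis .
qed

section \<open>Jacobians and vector fields\<close>

text \<open>\<open>Jac\<close> has the gradients as columns. Here they are rows, so that replacing
  an argument of the Jacobian replaces a row.\<close>

definition grads :: "'k::field mpoly list \<Rightarrow> nat \<Rightarrow> nat \<Rightarrow> 'k mpoly" where
  "grads us = (\<lambda>j i. pdiff i (us ! j))"

definition vfield :: "nat \<Rightarrow> (nat \<Rightarrow> 'k::field mpoly) \<Rightarrow> 'k mpoly \<Rightarrow> 'k mpoly" where
  "vfield n s u = (\<Sum>i<n. s i * pdiff i u)"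

definition divergence :: "nat \<Rightarrow> (nat \<Rightarrow> 'k::field mpoly) \<Rightarrow> 'k mpoly" where
  "divergence n s = (\<Sum>i<n. pdiff i (s i))"

definition vars :: "nat \<Rightarrow> 'k::field mpoly list" where
  "vars n = map var_poly [0..<n]"

text \<open>The vector field \<open>bracket i j f\<close> is, up to sign, left multiplication by \<open>f\<close> and the variables
  other than \<open>x\<^sub>i\<close> and \<open>x\<^sub>j\<close>.\<close>

definition bracket :: "nat \<Rightarrow> nat \<Rightarrow> 'k::field mpoly \<Rightarrow> 'k mpoly \<Rightarrow> 'k mpoly" where
  "bracket i j f u = pdiff i f * pdiff j u - pdiff j f * pdiff i u"

lemma Jac_rdet: "Jac n us = rdet n (grads us)"
proof -
  have "transpose_mat (mat n n (\<lambda>(i, j). pdiff i (us ! j))) = mat n n (\<lambda>(i, j). grads us i j)"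
    by (rule eq_matI) (auto simp: grads_def)
  then show ?thesis
    unfolding Jac_def rdet_def by (metis det_transpose mat_carrier)
qed

lemma Jac_update:
  assumes "length us = n" "i < n"
  shows "Jac n (us[i := u]) = rdet n ((grads us)(i := (\<lambda>j. pdiff j u)))"
  unfolding Jac_rdet by (rule rdet_cong) (use assms in \<open>auto simp: grads_def nth_list_update\<close>)

text \<open>Expanding along the row of the free argument: its coefficients are cofactors of the
  other gradients, so the Jacobian is a vector field in each slot.\<close>

lemma Jac_update_vfield:
  assumes "length us = n" "i < n"
  shows "Jac n (us[i := u]) = vfield n (\<lambda>k. rdet n ((grads us)(i := unit_row k))) u"
  unfolding Jac_update[OF assms] vfield_def rdet_expand[OF assms(2), of _ "\<lambda>j. pdiff j u"]
  by (simp add: mult.commute)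

lemma vfield_add: "vfield n s (u + v) = vfield n s u + vfield n s v"
  by (simp add: vfield_def pdiff_add distrib_left sum.distrib)

lemma vfield_const_mult: "vfield n s (const_poly c * u) = const_poly c * vfield n s u"
  by (simp add: vfield_def pdiff_const_mult sum_distrib_left mult.left_commute)

lemma vfield_const [simp]: "vfield n s (const_poly c) = 0"
  by (simp add: vfield_def)

lemma vfield_mult: "vfield n s (u * v) = vfield n s u * v + u * vfield n s v"
  unfolding vfield_def pdiff_mult sum_distrib_left sum_distrib_right sum.distrib[symmetric]
  by (intro sum.cong refl) (simp add: distrib_left mult.assoc mult.left_commute)

lemma vfield_var: "i < n \<Longrightarrow> vfield n s (var_poly i) = s i"
  by (simp add: vfield_def pdiff_var if_distrib sum.delta cong: if_cong)

lemma vfield_plus_field: "vfield n (\<lambda>i. s i + t i) u = vfield n s u + vfield n t u"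
  by (simp add: vfield_def distrib_right sum.distrib)

lemma vfield_mult_field: "vfield n (\<lambda>i. c * s i) u = c * vfield n s u"
  by (simp add: vfield_def sum_distrib_left mult.assoc)

lemma polys_vfield:
  "(\<And>i. i < n \<Longrightarrow> s i \<in> polys n) \<Longrightarrow> u \<in> polys n \<Longrightarrow> vfield n s u \<in> polys n"
  unfolding vfield_def by (intro polys_closed) auto

lemma pdiff_vfield: "pdiff j (vfield n s u) = (\<Sum>k<n. pdiff j (s k) * pdiff k u) + vfield n s (pdiff j u)"
  by (simp add: vfield_def pdiff_sum pdiff_mult sum.distrib pdiff_commute[of j])

text \<open>The gradient of \<open>X u_i\<close> splits into two rows. In one, the matrix of the
  \<open>\<partial>\<^sub>j s\<^sub>k\<close> acts on the gradient of \<open>u_i\<close>, and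
  \<open>rdet_trace\<close> turns the sum of these determinants into its trace, the divergence. In
  the other, \<open>X\<close> acts entrywise, which \<open>derivation_rdet\<close> sums to
  \<open>X (Jac u)\<close>.\<close>

lemma vfield_Jac:
  assumes "length us = n"
  shows "vfield n s (Jac n us) = (\<Sum>i<n. Jac n (us[i := vfield n s (us ! i)])) - divergence n s * Jac n us"
proof -
  let ?R = "grads us"
  have "(\<Sum>i<n. Jac n (us[i := vfield n s (us ! i)])) =
      (\<Sum>i<n. rdet n (?R(i := (\<lambda>j. \<Sum>k<n. pdiff j (s k) * ?R i k))) + rdet n (?R(i := (\<lambda>j. vfield n s (?R i j)))))"
    by (intro sum.cong refl) (simp add: Jac_update assms pdiff_vfield rdet_update_add grads_def)
  also have "\<dots> = divergence n s * Jac n us + vfield n s (Jac n us)"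
    unfolding sum.distrib rdet_trace derivation_rdet[of "vfield n s", OF vfield_add vfield_mult] Jac_rdet divergence_def ..
  finally show ?thesis by simp
qed

lemma self_add_eq_0D:
  fixes p :: "'k::field_char_0 mpoly"
  assumes "p + p = 0"
  shows "p = 0"
proof (rule poly_mapping_eqI)
  fix m
  have "Poly_Mapping.lookup p m + Poly_Mapping.lookup p m = 0"
    using assms by (metis lookup_add lookup_zero)
  then have "2 * Poly_Mapping.lookup p m = 0" by simp
  then show "Poly_Mapping.lookup p m = Poly_Mapping.lookup 0 m" by simp
qed

text \<open>The Piola identity: by symmetry of the Hessians, summing the derivatives of the cofactors along
  a row pairs a symmetric with an antisymmetric form.\<close>

lemma divergence_cofactors:
  fixes us :: "'k::field_char_0 mpoly list"
  assumes j: "j < n"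
  shows "divergence n (\<lambda>k. rdet n ((grads us)(j := unit_row k))) = 0"
proof -
  let ?R = "grads us"
  let ?H = "\<lambda>i k l. pdiff k (?R i l)"
  let ?b = "\<lambda>i l k. rdet n (?R(i := unit_row l, j := unit_row k)) :: 'k mpoly"
  have H: "?H i k l = ?H i l k" for i k l by (simp add: grads_def pdiff_commute)
  have b: "?b i k l = - ?b i l k" if "i < n" "i \<noteq> j" for i k l
    using that j by (intro rdet_swap) auto
  have 1: "pdiff k (rdet n (?R(j := unit_row k))) = (\<Sum>i\<in>{..<n} - {j}. \<Sum>l<n. ?H i k l * ?b i l k)" for k
  proof -
    let ?T = "?R(j := unit_row k)"
    have "pdiff k (rdet n ?T) = (\<Sum>i<n. rdet n (?T(i := (\<lambda>l. pdiff k (?T i l)))))"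
      by (rule derivation_rdet) (auto simp: pdiff_add pdiff_mult)
    \<comment> \<open>Row \<open>j\<close> has constant entries, so differentiating it gives a zero
      row and that summand drops out.\<close>
    also have "\<dots> = (\<Sum>i\<in>{..<n} - {j}. rdet n (?T(i := (\<lambda>l. pdiff k (?T i l)))))"
    proof -
      have "rdet n (?T(j := (\<lambda>l. pdiff k (?T j l)))) = 0"
        by (rule rdet_zero_row[OF j]) (auto simp: unit_row_def)
      then show ?thesis using j by (simp add: sum.remove[of "{..<n}" j])
    qed
    also have "\<dots> = (\<Sum>i\<in>{..<n} - {j}. \<Sum>l<n. ?H i k l * ?b i l k)"
    proof (rule sum.cong, goal_cases)
      case (2 i)
      then have i: "i < n" "i \<noteq> j" by auto
      show ?case
        unfolding rdet_expand[OF i(1), of ?T "\<lambda>l. pdiff k (?T i l)"] using i by (simp add: fun_upd_twist)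
    qed simp
    finally show ?thesis .
  qed
  have 2: "(\<Sum>k<n. \<Sum>l<n. ?H i k l * ?b i l k) = 0" if "i < n" "i \<noteq> j" for i
  proof -
    let ?s = "\<Sum>k<n. \<Sum>l<n. ?H i k l * ?b i l k"
    have "?s = (\<Sum>l<n. \<Sum>k<n. ?H i k l * ?b i l k)" by (rule sum.swap)
    also have "\<dots> = - (\<Sum>l<n. \<Sum>k<n. ?H i l k * ?b i k l)"
      unfolding sum_negf[symmetric]
    proof (intro sum.cong refl)
      fix l k
      show "?H i k l * ?b i l k = - (?H i l k * ?b i k l)"
        using b[OF that, of k l] H[of k i l] by simp
    qed
    finally have "?s + ?s = 0" by (simp only: eq_neg_iff_add_eq_0)
    then show ?thesis by (rule self_add_eq_0D)
  qed
  have "divergence n (\<lambda>k. rdet n (?R(j := unit_row k))) = (\<Sum>k<n. \<Sum>i\<in>{..<n} - {j}. \<Sum>l<n. ?H i k l * ?b i l k)"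
    unfolding divergence_def 1 ..
  also have "\<dots> = (\<Sum>i\<in>{..<n} - {j}. \<Sum>k<n. \<Sum>l<n. ?H i k l * ?b i l k)"
    by (rule sum.swap)
  also have "\<dots> = 0" by (rule sum.neutral) (use 2 in auto)
  finally show ?thesis .
qed

lemma polys_rdet:
  fixes R :: "nat \<Rightarrow> nat \<Rightarrow> 'k::field mpoly"
  assumes "\<And>i j. i < n \<Longrightarrow> j < n \<Longrightarrow> R i j \<in> polys m"
  shows "rdet n R \<in> polys m"
proof -
  have sign: "signof p * q \<in> polys m" if "q \<in> polys m" for p :: "nat \<Rightarrow> nat" and q :: "'k mpoly"
    using that polys_uminus[OF that] by (auto simp: sign_def)
  show ?thesis
    unfolding rdet_leibniz
  proof (intro polys_sum sign polys_prod assms)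
    fix p i assume "p \<in> {p. p permutes {0..<n}}" "i \<in> {0..<n}"
    then show "i < n" "p i < n" using permutes_in_image[of p "{0..<n}" i] by auto
  qed
qed

lemma polys_Jac:
  assumes "length us = n" "set us \<subseteq> polys n"
  shows "Jac n us \<in> polys n"
  unfolding Jac_rdet by (rule polys_rdet) (use assms in \<open>auto simp: grads_def intro!: polys_pdiff\<close>)

lemma polys_cofactors:
  assumes "length us = n" "set us \<subseteq> polys n"
  shows "rdet n ((grads us)(j := unit_row k)) \<in> polys n"
  by (rule polys_rdet) (use assms in \<open>auto simp: grads_def unit_row_def intro!: polys_pdiff\<close>)

section \<open>Jacobians with coordinate functions in all but a few slots\<close>

lemma length_vars [simp]: "length (vars n) = n"
  by (simp add: vars_def)

lemma set_vars: "set (vars n) \<subseteq> polys n"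
  by (auto simp: vars_def)

lemma grads_vars: "i < n \<Longrightarrow> grads (vars n) i = unit_row i"
  by (auto simp: grads_def vars_def unit_row_def pdiff_var)

lemma Jac_vars: "Jac n (vars n) = 1"
  unfolding Jac_rdet rdet_unit[of n, symmetric] by (rule rdet_cong) (simp add: grads_vars)

lemma Jac_vars_update:
  assumes "i < n"
  shows "Jac n ((vars n)[i := u]) = pdiff i u"
proof -
  have "Jac n ((vars n)[i := u]) = rdet n (unit_row(i := (\<lambda>j. pdiff j u)))"
    unfolding Jac_update[OF length_vars assms] by (rule rdet_cong) (simp add: grads_vars)
  with assms show ?thesis by (simp add: rdet_unit_update)
qed

text \<open>The remaining rows are unit rows, so only a 2 by 2 minor is left. Every bracket is thus
  a value of the \<open>n\<close>-ary operation, and the Leibniz rule can be applied to it.\<close>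

lemma Jac_vars_update2:
  assumes "i < n" "j < n" "i \<noteq> j"
  shows "Jac n ((vars n)[i := f, j := u]) = bracket i j f u"
proof -
  have "Jac n ((vars n)[i := f, j := u]) = rdet n (unit_row(i := (\<lambda>j. pdiff j f), j := (\<lambda>j. pdiff j u)))"
    unfolding Jac_rdet by (rule rdet_cong) (use assms in \<open>auto simp: grads_def nth_list_update grads_vars[unfolded grads_def] vars_def unit_row_def pdiff_var\<close>)
  with assms show ?thesis by (simp add: rdet_unit_update2 bracket_def)
qed

lemma Jac_const_entry:
  assumes "length us = n" "i < n" "us ! i \<in> range const_poly"
  shows "Jac n us = 0"
  unfolding Jac_rdet by (rule rdet_zero_row[of i]) (use assms in \<open>auto simp: grads_def\<close>)

text \<open>As \<open>\<partial>\<^sub>0 (g i) = s i\<close>, the field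
  \<open>bracket 0 i (g i)\<close> has the correct component along \<open>\<partial>\<^sub>i\<close>
  and adds \<open>- \<partial>\<^sub>i (g i)\<close> along \<open>\<partial>\<^sub>0\<close>. What
  is missing along \<open>\<partial>\<^sub>0\<close> has
  \<open>\<partial>\<^sub>0\<close>-derivative \<open>divergence n s = 0\<close>. Its antiderivative
  \<open>h\<close> in the second variable is therefore free of \<open>x_0\<close>, and
  \<open>bracket 1 0 h\<close> is that missing component alone.\<close>

lemma divergence_free_decomp:
  fixes s :: "nat \<Rightarrow> 'k::field_char_0 mpoly"
  assumes n: "n > 1" and div: "divergence n s = 0"
  defines "g \<equiv> \<lambda>i. antideriv 0 (s i)"
  defines "h \<equiv> antideriv 1 (s 0 + (\<Sum>i\<in>{1..<n}. pdiff i (g i)))"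
  shows "vfield n s u = (\<Sum>i\<in>{1..<n}. bracket 0 i (g i) u) + bracket 1 0 h u"
proof -
  have split: "(\<Sum>i<n. f i) = f 0 + (\<Sum>i\<in>{1..<n}. f i)" for f :: "nat \<Rightarrow> 'k mpoly"
    using n by (simp add: lessThan_atLeast0 sum.atLeast_Suc_lessThan)
  have "pdiff 0 (s 0 + (\<Sum>i\<in>{1..<n}. pdiff i (g i))) = divergence n s"
    unfolding divergence_def split
    by (simp add: pdiff_add pdiff_sum pdiff_commute[of 0] g_def pdiff_antideriv)
  then have h0: "pdiff 0 h = 0"
    by (simp add: h_def pdiff_antideriv_other div)
  have h1: "pdiff 1 h = s 0 + (\<Sum>i\<in>{1..<n}. pdiff i (g i))"
    unfolding h_def by (rule pdiff_antideriv)
  show ?thesis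
    unfolding bracket_def h0 h1 vfield_def split
    by (simp add: g_def pdiff_antideriv sum_subtractf sum_distrib_right distrib_right)
qed

section \<open>Derivations modulo constants\<close>

text \<open>Within \<open>polys n\<close>, this says that \<open>p - q\<close> is a constant.\<close>

definition eqc :: "nat \<Rightarrow> 'k::field mpoly \<Rightarrow> 'k mpoly \<Rightarrow> bool" where
  "eqc n p q \<longleftrightarrow> (\<forall>k<n. pdiff k p = pdiff k q)"

lemma pdiff_numeral [simp]: "pdiff i (numeral k) = 0"
  by (metis pdiff_const_poly const_poly_def single_numeral)

lemma eqc_refl [simp]: "eqc n p p"
  and eqc_sym: "eqc n p q \<Longrightarrow> eqc n q p"
  and eqc_trans [trans]: "eqc n p q \<Longrightarrow> eqc n q r \<Longrightarrow> eqc n p r"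
  and eqc_diff: "eqc n p p' \<Longrightarrow> eqc n q q' \<Longrightarrow> eqc n (p - q) (p' - q')"
  and eqc_const_mult: "eqc n p p' \<Longrightarrow> eqc n (const_poly c * p) (const_poly c * p')"
  by (auto simp: eqc_def pdiff_add pdiff_diff pdiff_const_mult)

lemma eqc_iff_const:
  fixes p q :: "'k::field_char_0 mpoly"
  assumes "p \<in> polys n" "q \<in> polys n"
  shows "eqc n p q \<longleftrightarrow> p - q \<in> range const_poly"
proof
  assume "eqc n p q"
  then show "p - q \<in> range const_poly"
    by (intro const_if_pdiff_0[of _ n] polys_diff assms) (auto simp: eqc_def pdiff_diff)
next
  assume "p - q \<in> range const_poly"
  then obtain c where "p - q = const_poly c" by blast
  then have "p = q + const_poly c" by (simp add: algebra_simps)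
  then show "eqc n p q" by (simp add: eqc_def pdiff_add)
qed

lemma eqc_0_const:
  fixes p :: "'k::field_char_0 mpoly"
  assumes "eqc n p 0" "p \<in> polys n"
  obtains c where "p = const_poly c"
  using assms eqc_iff_const[of p n 0] by auto

text \<open>Covers derivations of the polynomial algebra and lifts of derivations of its quotient by
  the constants at the same time; for the lifts the Leibniz rule holds only up to constants. Nothing
  is required of \<open>D\<close> outside \<open>polys n\<close>.\<close>

locale weak_derivation =
  fixes n :: nat and D :: "'k::field_char_0 mpoly \<Rightarrow> 'k mpoly"
  assumes n: "n > 1"
    and closed: "u \<in> polys n \<Longrightarrow> D u \<in> polys n"
    and add: "u \<in> polys n \<Longrightarrow> v \<in> polys n \<Longrightarrow> D (u + v) = D u + D v"
    and const_mult: "u \<in> polys n \<Longrightarrow> D (const_poly c * u) = const_poly c * D u"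
    and weak: "length us = n \<Longrightarrow> set us \<subseteq> polys n \<Longrightarrow>
      eqc n (D (Jac n us)) (\<Sum>i<n. Jac n (us[i := D (us ! i)]))"
begin

lemma zero [simp]: "D 0 = 0"
  using const_mult[of 0 0] by simp

lemma ex_other: "\<exists>i<n. i \<noteq> (j::nat)"
  using n by (intro exI[of _ "if j = 0 then 1 else 0"]) auto

lemma sum: "(\<And>a. a \<in> A \<Longrightarrow> f a \<in> polys n) \<Longrightarrow> D (sum f A) = (\<Sum>a\<in>A. D (f a))"
  by (induction A rule: infinite_finite_induct) (auto simp: add polys_sum)

text \<open>The Leibniz rule on a bracket has extra terms from the slots that hold the other
  variables. They are assumed to vanish, because two different reasons for this occur: a constant
  \<open>f\<close>, or a constant \<open>D x_k\<close>.\<close>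

lemma weak_vars_update2:
  assumes ij: "i < n" "j < n" "i \<noteq> j" and fu: "f \<in> polys n" "u \<in> polys n"
    and other: "\<And>k. k < n \<Longrightarrow> k \<noteq> i \<Longrightarrow> k \<noteq> j \<Longrightarrow> Jac n ((vars n)[i := f, j := u, k := D (var_poly k)]) = 0"
  shows "eqc n (D (bracket i j f u)) (bracket i j (D f) u + bracket i j f (D u))"
proof -
  let ?us = "(vars n)[i := f, j := u]"
  have "set ?us \<subseteq> polys n"
    using set_update_subset_insert[of "(vars n)[i := f]" j u] set_update_subset_insert[of "vars n" i f] set_vars fu by blast
  then have "eqc n (D (Jac n ?us)) (\<Sum>k<n. Jac n (?us[k := D (?us ! k)]))"
    by (intro weak) simp_all
  also have "(\<Sum>k<n. Jac n (?us[k := D (?us ! k)])) =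
      (\<Sum>k<n. (if k = i then bracket i j (D f) u else 0) + (if k = j then bracket i j f (D u) else 0))"
  proof (rule sum.cong, goal_cases)
    case (2 k)
    consider "k = i" | "k = j" | "k \<noteq> i" "k \<noteq> j" by blast
    then show ?case
    proof cases
      case 1
      then have "?us[k := D (?us ! k)] = (vars n)[i := D f, j := u]"
        using ij by (intro nth_equalityI) (auto simp: nth_list_update)
      with 1 ij show ?thesis by (simp add: Jac_vars_update2)
    next
      case 2
      with ij show ?thesis by (simp add: Jac_vars_update2)
    next
      case 3
      with 2 other[of k] show ?thesis by (simp add: vars_def)
    qed
  qed simp
  also have "\<dots> = bracket i j (D f) u + bracket i j f (D u)"
    unfolding sum.distrib using ij by simp
  finally show ?thesis by (simp add: Jac_vars_update2 ij)
qed

text \<open>With the constant 1 in slot \<open>i\<close>, every Jacobian that keeps this entry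
  vanishes. The Leibniz rule then leaves only that \<open>bracket i j (D 1) u\<close> is constant
  for all \<open>u\<close>.\<close>

lemma D1: "eqc n (D 1) 0"
  unfolding eqc_def
proof (intro allI impI)
  fix i assume i: "i < n"
  obtain j where j: "j < n" "i \<noteq> j" using ex_other[of i] by auto
  let ?x = "var_poly j :: 'k mpoly"
  have *: "eqc n (bracket i j (D 1) u) 0" if u: "u \<in> polys n" for u
  proof -
    have "eqc n (D (bracket i j 1 u)) (bracket i j (D 1) u + bracket i j 1 (D u))"
    proof (rule weak_vars_update2)
      fix k assume "k < n" "k \<noteq> i" "k \<noteq> j"
      then show "Jac n ((vars n)[i := 1, j := u, k := D (var_poly k)]) = 0"
        using i j by (intro Jac_const_entry[of _ _ i]) (auto simp: image_iff intro!: exI[of _ 1])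
    qed (use i j u in auto)
    then show ?thesis by (simp add: bracket_def eqc_sym)
  qed
  \<comment> \<open>The test \<open>u = x_j\<close> shows that
    \<open>\<partial>\<^sub>i (D 1)\<close> is constant, and \<open>u = x_j * x_j\<close> that
    \<open>2 x_j \<partial>\<^sub>i (D 1)\<close> is. Differentiating the latter by
    \<open>x_j\<close> leaves \<open>2 \<partial>\<^sub>i (D 1) = 0\<close>.\<close>
  have "pdiff j (pdiff i (D 1)) = 0"
    using *[of ?x] i j by (simp add: eqc_def bracket_def pdiff_var)
  moreover have "pdiff j (bracket i j (D 1) (?x * ?x)) = 0"
    using *[of "?x * ?x"] j by (simp add: eqc_def polys_mult)
  ultimately have "pdiff i (D 1) + pdiff i (D 1) = 0"
    using j by (simp add: bracket_def pdiff_mult pdiff_var pdiff_add pdiff_diff mult_2_right)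
  then show "pdiff i (D 1) = pdiff i 0" by (simp add: self_add_eq_0D)
qed

lemma divergence_const: obtains c where "divergence n (\<lambda>k. D (var_poly k)) = const_poly c"
proof -
  let ?f = "divergence n (\<lambda>k. D (var_poly k))"
  have "eqc n (D (Jac n (vars n))) (\<Sum>i<n. Jac n ((vars n)[i := D (vars n ! i)]))"
    by (intro weak) (simp_all add: set_vars)
  also have "(\<Sum>i<n. Jac n ((vars n)[i := D (vars n ! i)])) = ?f"
    unfolding divergence_def by (intro sum.cong refl) (simp add: Jac_vars_update, simp add: vars_def)
  finally have "eqc n ?f 0"
    unfolding Jac_vars using D1 eqc_sym eqc_trans by blast
  moreover have "?f \<in> polys n"
    unfolding divergence_def by (intro polys_closed closed) auto
  ultimately show thesis using eqc_0_const that by blast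
qed

end

section \<open>Vector fields with a scalar term as weak derivations\<close>

lemma Jac_update_add:
  assumes "length us = n" "i < n"
  shows "Jac n (us[i := u + v]) = Jac n (us[i := u]) + Jac n (us[i := v])"
  unfolding Jac_update[OF assms] pdiff_add rdet_update_add[OF assms(2)] ..

lemma Jac_update_const_mult:
  assumes "length us = n" "i < n"
  shows "Jac n (us[i := const_poly c * u]) = const_poly c * Jac n (us[i := u])"
  unfolding Jac_update[OF assms] pdiff_const_mult rdet_update_mult[OF assms(2)] ..

lemma Jac_update_diff:
  assumes "length us = n" "i < n"
  shows "Jac n (us[i := u - v]) = Jac n (us[i := u]) - Jac n (us[i := v])"
  using Jac_update_add[OF assms, of "u - v" v] by (simp add: algebra_simps)

text \<open>The scalar contributes \<open>c * Jac\<close> on the left and \<open>n * c * Jac\<close>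
  on the right; the divergence term of \<open>vfield_Jac\<close> makes up exactly the
  difference.\<close>

lemma Jac_vfield_plus_scalar:
  fixes t :: "nat \<Rightarrow> 'k::field mpoly"
  assumes "length us = n" and div: "divergence n t = const_poly ((1 - of_nat n) * c)"
  shows "vfield n t (Jac n us) + const_poly c * Jac n us =
    (\<Sum>i<n. Jac n (us[i := vfield n t (us ! i) + const_poly c * (us ! i)]))"
proof -
  have "(\<Sum>i<n. Jac n (us[i := vfield n t (us ! i) + const_poly c * (us ! i)])) =
      (\<Sum>i<n. Jac n (us[i := vfield n t (us ! i)])) + of_nat n * (const_poly c * Jac n us)"
    by (simp add: Jac_update_add Jac_update_const_mult assms(1) sum.distrib)
  moreover have "divergence n t = const_poly c - of_nat n * const_poly c"
    unfolding div by (simp add: const_poly_mult const_poly_diff const_poly_of_nat left_diff_distrib)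
  ultimately show ?thesis
    by (simp add: vfield_Jac[OF assms(1)] left_diff_distrib mult.assoc)
qed

lemma weak_derivation_vfield:
  fixes t :: "nat \<Rightarrow> 'k::field_char_0 mpoly"
  assumes "n > 1" "\<And>i. i < n \<Longrightarrow> t i \<in> polys n" "divergence n t = const_poly ((1 - of_nat n) * c)"
  shows "weak_derivation n (\<lambda>u. vfield n t u + const_poly c * u)"
proof
  fix us :: "'k mpoly list" assume "length us = n"
  from Jac_vfield_plus_scalar[OF this assms(3)]
  show "eqc n (vfield n t (Jac n us) + const_poly c * Jac n us)
      (\<Sum>i<n. Jac n (us[i := vfield n t (us ! i) + const_poly c * (us ! i)]))" by simp
qed (use assms in \<open>auto intro!: polys_closed polys_vfield simp: vfield_add vfield_const_mult distrib_left mult.left_commute add_ac\<close>)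

lemma weak_derivation_diff:
  assumes "weak_derivation n D" "weak_derivation n E"
  shows "weak_derivation n (\<lambda>u. D u - E u)"
proof -
  interpret D: weak_derivation n D by fact
  interpret E: weak_derivation n E by fact
  show ?thesis
  proof
    fix us :: "'a mpoly list" assume us: "length us = n" "set us \<subseteq> polys n"
    have "(\<Sum>i<n. Jac n (us[i := D (us ! i) - E (us ! i)])) =
       (\<Sum>i<n. Jac n (us[i := D (us ! i)])) - (\<Sum>i<n. Jac n (us[i := E (us ! i)]))"
      by (simp add: Jac_update_diff us sum_subtractf)
    with eqc_diff[OF D.weak[OF us] E.weak[OF us]]
    show "eqc n (D (Jac n us) - E (Jac n us)) (\<Sum>i<n. Jac n (us[i := D (us ! i) - E (us ! i)]))"
      by simp
  qed (use D.n D.closed E.closed D.add E.add D.const_mult E.const_mult in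
    \<open>auto intro!: polys_closed simp: right_diff_distrib\<close>)
qed

text \<open>Its only nonzero partial derivative is \<open>x_i\<close>, so
  \<open>bracket i j (half_square i)\<close> is the operator
  \<open>x_i \<partial>\<^sub>j\<close>.\<close>

definition half_square :: "nat \<Rightarrow> 'k::field mpoly" where
  "half_square i = const_poly (1 / 2) * (var_poly i * var_poly i)"

lemma pdiff_half_square:
  "pdiff j (half_square i :: 'k::field_char_0 mpoly) = (if j = i then var_poly i else 0)"
proof -
  have "const_poly (1 / 2) * (p + p) = p" for p :: "'k mpoly"
  proof -
    have "const_poly (1 / 2) * (p + p) = (const_poly (1 / 2) + const_poly (1 / 2)) * p"
      by (simp add: algebra_simps)
    then show ?thesis by (simp add: const_poly_add[symmetric])
  qed
  then show ?thesis
    by (simp add: half_square_def pdiff_const_mult pdiff_mult pdiff_var)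
qed

lemma polys_half_square [simp]: "i < n \<Longrightarrow> half_square i \<in> polys n"
  by (simp add: half_square_def polys_mult)

text \<open>First normalization: with \<open>D x_k\<close> constant, the slots holding untouched
  variables contribute nothing, and the Leibniz rule holds for all brackets.\<close>

locale weak_derivation_vars = weak_derivation +
  assumes vars: "\<And>k. k < n \<Longrightarrow> eqc n (D (var_poly k)) 0"
begin

lemma bracket:
  assumes ij: "i < n" "j < n" "i \<noteq> j" and fu: "f \<in> polys n" "u \<in> polys n"
  shows "eqc n (D (bracket i j f u)) (bracket i j (D f) u + bracket i j f (D u))"
proof (rule weak_vars_update2[OF ij fu])
  fix k assume k: "k < n" "k \<noteq> i" "k \<noteq> j"
  obtain c where "D (var_poly k) = const_poly c"
    using eqc_0_const[OF vars[OF k(1)] closed] k by auto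
  with k ij show "Jac n ((vars n)[i := f, j := u, k := D (var_poly k)]) = 0"
    by (intro Jac_const_entry[of _ _ k]) auto
qed

text \<open>\<open>bracket i j x_i\<close> is \<open>\<partial>\<^sub>j\<close>, and the term with
  \<open>D x_i\<close> vanishes because \<open>D x_i\<close> is constant.\<close>

lemma pdiff:
  assumes j: "j < n" and u: "u \<in> polys n"
  shows "eqc n (D (pdiff j u)) (pdiff j (D u))"
proof -
  obtain i where i: "i < n" "i \<noteq> j" using ex_other[of j] by auto
  have "bracket i j (var_poly i) v = pdiff j v" for v :: "'a mpoly"
    using i by (simp add: bracket_def pdiff_var)
  moreover have "bracket i j (D (var_poly i)) u = 0"
    using vars[OF i(1)] i j by (simp add: bracket_def eqc_def)
  ultimately show ?thesis
    using bracket[OF i(1) j i(2) polys_var[OF i(1)] u] by simp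
qed

text \<open>The failure of \<open>D\<close> to commute with \<open>x_i \<partial>\<^sub>j\<close> is
  measured by \<open>D (half_square i)\<close> alone, which is why these values are normalized
  next.\<close>

lemma var_pdiff:
  assumes ij: "i < n" "j < n" "i \<noteq> j" and u: "u \<in> polys n"
  shows "eqc n (D (var_poly i * pdiff j u)) (bracket i j (D (half_square i)) u + var_poly i * pdiff j (D u))"
  using bracket[OF ij polys_half_square[OF ij(1)] u] ij
  by (simp add: bracket_def pdiff_half_square)

text \<open>Commuting \<open>D\<close> with \<open>\<partial>\<^sub>k\<close> shows that
  \<open>D (half_square i)\<close> has constant partial derivatives. For the off-diagonal ones,
  \<open>var_pdiff\<close> gives \<open>D (x_i x_j)\<close> from \<open>half_square j\<close>, and
  then \<open>D (x_i x_i)\<close> from \<open>x_i x_j\<close>.\<close>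

lemma half_squares:
  obtains b where
    "\<And>i k. i < n \<Longrightarrow> k < n \<Longrightarrow> pdiff k (D (half_square i)) = (if k = i then const_poly (b i) else 0)"
proof -
  have "\<exists>c. pdiff k (D (half_square i)) = const_poly c" if ik: "i < n" "k < n" for i k
  proof -
    have "eqc n (pdiff k (D (half_square i))) (D (pdiff k (half_square i)))"
      by (intro eqc_sym[OF pdiff]) (use ik in auto)
    also have "eqc n \<dots> 0"
      using vars[OF ik(1)] by (auto simp: pdiff_half_square)
    finally show ?thesis
      using ik by (metis closed eqc_0_const polys_half_square polys_pdiff)
  qed
  then obtain b where b: "\<And>i k. i < n \<Longrightarrow> k < n \<Longrightarrow> pdiff k (D (half_square i)) = const_poly (b i k)"
    by metis
  have "b i j = 0" if ij: "i < n" "j < n" "i \<noteq> j" for i j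
  proof -
    let ?x = "var_poly i :: 'a mpoly" and ?y = "var_poly j :: 'a mpoly"
    have *: "eqc n (D (?x * pdiff j u)) (const_poly (b i i) * pdiff j u - const_poly (b i j) * pdiff i u + ?x * pdiff j (D u))"
      if "u \<in> polys n" for u
      using var_pdiff[OF ij that] ij by (simp add: bracket_def b)
    have "eqc n (D (?x * ?y)) (const_poly (b i i) * ?y + ?x * const_poly (b j j))"
      using *[of "half_square j"] ij by (simp add: pdiff_half_square b)
    then have "pdiff j (D (?x * ?y)) = const_poly (b i i)"
      using ij by (simp add: eqc_def pdiff_mult pdiff_add pdiff_var)
    then have "eqc n (D (?x * ?x)) (const_poly (b i i) * ?x - const_poly (b i j) * ?y + ?x * const_poly (b i i))"
      using *[of "?x * ?y"] ij by (simp add: pdiff_mult pdiff_var polys_mult)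
    then have *: "pdiff j (D (?x * ?x)) = - const_poly (b i j)"
      using ij by (simp add: eqc_def pdiff_mult pdiff_add pdiff_diff pdiff_var)
    \<comment> \<open>The two computations of the same value give
      \<open>b i j = - b i j / 2\<close>, hence \<open>3 * b i j = 0\<close>.\<close>
    have "D (half_square i) = const_poly (1 / 2) * D (?x * ?x)"
      unfolding half_square_def by (rule const_mult) (use ij in \<open>auto intro: polys_mult\<close>)
    then have "const_poly (b i j) = const_poly (1 / 2) * pdiff j (D (?x * ?x))"
      using b[OF ij(1,2)] by (simp add: pdiff_const_mult)
    then have "const_poly (b i j) = const_poly (- (1 / 2 * b i j))"
      unfolding * by (simp only: const_poly_mult const_poly_uminus mult_minus_right)
    then have "b i j = - (1 / 2 * b i j)" by (simp only: const_poly_eq_iff)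
    then have "2 * b i j = - b i j" by (simp add: field_simps)
    then have "3 * b i j = 0" by (simp add: algebra_simps)
    then show ?thesis by simp
  qed
  with b that[of "\<lambda>i. b i i"] show thesis by auto
qed

end

text \<open>Second normalization: the correction term in \<open>var_pdiff\<close> disappears, so
  \<open>D\<close> commutes with every \<open>x_i \<partial>\<^sub>j\<close> for distinct
  \<open>i\<close> and \<open>j\<close>, up to constants.\<close>

locale weak_derivation_squares = weak_derivation_vars +
  assumes squares: "\<And>k. k < n \<Longrightarrow> eqc n (D (half_square k)) 0"
begin

lemma var_pdiff':
  assumes "i < n" "j < n" "i \<noteq> j" "u \<in> polys n"
  shows "eqc n (D (var_poly i * pdiff j u)) (var_poly i * pdiff j (D u))"
  using var_pdiff[OF assms] squares[OF assms(1)] assms by (simp add: bracket_def eqc_def)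

text \<open>Comparing \<open>D \<circ> x\<^sub>i \<partial>\<^sub>k x\<^sub>k \<partial>\<^sub>i\<close> with \<open>x\<^sub>i \<partial>\<^sub>k x\<^sub>k \<partial>\<^sub>i \<circ> D\<close> on a monomial, which is an eigenvector.\<close>

lemma monomial:
  "Poly_Mapping.keys m \<subseteq> {..<n} \<Longrightarrow> eqc n (D (Poly_Mapping.single m 1)) 0"
proof (induction "\<Sum>k<n. Poly_Mapping.lookup m k" arbitrary: m rule: less_induct)
  case less
  let ?u = "Poly_Mapping.single m (1 :: 'a)"
  let ?m = "\<lambda>i. of_nat (Poly_Mapping.lookup m i) :: 'a"
  have u: "?u \<in> polys n" using less.prems by (simp add: polys_iff)
  \<comment> \<open>By the induction hypothesis \<open>D\<close> sends each
    \<open>\<partial>\<^sub>k u\<close>, a multiple of a monomial of smaller degree, to a constant.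
    So \<open>D u\<close> is affine, with linear coefficients \<open>c k\<close>.\<close>
  have "\<exists>c. pdiff k (D ?u) = const_poly c" if k: "k < n" for k
  proof -
    have "eqc n (D (pdiff k ?u)) 0"
    proof (cases "Poly_Mapping.lookup m k = 0")
      case True
      then show ?thesis by (simp add: pdiff_single)
    next
      case False
      let ?l = "m - Poly_Mapping.single k 1"
      have keys: "Poly_Mapping.keys ?l \<subseteq> {..<n}"
        using less.prems by (auto simp: in_keys_iff lookup_minus subset_iff)
      have "(\<Sum>i<n. Poly_Mapping.lookup ?l i) < (\<Sum>i<n. Poly_Mapping.lookup m i)"
        by (rule sum_strict_mono_ex1) (use k False in \<open>auto simp: lookup_minus lookup_single intro!: bexI[of _ k]\<close>)
      then have "eqc n (D (Poly_Mapping.single ?l 1)) 0"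
        by (rule less.hyps) (rule keys)
      moreover have "pdiff k ?u = const_poly (?m k) * Poly_Mapping.single ?l 1"
        by (simp add: pdiff_single const_poly_def mult_single del: single_of_nat)
      moreover have "Poly_Mapping.single ?l (1 :: 'a) \<in> polys n"
        using keys by (simp add: polys_iff)
      ultimately show ?thesis
        by (metis const_mult eqc_const_mult mult_zero_right)
    qed
    with pdiff[OF k u] have "eqc n (pdiff k (D ?u)) 0"
      using eqc_sym eqc_trans by blast
    then show ?thesis using eqc_0_const closed[OF u] polys_pdiff by metis
  qed
  then obtain c where c: "\<And>k. k < n \<Longrightarrow> pdiff k (D ?u) = const_poly (c k)" by metis
  have eigen: "var_poly j * pdiff j ?u = const_poly (?m j) * ?u" for j
  proof (cases "Poly_Mapping.lookup m j = 0")
    case False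
    then have "Poly_Mapping.single j 1 + (m - Poly_Mapping.single j 1) = m"
      by (intro poly_mapping_eqI) (auto simp: lookup_add lookup_minus lookup_single when_def)
    then show ?thesis
      by (simp add: var_poly_def const_poly_def pdiff_single mult_single del: single_of_nat)
  qed (simp add: pdiff_single)
  \<comment> \<open>The left factor is the eigenvalue of
    \<open>x_i \<partial>\<^sub>k x_k \<partial>\<^sub>i\<close> on the monomial; applied to the
    affine \<open>D u\<close>, the same operator gives \<open>c i * x_i\<close>. The equation
    compares the coefficients of \<open>x_l\<close>.\<close>
  have key: "?m i * (?m k + 1) * c l = (if l = i then c i else 0)"
    if "i < n" "k < n" "i \<noteq> k" "l < n" for i k l
  proof -
    let ?x = "var_poly i :: 'a mpoly" and ?y = "var_poly k :: 'a mpoly"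
    have yu: "?y * pdiff i ?u \<in> polys n" using that u by (intro polys_closed) auto
    have "?x * pdiff k (?y * pdiff i ?u) = ?x * pdiff i ?u + ?y * pdiff k (?x * pdiff i ?u)"
      using that by (simp add: pdiff_mult pdiff_var algebra_simps)
    also have "\<dots> = const_poly (?m i) * ?u + const_poly (?m i) * (?y * pdiff k ?u)"
      unfolding eigen[of i] pdiff_const_mult by (simp add: mult.left_commute)
    also have "\<dots> = const_poly (?m i * (?m k + 1)) * ?u"
      unfolding eigen by (simp add: const_poly_mult const_poly_add algebra_simps)
    finally have "eqc n (D (const_poly (?m i * (?m k + 1)) * ?u)) (?x * pdiff k (D (?y * pdiff i ?u)))"
      using var_pdiff'[OF that(1-3) yu] by simp
    moreover have "pdiff k (D (?y * pdiff i ?u)) = const_poly (c i)"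
      using var_pdiff'[OF that(2,1) _ u] that by (simp add: eqc_def c pdiff_mult pdiff_var)
    ultimately have "pdiff l (const_poly (?m i * (?m k + 1)) * D ?u) = pdiff l (?x * const_poly (c i))"
      using that u by (simp add: eqc_def const_mult)
    then have "const_poly (?m i * (?m k + 1) * c l) = const_poly (if l = i then c i else 0)"
      using that by (simp add: pdiff_const_mult pdiff_mult pdiff_var c const_poly_mult)
    then show ?thesis by (simp only: const_poly_eq_iff)
  qed
  \<comment> \<open>An eigenvalue other than 0 and 1 forces all \<open>c l\<close> to vanish. It is
    0 only if \<open>x_i\<close> does not occur, and 1 only if \<open>x_i\<close> has exponent 1 and
    \<open>x_k\<close> does not occur.\<close>
  have "\<forall>l<n. c l = 0" if ik: "i < n" "k < n" "i \<noteq> k" "Poly_Mapping.lookup m i \<noteq> 0"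
    "Poly_Mapping.lookup m i \<noteq> 1 \<or> Poly_Mapping.lookup m k \<noteq> 0" for i k
  proof (intro allI impI)
    fix l assume l: "l < n"
    define N where "N = Poly_Mapping.lookup m i * (Poly_Mapping.lookup m k + 1)"
    have *: "of_nat N * c l = (if l = i then c i else 0)"
      using key[OF ik(1-3) l] by (simp add: N_def algebra_simps)
    have "N \<noteq> 0" using ik by (simp add: N_def)
    moreover have "N \<noteq> 1" using ik unfolding N_def by (simp only: nat_mult_eq_1_iff) auto
    moreover have "(of_nat N :: 'a) = 1 \<longleftrightarrow> N = 1" by (metis of_nat_1 of_nat_eq_iff)
    ultimately show "c l = 0" using * by (cases "l = i") auto
  qed
  moreover have "eqc n (D ?u) 0" if "\<forall>l<n. c l = 0"
    using that c by (simp add: eqc_def)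
  moreover have "eqc n (D ?u) 0" if "m = 0"
    using D1 that by simp
  moreover have "\<exists>i<n. Poly_Mapping.lookup m i \<noteq> 0" if "m \<noteq> 0"
  proof -
    have "\<exists>i. Poly_Mapping.lookup m i \<noteq> 0" using that by (auto simp: poly_mapping_eq_iff fun_eq_iff)
    with less.prems show ?thesis by (auto simp: subset_iff in_keys_iff)
  qed
  moreover have "eqc n (D ?u) 0" if "i < n" "Poly_Mapping.lookup m i = 1"
    "\<And>k. k < n \<Longrightarrow> i \<noteq> k \<Longrightarrow> Poly_Mapping.lookup m k = 0" for i
  proof -
    have "m = Poly_Mapping.single i 1"
    proof (rule poly_mapping_eqI)
      fix k
      show "Poly_Mapping.lookup m k = Poly_Mapping.lookup (Poly_Mapping.single i 1) k"
        using that less.prems by (cases "k < n") (auto simp: lookup_single when_def subset_iff in_keys_iff)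
    qed
    then show ?thesis using vars[OF that(1)] by (simp add: var_poly_def)
  qed
  \<comment> \<open>The eigenvalue argument fails for all pairs of indices only if the monomial is 1
    or a single variable, and these are settled by \<open>D1\<close> and
    \<open>vars\<close>.\<close>
  ultimately show ?case using ex_other by metis
qed

lemma trivial:
  assumes "u \<in> polys n"
  shows "eqc n (D u) 0"
proof -
  let ?K = "Poly_Mapping.keys u" and ?c = "Poly_Mapping.lookup u"
  have m: "Poly_Mapping.single k (1 :: 'a) \<in> polys n" "eqc n (D (Poly_Mapping.single k 1)) 0" if "k \<in> ?K" for k
    using that assms by (auto simp: polys_iff intro!: monomial)
  have "u = (\<Sum>k\<in>?K. const_poly (?c k) * Poly_Mapping.single k 1)"
    by (simp add: const_poly_def mult_single poly_sum_monomials)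
  moreover have "D (\<Sum>k\<in>?K. const_poly (?c k) * Poly_Mapping.single k 1) =
      (\<Sum>k\<in>?K. const_poly (?c k) * D (Poly_Mapping.single k 1))"
    by (subst sum) (auto intro!: polys_mult m sum.cong const_mult)
  ultimately have "D u = (\<Sum>k\<in>?K. const_poly (?c k) * D (Poly_Mapping.single k 1))" by simp
  then show ?thesis
    using m by (simp add: eqc_def pdiff_sum pdiff_const_mult)
qed

end

theorem weak_derivation_cases:
  fixes D :: "'k::field_char_0 mpoly \<Rightarrow> 'k mpoly"
  assumes "weak_derivation n D"
  obtains t c where "\<And>i. i < n \<Longrightarrow> t i \<in> polys n" "divergence n t = const_poly ((1 - of_nat n) * c)"
    "\<And>u. u \<in> polys n \<Longrightarrow> eqc n (D u) (vfield n t u + const_poly c * u)"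
proof -
  interpret weak_derivation n D by fact
  obtain c where c: "divergence n (\<lambda>k. D (var_poly k)) = const_poly c"
    by (rule divergence_const)
  \<comment> \<open>The divergence \<open>c\<close> of the field \<open>D x_k\<close> is also the
    right scalar: removing \<open>c * x_k\<close> from each component leaves divergence
    \<open>c - n * c\<close>, which is what a field with scalar term \<open>c\<close> must have. The
    resulting operator agrees with \<open>D\<close> on the variables.\<close>
  define s where "s k = D (var_poly k) - const_poly c * var_poly k" for k
  have s: "s i \<in> polys n" if "i < n" for i
    using that unfolding s_def by (intro polys_closed closed) auto
  have div: "divergence n s = const_poly ((1 - of_nat n) * c)"
  proof -
    have "divergence n s = const_poly c - of_nat n * const_poly c"
      unfolding c[symmetric]
      by (simp add: divergence_def s_def pdiff_diff pdiff_const_mult pdiff_var sum_subtractf)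
        (simp add: c[unfolded divergence_def])
    then show ?thesis by (simp add: const_poly_mult const_poly_diff const_poly_of_nat left_diff_distrib)
  qed
  let ?E = "\<lambda>u. D u - (vfield n s u + const_poly c * u)"
  have E: "weak_derivation n ?E"
    by (intro weak_derivation_diff[OF assms] weak_derivation_vfield n s div)
  interpret E: weak_derivation_vars n ?E
  proof (intro weak_derivation_vars.intro E weak_derivation_vars_axioms.intro)
    show "eqc n (?E (var_poly k)) 0" if "k < n" for k
      using that by (simp add: vfield_var s_def)
  qed
  obtain b where b: "\<And>i k. i < n \<Longrightarrow> k < n \<Longrightarrow> pdiff k (?E (half_square i)) = (if k = i then const_poly (b i) else 0)"
    using E.half_squares by blast
  \<comment> \<open>This constant field sends \<open>half_square i\<close> to
    \<open>b i * x_i\<close> and each variable to a constant, so the first normalization survives.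
    It has divergence 0, hence the scalar term 0.\<close>
  let ?b = "\<lambda>i. const_poly (b i)"
  let ?F = "\<lambda>u. ?E u - (vfield n ?b u + const_poly 0 * u)"
  have F: "weak_derivation n ?F"
    by (intro weak_derivation_diff[OF E] weak_derivation_vfield n) (auto simp: divergence_def)
  interpret F: weak_derivation_squares n ?F
  proof (intro weak_derivation_squares.intro weak_derivation_vars.intro F weak_derivation_vars_axioms.intro
      weak_derivation_squares_axioms.intro)
    show "eqc n (?F (var_poly k)) 0" if "k < n" for k
      using that eqc_diff[OF E.vars[OF that], of "const_poly (b k)" 0]
      by (simp add: vfield_var s_def eqc_def)
    show "eqc n (?F (half_square i)) 0" if "i < n" for i
    proof -
      have "vfield n ?b (half_square i) = const_poly (b i) * var_poly i"
        using that by (simp add: vfield_def pdiff_half_square if_distrib sum.delta cong: if_cong)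
      moreover have "pdiff k (?E (half_square i) - const_poly (b i) * var_poly i) = 0" if "k < n" for k
        using b[OF \<open>i < n\<close> that] unfolding pdiff_diff[of k "?E (half_square i)"] by (simp add: pdiff_const_mult pdiff_var)
      ultimately show ?thesis unfolding eqc_def by simp
    qed
  qed
  show thesis
  proof (rule that[of "\<lambda>i. s i + ?b i" c])
    show "divergence n (\<lambda>i. s i + ?b i) = const_poly ((1 - of_nat n) * c)"
      using div by (simp add: divergence_def pdiff_add)
    show "eqc n (D u) (vfield n (\<lambda>i. s i + ?b i) u + const_poly c * u)" if "u \<in> polys n" for u
      using F.trivial[OF that] by (simp add: eqc_def vfield_plus_field pdiff_add pdiff_diff algebra_simps)
  qed (use s in \<open>auto intro: polys_add\<close>)
qed

section \<open>Quotient spaces and spaces of linear maps\<close>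

lemma (in Module.module) span_singleton:
  assumes "v \<in> carrier M"
  shows "span {v} = (\<lambda>c. c \<odot>\<^bsub>M\<^esub> v) ` carrier R"
proof -
  have *: "lincomb a {v} = a v \<odot>\<^bsub>M\<^esub> v" if "a v \<in> carrier R" for a
    using that assms by (simp add: lincomb_def)
  have "span {v} = {lincomb a {v} | a. a \<in> {v} \<rightarrow> carrier R}"
    by (rule finite_span) (use assms in auto)
  also have "\<dots> = (\<lambda>c. c \<odot>\<^bsub>M\<^esub> v) ` carrier R"
  proof (intro equalityI subsetI)
    fix w assume "w \<in> (\<lambda>c. c \<odot>\<^bsub>M\<^esub> v) ` carrier R"
    then obtain c where "c \<in> carrier R" "w = c \<odot>\<^bsub>M\<^esub> v" by blast
    then show "w \<in> {lincomb a {v} | a. a \<in> {v} \<rightarrow> carrier R}"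
      using *[of "\<lambda>_. c"] by (auto intro!: exI[of _ "\<lambda>_. c"])
  qed (auto simp: *)
  finally show ?thesis .
qed

lemma (in vectorspace) has_dim_1I:
  assumes "v \<in> carrier V" "v \<noteq> \<zero>\<^bsub>V\<^esub>" "span {v} = carrier V"
  shows "has_dim K V 1"
  unfolding has_dim_def fin_dim_def using assms dim1I[of v] vectorspace_axioms by blast

locale vs_quotient = vectorspace +
  fixes W
  assumes subspace: "VectorSpace.subspace K W V"
begin

abbreviation cls where "cls a \<equiv> W +>\<^bsub>V\<^esub> a"
abbreviation Q where "Q \<equiv> quot_space V W"

lemma submodule: "submodule K W V"
  using subspace by (rule is_module)

lemmas W_subset = submodule.subset[OF submodule]
  and W_add = submodule.m_closed[OF submodule]
  and W_zero = submodule.zero_closed[OF submodule]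
  and W_smult = submodule.smult_closed[OF submodule]

lemma W_neg: "w \<in> W \<Longrightarrow> \<ominus>\<^bsub>V\<^esub> w \<in> W"
  using W_smult[of "\<ominus>\<^bsub>K\<^esub> \<one>\<^bsub>K\<^esub>" w] W_subset smult_l_minus[of "\<one>\<^bsub>K\<^esub>" w] by auto

sublocale sub: abelian_subgroup W V
proof (rule abelian_subgroupI3)
  show "additive_subgroup W V"
  proof (intro additive_subgroup.intro subgroup.intro)
    fix w assume "w \<in> W"
    then show "inv\<^bsub>add_monoid V\<^esub> w \<in> W" using W_neg by (simp add: a_inv_def)
  qed (use W_subset W_add W_zero in auto)
qed unfold_locales

lemma cls_eq_iff:
  assumes "a \<in> carrier V" "b \<in> carrier V"
  shows "cls a = cls b \<longleftrightarrow> a \<ominus>\<^bsub>V\<^esub> b \<in> W"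
proof -
  have "a \<ominus>\<^bsub>V\<^esub> b \<in> W \<longleftrightarrow> a \<in> cls b"
    using sub.a_rcos_module[of b a] assms by (simp add: a_minus_def)
  then show ?thesis
    using assms sub.a_rcos_self[of a] sub.a_repr_independence'[of a b] by auto
qed

lemma mem_cls_iff:
  assumes "a \<in> carrier V" "b \<in> carrier V"
  shows "a \<in> cls b \<longleftrightarrow> a \<ominus>\<^bsub>V\<^esub> b \<in> W"
  using sub.a_rcos_module[of b a] assms by (simp add: a_minus_def)

lemma cls_subset: "a \<in> carrier V \<Longrightarrow> cls a \<subseteq> carrier V"
  using W_subset by (rule a_r_coset_subset_G)

lemma cls_zero: "cls \<zero>\<^bsub>V\<^esub> = W"
  using W_zero by (rule sub.a_rcos_const)

lemma carrier_quot: "carrier Q = cls ` carrier V"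
  by (auto simp: quot_space_def A_RCOSETS_def')

lemma cls_mem: "a \<in> carrier V \<Longrightarrow> cls a \<in> carrier Q"
  by (simp add: carrier_quot)

lemma cls_add: "a \<in> carrier V \<Longrightarrow> b \<in> carrier V \<Longrightarrow> cls a \<oplus>\<^bsub>Q\<^esub> cls b = cls (a \<oplus>\<^bsub>V\<^esub> b)"
  by (simp add: quot_space_def sub.a_rcos_sum)

lemma zero_quot: "\<zero>\<^bsub>Q\<^esub> = W"
  by (simp add: quot_space_def)

text \<open>Operations on cosets are unions over all representatives; the union collapses once the
  result is independent of the choice.\<close>

lemma UN_cls:
  assumes "a \<in> carrier V" and "\<And>b. b \<in> cls a \<Longrightarrow> f b = f a"
  shows "(\<Union>b\<in>cls a. f b) = f a"
  using assms(2) sub.a_rcos_self[OF assms(1)] by blast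

lemma smult_diff:
  "c \<in> carrier K \<Longrightarrow> a \<in> carrier V \<Longrightarrow> b \<in> carrier V \<Longrightarrow>
    c \<odot>\<^bsub>V\<^esub> a \<ominus>\<^bsub>V\<^esub> c \<odot>\<^bsub>V\<^esub> b = c \<odot>\<^bsub>V\<^esub> (a \<ominus>\<^bsub>V\<^esub> b)"
  by (simp add: a_minus_def smult_r_distr smult_r_minus)

lemma cls_smult:
  assumes "c \<in> carrier K" "a \<in> carrier V"
  shows "c \<odot>\<^bsub>Q\<^esub> cls a = cls (c \<odot>\<^bsub>V\<^esub> a)"
proof -
  have "cls (c \<odot>\<^bsub>V\<^esub> b) = cls (c \<odot>\<^bsub>V\<^esub> a)" if "b \<in> cls a" for b
  proof -
    have b: "b \<in> carrier V" using that cls_subset assms by auto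
    then have "b \<ominus>\<^bsub>V\<^esub> a \<in> W" using that assms mem_cls_iff by blast
    then have "c \<odot>\<^bsub>V\<^esub> b \<ominus>\<^bsub>V\<^esub> c \<odot>\<^bsub>V\<^esub> a \<in> W"
      using assms b W_smult by (simp add: smult_diff)
    then show ?thesis using assms b by (simp add: cls_eq_iff)
  qed
  from UN_cls[of a "\<lambda>b. cls (c \<odot>\<^bsub>V\<^esub> b)", OF assms(2) this]
  show ?thesis by (simp add: quot_space_def)
qed

lemma quot_vectorspace: "vectorspace K Q"
proof (rule vs_criteria)
  show "field K" ..
  show "\<zero>\<^bsub>Q\<^esub> \<in> carrier Q" using cls_mem[of "\<zero>\<^bsub>V\<^esub>"] by (simp add: cls_zero zero_quot)
  show "\<forall>v\<in>carrier Q. \<exists>neg_v\<in>carrier Q. v \<oplus>\<^bsub>Q\<^esub> neg_v = \<zero>\<^bsub>Q\<^esub>"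
  proof
    fix v assume "v \<in> carrier Q"
    then obtain a where a: "a \<in> carrier V" "v = cls a" by (auto simp: carrier_quot)
    then show "\<exists>neg_v\<in>carrier Q. v \<oplus>\<^bsub>Q\<^esub> neg_v = \<zero>\<^bsub>Q\<^esub>"
      by (intro bexI[of _ "cls (\<ominus>\<^bsub>V\<^esub> a)"]) (simp_all add: cls_add cls_mem M.r_neg cls_zero zero_quot)
  qed
  show "\<forall>v\<in>carrier Q. v \<oplus>\<^bsub>Q\<^esub> \<zero>\<^bsub>Q\<^esub> = v"
    unfolding zero_quot carrier_quot using cls_add[of _ "\<zero>\<^bsub>V\<^esub>"] by (auto simp: cls_zero)
  show "\<forall>v w. v \<in> carrier Q \<and> w \<in> carrier Q \<longrightarrow> v \<oplus>\<^bsub>Q\<^esub> w = w \<oplus>\<^bsub>Q\<^esub> v"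
    unfolding carrier_quot using M.a_comm by (auto simp only: cls_add)
  show "\<forall>v w x. v \<in> carrier Q \<and> w \<in> carrier Q \<and> x \<in> carrier Q \<longrightarrow>
      v \<oplus>\<^bsub>Q\<^esub> w \<oplus>\<^bsub>Q\<^esub> x = v \<oplus>\<^bsub>Q\<^esub> (w \<oplus>\<^bsub>Q\<^esub> x)"
    by (auto simp: carrier_quot cls_add M.a_assoc)
qed (auto simp: carrier_quot cls_add cls_smult smult_assoc1 smult_l_distr smult_r_distr)

lemma cls_finsum:
  assumes "\<And>i. i \<in> A \<Longrightarrow> f i \<in> carrier V"
  shows "(\<Oplus>\<^bsub>Q\<^esub>i\<in>A. cls (f i)) = cls (\<Oplus>\<^bsub>V\<^esub>i\<in>A. f i)"
proof -
  interpret Q: vectorspace K Q by (rule quot_vectorspace)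
  show ?thesis using assms
  proof (induction A rule: infinite_finite_induct)
    case (insert i A)
    then have "(\<Oplus>\<^bsub>Q\<^esub>i\<in>insert i A. cls (f i)) = cls (f i) \<oplus>\<^bsub>Q\<^esub> (\<Oplus>\<^bsub>Q\<^esub>i\<in>A. cls (f i))"
      by (intro Q.finsum_insert) (auto intro: cls_mem)
    also have "\<dots> = cls (f i \<oplus>\<^bsub>V\<^esub> (\<Oplus>\<^bsub>V\<^esub>i\<in>A. f i))"
      using insert by (simp add: cls_add M.finsum_closed Pi_iff)
    also have "f i \<oplus>\<^bsub>V\<^esub> (\<Oplus>\<^bsub>V\<^esub>i\<in>A. f i) = (\<Oplus>\<^bsub>V\<^esub>i\<in>insert i A. f i)"
      using insert by (intro M.finsum_insert[symmetric]) auto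
    finally show ?case .
  qed (simp_all add: cls_zero zero_quot)
qed

lemma cls_neg: "a \<in> carrier V \<Longrightarrow> \<ominus>\<^bsub>Q\<^esub> cls a = cls (\<ominus>\<^bsub>V\<^esub> a)"
proof -
  interpret Q: vectorspace K Q by (rule quot_vectorspace)
  assume a: "a \<in> carrier V"
  then have "cls (\<ominus>\<^bsub>V\<^esub> a) \<oplus>\<^bsub>Q\<^esub> cls a = \<zero>\<^bsub>Q\<^esub>"
    by (simp add: cls_add M.l_neg cls_zero zero_quot)
  then show ?thesis using a by (intro Q.M.minus_equality) (auto intro: cls_mem)
qed

end

section \<open>The vector space of linear endomorphisms\<close>

context vectorspace
begin

abbreviation E where "E \<equiv> End_space K V"

lemma End_iff:
  "f \<in> carrier E \<longleftrightarrow> (\<forall>a\<in>carrier V. f a \<in> carrier V) \<and>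
     (\<forall>a\<in>carrier V. \<forall>b\<in>carrier V. f (a \<oplus>\<^bsub>V\<^esub> b) = f a \<oplus>\<^bsub>V\<^esub> f b) \<and>
     (\<forall>c\<in>carrier K. \<forall>a\<in>carrier V. f (c \<odot>\<^bsub>V\<^esub> a) = c \<odot>\<^bsub>V\<^esub> f a) \<and> f \<in> extensional (carrier V)"
  by (auto simp: End_space_def LinearCombinations.module_hom_def)

lemma End_closed: "f \<in> carrier E \<Longrightarrow> a \<in> carrier V \<Longrightarrow> f a \<in> carrier V"
  and End_f_add: "f \<in> carrier E \<Longrightarrow> a \<in> carrier V \<Longrightarrow> b \<in> carrier V \<Longrightarrow> f (a \<oplus>\<^bsub>V\<^esub> b) = f a \<oplus>\<^bsub>V\<^esub> f b"
  and End_f_smult: "f \<in> carrier E \<Longrightarrow> c \<in> carrier K \<Longrightarrow> a \<in> carrier V \<Longrightarrow> f (c \<odot>\<^bsub>V\<^esub> a) = c \<odot>\<^bsub>V\<^esub> f a"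
  by (auto simp: End_iff)

lemma End_f_diff:
  "f \<in> carrier E \<Longrightarrow> a \<in> carrier V \<Longrightarrow> b \<in> carrier V \<Longrightarrow> f (a \<ominus>\<^bsub>V\<^esub> b) = f a \<ominus>\<^bsub>V\<^esub> f b"
  using End_f_smult[of f "\<ominus>\<^bsub>K\<^esub> \<one>\<^bsub>K\<^esub>" b] End_closed[of f b]
  by (simp add: a_minus_def End_f_add smult_l_minus)

lemma End_eqI:
  "f \<in> carrier E \<Longrightarrow> g \<in> carrier E \<Longrightarrow> (\<And>a. a \<in> carrier V \<Longrightarrow> f a = g a) \<Longrightarrow> f = g"
  by (auto simp: End_iff intro: extensionalityI)

lemma End_add_apply: "a \<in> carrier V \<Longrightarrow> (f \<oplus>\<^bsub>E\<^esub> g) a = f a \<oplus>\<^bsub>V\<^esub> g a"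
  and End_smult_apply: "a \<in> carrier V \<Longrightarrow> (c \<odot>\<^bsub>E\<^esub> f) a = c \<odot>\<^bsub>V\<^esub> f a"
  and End_zero_apply: "a \<in> carrier V \<Longrightarrow> \<zero>\<^bsub>E\<^esub> a = \<zero>\<^bsub>V\<^esub>"
  by (auto simp: End_space_def)

lemma End_add_closed:
  assumes "f \<in> carrier E" "g \<in> carrier E"
  shows "f \<oplus>\<^bsub>E\<^esub> g \<in> carrier E"
  unfolding End_iff
proof (intro conjI ballI)
  show "(f \<oplus>\<^bsub>E\<^esub> g) \<in> extensional (carrier V)" by (simp add: End_space_def)
  fix a b assume "a \<in> carrier V" "b \<in> carrier V"
  with assms show "(f \<oplus>\<^bsub>E\<^esub> g) (a \<oplus>\<^bsub>V\<^esub> b) = (f \<oplus>\<^bsub>E\<^esub> g) a \<oplus>\<^bsub>V\<^esub> (f \<oplus>\<^bsub>E\<^esub> g) b"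
    by (simp add: End_add_apply End_closed End_f_add M.a_ac)
qed (use assms in \<open>simp_all add: End_add_apply End_closed End_f_smult smult_r_distr\<close>)

lemma End_smult_closed:
  assumes "c \<in> carrier K" "f \<in> carrier E"
  shows "c \<odot>\<^bsub>E\<^esub> f \<in> carrier E"
  unfolding End_iff
proof (intro conjI ballI)
  show "(c \<odot>\<^bsub>E\<^esub> f) \<in> extensional (carrier V)" by (simp add: End_space_def)
  fix d a assume "d \<in> carrier K" "a \<in> carrier V"
  moreover from this assms have "c \<odot>\<^bsub>V\<^esub> (d \<odot>\<^bsub>V\<^esub> f a) = d \<odot>\<^bsub>V\<^esub> (c \<odot>\<^bsub>V\<^esub> f a)"
    using smult_assoc1[of c d "f a"] smult_assoc1[of d c "f a"] R.m_comm[of c d] End_closed by metis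
  ultimately show "(c \<odot>\<^bsub>E\<^esub> f) (d \<odot>\<^bsub>V\<^esub> a) = d \<odot>\<^bsub>V\<^esub> (c \<odot>\<^bsub>E\<^esub> f) a"
    using assms by (simp add: End_smult_apply End_f_smult)
qed (use assms in \<open>simp_all add: End_smult_apply End_closed End_f_add smult_r_distr\<close>)

lemma End_zero_closed: "\<zero>\<^bsub>E\<^esub> \<in> carrier E"
  unfolding End_iff by (auto simp: End_zero_apply) (auto simp: End_space_def)

lemma End_vectorspace: "vectorspace K E"
proof (rule vs_criteria)
  show "field K" ..
  show "\<forall>f\<in>carrier E. \<exists>g\<in>carrier E. f \<oplus>\<^bsub>E\<^esub> g = \<zero>\<^bsub>E\<^esub>"
  proof
    fix f assume f: "f \<in> carrier E"
    show "\<exists>g\<in>carrier E. f \<oplus>\<^bsub>E\<^esub> g = \<zero>\<^bsub>E\<^esub>"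
    proof (intro bexI[of _ "(\<ominus>\<^bsub>K\<^esub> \<one>\<^bsub>K\<^esub>) \<odot>\<^bsub>E\<^esub> f"] End_eqI)
      fix a assume "a \<in> carrier V"
      then show "(f \<oplus>\<^bsub>E\<^esub> (\<ominus>\<^bsub>K\<^esub> \<one>\<^bsub>K\<^esub>) \<odot>\<^bsub>E\<^esub> f) a = \<zero>\<^bsub>E\<^esub> a"
        using f by (simp add: End_add_apply End_smult_apply End_zero_apply smult_l_minus End_closed M.r_neg)
    qed (use f in \<open>auto intro: End_add_closed End_smult_closed End_zero_closed\<close>)
  qed
  show "\<forall>f g. f \<in> carrier E \<and> g \<in> carrier E \<longrightarrow> f \<oplus>\<^bsub>E\<^esub> g = g \<oplus>\<^bsub>E\<^esub> f"
    by (auto intro!: End_eqI End_add_closed simp: End_add_apply End_closed M.a_comm)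
  show "\<forall>f g h. f \<in> carrier E \<and> g \<in> carrier E \<and> h \<in> carrier E \<longrightarrow>
      f \<oplus>\<^bsub>E\<^esub> g \<oplus>\<^bsub>E\<^esub> h = f \<oplus>\<^bsub>E\<^esub> (g \<oplus>\<^bsub>E\<^esub> h)"
    by (auto intro!: End_eqI End_add_closed simp: End_add_apply End_closed M.a_assoc)
  show "\<forall>f\<in>carrier E. f \<oplus>\<^bsub>E\<^esub> \<zero>\<^bsub>E\<^esub> = f"
    by (auto intro!: End_eqI End_add_closed End_zero_closed simp: End_add_apply End_zero_apply End_closed)
  show "\<forall>a b f. a \<in> carrier K \<and> b \<in> carrier K \<and> f \<in> carrier E \<longrightarrow>
      (a \<otimes>\<^bsub>K\<^esub> b) \<odot>\<^bsub>E\<^esub> f = a \<odot>\<^bsub>E\<^esub> (b \<odot>\<^bsub>E\<^esub> f)"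
    by (auto intro!: End_eqI End_smult_closed simp: End_smult_apply End_closed smult_assoc1)
  show "\<forall>f\<in>carrier E. \<one>\<^bsub>K\<^esub> \<odot>\<^bsub>E\<^esub> f = f"
    by (auto intro!: End_eqI End_smult_closed simp: End_smult_apply End_closed)
  show "\<forall>a b f. a \<in> carrier K \<and> b \<in> carrier K \<and> f \<in> carrier E \<longrightarrow>
      (a \<oplus>\<^bsub>K\<^esub> b) \<odot>\<^bsub>E\<^esub> f = a \<odot>\<^bsub>E\<^esub> f \<oplus>\<^bsub>E\<^esub> b \<odot>\<^bsub>E\<^esub> f"
    by (auto intro!: End_eqI End_smult_closed End_add_closed simp: End_smult_apply End_add_apply End_closed smult_l_distr)
  show "\<forall>a f g. a \<in> carrier K \<and> f \<in> carrier E \<and> g \<in> carrier E \<longrightarrow>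
      a \<odot>\<^bsub>E\<^esub> (f \<oplus>\<^bsub>E\<^esub> g) = a \<odot>\<^bsub>E\<^esub> f \<oplus>\<^bsub>E\<^esub> a \<odot>\<^bsub>E\<^esub> g"
    by (auto intro!: End_eqI End_smult_closed End_add_closed simp: End_smult_apply End_add_apply End_closed smult_r_distr)
qed (auto intro!: End_add_closed End_smult_closed End_zero_closed)

lemma End_submoduleI:
  assumes "N \<subseteq> carrier E" "\<zero>\<^bsub>E\<^esub> \<in> N" "\<And>f g. f \<in> N \<Longrightarrow> g \<in> N \<Longrightarrow> f \<oplus>\<^bsub>E\<^esub> g \<in> N"
    "\<And>c f. c \<in> carrier K \<Longrightarrow> f \<in> N \<Longrightarrow> c \<odot>\<^bsub>E\<^esub> f \<in> N"
  shows "submodule K N E"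
proof -
  interpret E: vectorspace K E by (rule End_vectorspace)
  show ?thesis by (intro submodule.intro E.module_axioms assms)
qed

end

section \<open>Derivations of \<open>n\<close>-Lie algebras\<close>

lemma args_update:
  "as \<in> args V n \<Longrightarrow> x \<in> carrier V \<Longrightarrow> as[i := x] \<in> args V n"
  using set_update_subset_insert[of as i x] by (auto simp: args_def)

lemma args_nth: "as \<in> args V n \<Longrightarrow> i < n \<Longrightarrow> as ! i \<in> carrier V"
  by (auto simp: args_def)

lemma args_length: "as \<in> args V n \<Longrightarrow> length as = n"
  by (simp add: args_def)

lemma args_snoc:
  "n > 0 \<Longrightarrow> as \<in> args V (n - 1) \<Longrightarrow> x \<in> carrier V \<Longrightarrow> as @ [x] \<in> args V n"
  by (auto simp: args_def)

locale n_lie = vectorspace +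
  fixes n :: nat and \<omega>
  assumes n_pos: "n > 0" and n_lie: "n_lie_algebra K V n \<omega>"
begin

lemma op_closed: "as \<in> args V n \<Longrightarrow> \<omega> as \<in> carrier V"
  and op_add: "as \<in> args V n \<Longrightarrow> i < n \<Longrightarrow> x \<in> carrier V \<Longrightarrow> y \<in> carrier V \<Longrightarrow>
        \<omega> (as[i := x \<oplus>\<^bsub>V\<^esub> y]) = \<omega> (as[i := x]) \<oplus>\<^bsub>V\<^esub> \<omega> (as[i := y])"
  and op_smult: "as \<in> args V n \<Longrightarrow> i < n \<Longrightarrow> c \<in> carrier K \<Longrightarrow> x \<in> carrier V \<Longrightarrow>
        \<omega> (as[i := c \<odot>\<^bsub>V\<^esub> x]) = c \<odot>\<^bsub>V\<^esub> \<omega> (as[i := x])"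
  and op_swap: "as \<in> args V n \<Longrightarrow> i < n \<Longrightarrow> j < n \<Longrightarrow> i \<noteq> j \<Longrightarrow>
        \<omega> (as[i := as ! j, j := as ! i]) = \<ominus>\<^bsub>V\<^esub> \<omega> as"
  and left_mult_derivation: "bs \<in> args V (n - 1) \<Longrightarrow> left_mult V \<omega> bs \<in> derivations K V n \<omega>"
  using n_lie unfolding n_lie_algebra_def multilinear_op_def skew_symmetric_op_def by blast+

abbreviation Der where "Der \<equiv> derivations K V n \<omega>"
abbreviation Inn where "Inn \<equiv> interior_derivations K V n \<omega>"

lemma op_update_closed: "as \<in> args V n \<Longrightarrow> x \<in> carrier V \<Longrightarrow> \<omega> (as[i := x]) \<in> carrier V"
  by (intro op_closed args_update)

lemma Der_iff:
  "D \<in> Der \<longleftrightarrow> D \<in> carrier E \<and> (\<forall>as\<in>args V n. D (\<omega> as) = (\<Oplus>\<^bsub>V\<^esub>i\<in>{..<n}. \<omega> (as[i := D (as ! i)])))"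
  by (auto simp: derivations_def)

lemma Der_submodule: "submodule K Der E"
proof (rule End_submoduleI)
  show "Der \<subseteq> carrier E" by (auto simp: Der_iff)
  show "\<zero>\<^bsub>E\<^esub> \<in> Der"
    unfolding Der_iff
  proof (intro conjI ballI)
    fix as assume as: "as \<in> args V n"
    have "\<omega> (as[i := \<zero>\<^bsub>E\<^esub> (as ! i)]) = \<zero>\<^bsub>V\<^esub>" if "i < n" for i
      using op_smult[OF as that, of "\<zero>\<^bsub>K\<^esub>" "\<zero>\<^bsub>V\<^esub>"] that args_nth[OF as that] op_update_closed[OF as, of "\<zero>\<^bsub>V\<^esub>"]
      by (simp add: End_zero_apply)
    then have "(\<Oplus>\<^bsub>V\<^esub>i\<in>{..<n}. \<omega> (as[i := \<zero>\<^bsub>E\<^esub> (as ! i)])) = \<zero>\<^bsub>V\<^esub>"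
      by (intro M.finsum_all0) auto
    then show "\<zero>\<^bsub>E\<^esub> (\<omega> as) = (\<Oplus>\<^bsub>V\<^esub>i\<in>{..<n}. \<omega> (as[i := \<zero>\<^bsub>E\<^esub> (as ! i)]))"
      using op_closed[OF as] by (simp add: End_zero_apply)
  qed (rule End_zero_closed)
next
  fix f g assume fg: "f \<in> Der" "g \<in> Der"
  then have E: "f \<in> carrier E" "g \<in> carrier E" by (auto simp: Der_iff)
  show "f \<oplus>\<^bsub>E\<^esub> g \<in> Der"
    unfolding Der_iff
  proof (intro conjI ballI)
    fix as assume as: "as \<in> args V n"
    note c = op_closed[OF as] args_nth[OF as] op_update_closed[OF as] End_closed[OF E(1)] End_closed[OF E(2)]
    have "(f \<oplus>\<^bsub>E\<^esub> g) (\<omega> as) = (\<Oplus>\<^bsub>V\<^esub>i\<in>{..<n}. \<omega> (as[i := f (as ! i)])) \<oplus>\<^bsub>V\<^esub> (\<Oplus>\<^bsub>V\<^esub>i\<in>{..<n}. \<omega> (as[i := g (as ! i)]))"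
      using fg as c by (simp add: Der_iff End_add_apply)
    also have "\<dots> = (\<Oplus>\<^bsub>V\<^esub>i\<in>{..<n}. \<omega> (as[i := f (as ! i)]) \<oplus>\<^bsub>V\<^esub> \<omega> (as[i := g (as ! i)]))"
      using c by (intro M.finsum_addf[symmetric]) auto
    also have "\<dots> = (\<Oplus>\<^bsub>V\<^esub>i\<in>{..<n}. \<omega> (as[i := (f \<oplus>\<^bsub>E\<^esub> g) (as ! i)]))"
      using c as by (intro M.finsum_cong') (auto simp: End_add_apply op_add)
    finally show "(f \<oplus>\<^bsub>E\<^esub> g) (\<omega> as) = (\<Oplus>\<^bsub>V\<^esub>i\<in>{..<n}. \<omega> (as[i := (f \<oplus>\<^bsub>E\<^esub> g) (as ! i)]))" .
  qed (rule End_add_closed[OF E])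
next
  fix c f assume c: "c \<in> carrier K" and f: "f \<in> Der"
  then have E: "f \<in> carrier E" by (auto simp: Der_iff)
  show "c \<odot>\<^bsub>E\<^esub> f \<in> Der"
    unfolding Der_iff
  proof (intro conjI ballI)
    fix as assume as: "as \<in> args V n"
    note cl = op_closed[OF as] args_nth[OF as] op_update_closed[OF as] End_closed[OF E]
    have "(c \<odot>\<^bsub>E\<^esub> f) (\<omega> as) = c \<odot>\<^bsub>V\<^esub> (\<Oplus>\<^bsub>V\<^esub>i\<in>{..<n}. \<omega> (as[i := f (as ! i)]))"
      using f as cl by (simp add: Der_iff End_smult_apply)
    also have "\<dots> = (\<Oplus>\<^bsub>V\<^esub>i\<in>{..<n}. c \<odot>\<^bsub>V\<^esub> \<omega> (as[i := f (as ! i)]))"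
      using cl c by (intro finsum_smult) auto
    also have "\<dots> = (\<Oplus>\<^bsub>V\<^esub>i\<in>{..<n}. \<omega> (as[i := (c \<odot>\<^bsub>E\<^esub> f) (as ! i)]))"
      using cl c as by (intro M.finsum_cong') (auto simp: End_smult_apply op_smult)
    finally show "(c \<odot>\<^bsub>E\<^esub> f) (\<omega> as) = (\<Oplus>\<^bsub>V\<^esub>i\<in>{..<n}. \<omega> (as[i := (c \<odot>\<^bsub>E\<^esub> f) (as ! i)]))" .
  qed (rule End_smult_closed[OF c E])
qed

lemma left_mults_Der: "left_mult V \<omega> ` args V (n - 1) \<subseteq> Der"
  using left_mult_derivation by blast

lemma Der_subset: "Der \<subseteq> carrier E"
  by (auto simp: Der_iff)

lemma Inn_submodule: "submodule K Inn E"
proof -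
  interpret E: vectorspace K E by (rule End_vectorspace)
  show ?thesis
    unfolding interior_derivations_def
    by (rule E.span_is_submodule) (use left_mults_Der Der_subset in blast)
qed

text \<open>The form in which the span is used: an inclusion of interior derivations only needs a
  submodule that contains the left multiplications.\<close>

lemma Inn_minimal:
  assumes "submodule K N E" "\<And>as. as \<in> args V (n - 1) \<Longrightarrow> left_mult V \<omega> as \<in> N"
  shows "Inn \<subseteq> N"
proof -
  interpret E: vectorspace K E by (rule End_vectorspace)
  show ?thesis
    unfolding interior_derivations_def
    by (rule E.span_is_subset) (use assms in auto)
qed

lemma left_mult_Inn: "as \<in> args V (n - 1) \<Longrightarrow> left_mult V \<omega> as \<in> Inn"
proof -
  interpret E: vectorspace K E by (rule End_vectorspace)
  assume "as \<in> args V (n - 1)"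
  then show ?thesis
    unfolding interior_derivations_def
    using E.in_own_span[of "left_mult V \<omega> ` args V (n - 1)"] left_mults_Der Der_subset by blast
qed

lemma Inn_Der: "Inn \<subseteq> Der"
  by (rule Inn_minimal[OF Der_submodule left_mult_derivation])

lemmas Inn_add = submodule.m_closed[OF Inn_submodule]
  and Inn_smult = submodule.smult_closed[OF Inn_submodule]
  and Inn_zero = submodule.zero_closed[OF Inn_submodule]

text \<open>Pure linear algebra: in the quotient the class of \<open>S\<close> vanishes, so every
  class is a multiple of the nonzero class of \<Delta>. It serves both algebras.\<close>

lemma Out_one_dim:
  assumes \<Delta>: "\<Delta> \<in> Der" "\<Delta> \<notin> Inn"
    and gen: "\<And>D. D \<in> Der \<Longrightarrow> \<exists>c\<in>carrier K. \<exists>S\<in>Inn. D = S \<oplus>\<^bsub>E\<^esub> c \<odot>\<^bsub>E\<^esub> \<Delta>"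
  shows "outer_class K V n \<omega> \<Delta> \<noteq> \<zero>\<^bsub>Out_space K V n \<omega>\<^esub>"
    and "LinearCombinations.module.span K (Out_space K V n \<omega>) {outer_class K V n \<omega> \<Delta>}
         = carrier (Out_space K V n \<omega>)"
    and "has_dim K (Out_space K V n \<omega>) 1"
proof -
  interpret E: vectorspace K E by (rule End_vectorspace)
  have "VectorSpace.subspace K Der E"
    by (intro VectorSpace.subspace.intro E.vectorspace_axioms Der_submodule)
  then have Der_vs: "vectorspace K (Der_space K V n \<omega>)"
    unfolding Der_space_def by (rule E.subspace_is_vs)
  interpret D: vectorspace K "Der_space K V n \<omega>" by (rule Der_vs)
  have D_simps: "carrier (Der_space K V n \<omega>) = Der" "add (Der_space K V n \<omega>) = add E"
    "module.smult (Der_space K V n \<omega>) = module.smult E" "zero (Der_space K V n \<omega>) = zero E"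
    by (simp_all add: Der_space_def)
  have "submodule K Inn (Der_space K V n \<omega>)"
    using Inn_submodule Inn_Der by (intro submodule.intro D.module_axioms) (auto simp: D_simps Inn_add Inn_smult Inn_zero)
  then interpret O: vs_quotient K "Der_space K V n \<omega>" Inn
    by (intro vs_quotient.intro vs_quotient_axioms.intro VectorSpace.subspace.intro D.vectorspace_axioms)
  interpret Q: vectorspace K O.Q by (rule O.quot_vectorspace)
  let ?d = "O.cls \<Delta>"
  have Q: "Out_space K V n \<omega> = O.Q" and d: "outer_class K V n \<omega> \<Delta> = ?d"
    by (simp_all add: Out_space_def outer_class_def)
  have d_carr: "?d \<in> carrier O.Q" using \<Delta> by (auto intro: O.cls_mem simp: D_simps)
  have nz: "?d \<noteq> \<zero>\<^bsub>O.Q\<^esub>"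
    using \<Delta> O.sub.a_rcos_self[of \<Delta>] by (auto simp: O.zero_quot D_simps)
  have span: "Q.span {?d} = carrier O.Q"
  proof
    show "Q.span {?d} \<subseteq> carrier O.Q" using d_carr by (intro Q.span_is_subset2) auto
    show "carrier O.Q \<subseteq> Q.span {?d}"
    proof
      fix v assume "v \<in> carrier O.Q"
      then obtain D where D: "D \<in> Der" "v = O.cls D" by (auto simp: O.carrier_quot D_simps)
      then obtain c S where cS: "c \<in> carrier K" "S \<in> Inn" "D = S \<oplus>\<^bsub>E\<^esub> c \<odot>\<^bsub>E\<^esub> \<Delta>" using gen by blast
      have "v = O.cls S \<oplus>\<^bsub>O.Q\<^esub> c \<odot>\<^bsub>O.Q\<^esub> ?d"
        using cS D \<Delta> Inn_Der D.smult_closed[of c \<Delta>] by (auto simp: O.cls_add O.cls_smult D_simps)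
      also have "O.cls S = \<zero>\<^bsub>O.Q\<^esub>"
        using cS O.sub.a_rcos_const O.zero_quot by simp
      finally have "v = c \<odot>\<^bsub>O.Q\<^esub> ?d" using d_carr cS by simp
      then show "v \<in> Q.span {?d}" using cS d_carr by (auto simp: Q.span_singleton)
    qed
  qed
  show "outer_class K V n \<omega> \<Delta> \<noteq> \<zero>\<^bsub>Out_space K V n \<omega>\<^esub>" unfolding Q d by (rule nz)
  show "LinearCombinations.module.span K (Out_space K V n \<omega>) {outer_class K V n \<omega> \<Delta>} = carrier (Out_space K V n \<omega>)"
    unfolding Q d by (rule span)
  show "has_dim K (Out_space K V n \<omega>) 1"
    unfolding Q using d_carr nz span by (rule Q.has_dim_1I)
qed

text \<open>One transposition moves slot \<open>i\<close> to the end and costs a sign; for the last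
  slot nothing has to be moved. Left multiplications are defined through the last slot.\<close>

lemma op_slot_last:
  assumes as: "as \<in> args V n" and i: "i < n"
  obtains bs where "bs \<in> args V (n - 1)" "\<And>u. u \<in> carrier V \<Longrightarrow> \<omega> (as[i := u]) = \<omega> (bs @ [u])"
  | bs where "bs \<in> args V (n - 1)" "\<And>u. u \<in> carrier V \<Longrightarrow> \<omega> (as[i := u]) = \<ominus>\<^bsub>V\<^esub> \<omega> (bs @ [u])"
proof -
  obtain xs l where as_eq: "as = xs @ [l]"
    using as i by (cases as rule: rev_exhaust) (auto simp: args_def)
  then have xs: "length xs = n - 1" "xs \<in> args V (n - 1)" and l: "l \<in> carrier V"
    using as by (auto simp: args_def)
  show thesis
  proof (cases "i = n - 1")
    case True
    then have "as[i := u] = xs @ [u]" for u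
      unfolding as_eq using list_update_length[of xs l "[]" u] xs by simp
    then show ?thesis using that(1) xs by simp
  next
    case False
    then have i': "i < length xs" using i xs by simp
    have bs: "xs[i := l] \<in> args V (n - 1)" using xs(2) l by (rule args_update)
    have "\<omega> (as[i := u]) = \<ominus>\<^bsub>V\<^esub> \<omega> (xs[i := l] @ [u])" if u: "u \<in> carrier V" for u
    proof -
      let ?cs = "xs[i := l] @ [u]"
      have "?cs ! (n - 1) = u" "?cs ! i = l"
        using i' xs(1) by (simp_all add: nth_append)
      then have "?cs[i := ?cs ! (n - 1), n - 1 := ?cs ! i] = as[i := u]"
        using i' xs(1) by (simp add: as_eq list_update_append)
      moreover have "\<omega> (?cs[i := ?cs ! (n - 1), n - 1 := ?cs ! i]) = \<ominus>\<^bsub>V\<^esub> \<omega> ?cs"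
        by (rule op_swap) (use args_snoc[OF n_pos bs u] i False in auto)
      ultimately show ?thesis by simp
    qed
    with bs show ?thesis using that(2) by blast
  qed
qed

text \<open>The analogue for the first slot, through which center and ideals are defined.\<close>

lemma op_slot_first:
  assumes as: "as \<in> args V n" and i: "i < n" and z: "z \<in> carrier V"
  obtains bs where "bs \<in> args V (n - 1)" "\<omega> (as[i := z]) = \<omega> (z # bs)"
  | bs where "bs \<in> args V (n - 1)" "\<omega> (as[i := z]) = \<ominus>\<^bsub>V\<^esub> \<omega> (z # bs)"
proof -
  have tl: "cs = hd cs # tl cs" "tl cs \<in> args V (n - 1)" if "cs \<in> args V n" for cs
    using that n_pos by (cases cs; auto simp: args_def)+
  show thesis
  proof (cases "i = 0")
    case True
    have "hd (as[i := z]) = z" using True as n_pos by (cases as) (auto simp: args_def)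
    then show ?thesis using tl[OF args_update[OF as z, of i]] that(1) by metis
  next
    case False
    let ?cs = "as[0 := z, i := as ! 0]"
    have len: "length as = n" using as by (simp add: args_def)
    have cs: "?cs \<in> args V n" using as z i n_pos by (intro args_update) (auto intro: args_nth)
    have "as[i := z] = ?cs[0 := ?cs ! i, i := ?cs ! 0]"
      using False i len n_pos by (auto simp: list_eq_iff_nth_eq nth_list_update)
    moreover have "\<omega> \<dots> = \<ominus>\<^bsub>V\<^esub> \<omega> ?cs"
      by (rule op_swap) (use cs i False n_pos in auto)
    moreover have "hd ?cs = z" using False len n_pos by (cases as; cases i) auto
    ultimately show ?thesis using tl[OF cs] that(2) by metis
  qed
qed

text \<open>Up to sign, leaving any one slot free is a left multiplication. This is what makes the
  brackets interior.\<close>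

lemma slot_mult_Inn:
  assumes as: "as \<in> args V n" and i: "i < n"
  shows "(\<lambda>u\<in>carrier V. \<omega> (as[i := u])) \<in> Inn"
  using as i
proof (cases rule: op_slot_last)
  case (1 bs)
  then have "(\<lambda>u\<in>carrier V. \<omega> (as[i := u])) = left_mult V \<omega> bs"
    by (auto simp: left_mult_def)
  then show ?thesis using left_mult_Inn 1(1) by simp
next
  case (2 bs)
  have "(\<lambda>u\<in>carrier V. \<omega> (as[i := u])) = (\<ominus>\<^bsub>K\<^esub> \<one>\<^bsub>K\<^esub>) \<odot>\<^bsub>E\<^esub> left_mult V \<omega> bs"
  proof
    fix u
    show "(\<lambda>u\<in>carrier V. \<omega> (as[i := u])) u = ((\<ominus>\<^bsub>K\<^esub> \<one>\<^bsub>K\<^esub>) \<odot>\<^bsub>E\<^esub> left_mult V \<omega> bs) u"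
    proof (cases "u \<in> carrier V")
      case True
      then have "\<omega> (bs @ [u]) \<in> carrier V" using 2 by (intro op_closed args_snoc n_pos)
      with True 2 show ?thesis by (simp add: End_smult_apply left_mult_def smult_l_minus)
    qed (simp add: End_space_def)
  qed
  then show ?thesis using Inn_smult left_mult_Inn 2(1) by simp
qed

lemma center_slot:
  assumes "z \<in> center V n \<omega>" "as \<in> args V n" "i < n"
  shows "\<omega> (as[i := z]) = \<zero>\<^bsub>V\<^esub>"
proof -
  have z: "z \<in> carrier V" "\<And>bs. bs \<in> args V (n - 1) \<Longrightarrow> \<omega> (z # bs) = \<zero>\<^bsub>V\<^esub>"
    using assms by (auto simp: center_def)
  from assms(2,3) z(1) show ?thesis
    by (cases rule: op_slot_first) (use z in auto)
qed

lemma ideal_slot: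
  assumes J: "n_lie_ideal K V n \<omega> J" and z: "z \<in> J" and as: "as \<in> args V n" "i < n"
  shows "\<omega> (as[i := z]) \<in> J"
proof -
  have sub: "submodule K J V" and cl: "\<And>bs. bs \<in> args V (n - 1) \<Longrightarrow> \<omega> (z # bs) \<in> J"
    using J z by (auto simp: n_lie_ideal_def)
  have zV: "z \<in> carrier V" using submodule.subset[OF sub] z by auto
  have neg: "\<ominus>\<^bsub>V\<^esub> w \<in> J" if "w \<in> J" for w
    using submodule.smult_closed[OF sub _ that, of "\<ominus>\<^bsub>K\<^esub> \<one>\<^bsub>K\<^esub>"] submodule.subset[OF sub] that
    by (auto simp: smult_l_minus subset_iff)
  from as zV show ?thesis
    by (cases rule: op_slot_first) (use cl neg in auto)
qed

end

section \<open>Central quotients of \<open>n\<close>-Lie algebras\<close>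

lemma in_listset_iff: "xs \<in> listset As \<longleftrightarrow> length xs = length As \<and> (\<forall>i<length As. xs ! i \<in> As ! i)"
proof (induction As arbitrary: xs)
  case (Cons A As)
  then show ?case
    by (cases xs) (auto simp: set_Cons_def nth_Cons split: nat.splits)
qed auto

lemma args_lists: "args U m = {as \<in> lists (carrier U). length as = m}"
  by (auto simp: args_def)

locale n_lie_central = n_lie + vs_quotient +
  assumes central: "W \<subseteq> center V n \<omega>"
begin

lemma op_W: "z \<in> W \<Longrightarrow> as \<in> args V n \<Longrightarrow> i < n \<Longrightarrow> \<omega> (as[i := z]) = \<zero>\<^bsub>V\<^esub>"
  using central center_slot by blast

text \<open>The arguments are exchanged one at a time along \<open>take k bs @ drop k as\<close>;
  each exchange adds an element of \<open>W\<close> to one slot and so does not change the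
  value.\<close>

lemma op_cong:
  assumes as: "as \<in> args V n" and bs: "bs \<in> args V n" and W: "\<And>i. i < n \<Longrightarrow> bs ! i \<ominus>\<^bsub>V\<^esub> as ! i \<in> W"
  shows "\<omega> bs = \<omega> as"
proof -
  have len: "length as = n" "length bs = n" using as bs by (auto simp: args_def)
  have "\<omega> (take k bs @ drop k as) = \<omega> as" if "k \<le> n" for k
    using that
  proof (induction k)
    case (Suc k)
    let ?cs = "take k bs @ drop k as"
    have cs: "?cs \<in> args V n"
      using as bs Suc by (auto simp: args_def dest: in_set_takeD in_set_dropD)
    have ab: "as ! k \<in> carrier V" "bs ! k \<in> carrier V" using as bs Suc by (auto intro: args_nth)
    let ?z = "bs ! k \<ominus>\<^bsub>V\<^esub> as ! k"
    have z: "?z \<in> W" using W Suc by simp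
    have "take (Suc k) bs @ drop (Suc k) as = ?cs[k := bs ! k]"
      using Suc len by (intro nth_equalityI) (auto simp: nth_append nth_list_update less_Suc_eq)
    moreover have "bs ! k = as ! k \<oplus>\<^bsub>V\<^esub> ?z"
      using ab M.a_lcomm[of "as ! k" "bs ! k" "\<ominus>\<^bsub>V\<^esub> (as ! k)"] by (simp add: a_minus_def M.r_neg)
    ultimately have "\<omega> (take (Suc k) bs @ drop (Suc k) as) = \<omega> (?cs[k := as ! k \<oplus>\<^bsub>V\<^esub> ?z])"
      by simp
    also have "\<dots> = \<omega> (?cs[k := as ! k]) \<oplus>\<^bsub>V\<^esub> \<omega> (?cs[k := ?z])"
      using cs Suc ab by (intro op_add) auto
    also have "\<dots> = \<omega> (?cs[k := as ! k])"
      using op_W[OF z cs] op_update_closed[OF cs ab(1), of k] Suc by simp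
    also have "?cs[k := as ! k] = ?cs"
      using Suc len by (intro list_update_same_conv[THEN iffD2]) (auto simp: nth_append)
    finally show ?case using Suc by simp
  qed simp
  from this[of n] len show ?thesis by simp
qed

abbreviation \<omega>Q where "\<omega>Q \<equiv> factor_op V W \<omega>"

lemma args_quot: "args Q m = map cls ` args V m"
  unfolding args_lists carrier_quot lists_image by auto

lemma map_cls_update: "(map cls as)[i := cls x] = map cls (as[i := x])"
  by (simp add: map_update)

lemma factor_op_cls:
  assumes as: "as \<in> args V n"
  shows "\<omega>Q (map cls as) = cls (\<omega> as)"
proof -
  have len: "length as = n" using as by (simp add: args_def)
  have "cls (\<omega> bs) = cls (\<omega> as)" if "bs \<in> listset (map cls as)" for bs
  proof -
    have bs: "length bs = n" "\<And>i. i < n \<Longrightarrow> bs ! i \<in> cls (as ! i)"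
      using that len by (auto simp: in_listset_iff)
    then have "bs ! i \<in> carrier V" if "i < n" for i
      using that cls_subset[OF args_nth[OF as that]] by auto
    then have args: "bs \<in> args V n" using bs by (auto simp: args_def in_set_conv_nth)
    have "\<omega> bs = \<omega> as"
      using as args by (rule op_cong) (use bs mem_cls_iff args_nth as args in blast)
    then show ?thesis by simp
  qed
  moreover have "as \<in> listset (map cls as)"
    using sub.a_rcos_self[OF args_nth[OF as]] by (auto simp: in_listset_iff len)
  ultimately show ?thesis unfolding factor_op_def by blast
qed

lemma factor_map_cls:
  assumes "D \<in> carrier E" "D ` W \<subseteq> W" "a \<in> carrier V"
  shows "factor_map V W D (cls a) = cls (D a)"
proof -
  have "cls (D b) = cls (D a)" if "b \<in> cls a" for b
  proof -
    have b: "b \<in> carrier V" using that cls_subset assms by auto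
    then have "b \<ominus>\<^bsub>V\<^esub> a \<in> W" using that assms mem_cls_iff by blast
    then have "D (b \<ominus>\<^bsub>V\<^esub> a) \<in> W" using assms by blast
    then show ?thesis using assms b by (simp add: cls_eq_iff End_f_diff End_closed)
  qed
  from UN_cls[of a "\<lambda>b. cls (D b)", OF assms(3) this] cls_mem[OF assms(3)]
  show ?thesis by (simp add: factor_map_def quot_space_def)
qed

lemma factor_map_extensional: "factor_map V W D \<in> extensional (carrier Q)"
  by (simp add: factor_map_def quot_space_def)

sublocale Q: vectorspace K Q
  by (rule quot_vectorspace)

lemma factor_map_End:
  assumes "D \<in> carrier E" "D ` W \<subseteq> W"
  shows "factor_map V W D \<in> carrier (End_space K Q)"
  unfolding Q.End_iff
proof (intro conjI)
  show "factor_map V W D \<in> extensional (carrier Q)" by (rule factor_map_extensional)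
qed (use assms in \<open>auto simp: carrier_quot factor_map_cls cls_add cls_smult End_closed End_f_add End_f_smult\<close>)

lemma factor_map_add:
  assumes "D \<in> carrier E" "D ` W \<subseteq> W" "D' \<in> carrier E" "D' ` W \<subseteq> W"
  shows "(D \<oplus>\<^bsub>E\<^esub> D') ` W \<subseteq> W"
    "factor_map V W (D \<oplus>\<^bsub>E\<^esub> D') = factor_map V W D \<oplus>\<^bsub>End_space K Q\<^esub> factor_map V W D'"
proof -
  show W: "(D \<oplus>\<^bsub>E\<^esub> D') ` W \<subseteq> W"
  proof (rule image_subsetI)
    fix w assume "w \<in> W"
    then have "w \<in> carrier V" "D w \<in> W" "D' w \<in> W" using assms(2,4) W_subset by blast+
    then show "(D \<oplus>\<^bsub>E\<^esub> D') w \<in> W" by (simp add: End_add_apply W_add)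
  qed
  show "factor_map V W (D \<oplus>\<^bsub>E\<^esub> D') = factor_map V W D \<oplus>\<^bsub>End_space K Q\<^esub> factor_map V W D'"
  proof (rule Q.End_eqI)
    fix A assume "A \<in> carrier Q"
    then obtain a where "a \<in> carrier V" "A = cls a" by (auto simp: carrier_quot)
    then show "factor_map V W (D \<oplus>\<^bsub>E\<^esub> D') A = (factor_map V W D \<oplus>\<^bsub>End_space K Q\<^esub> factor_map V W D') A"
      using assms W by (simp add: factor_map_cls End_add_closed End_add_apply Q.End_add_apply cls_mem cls_add End_closed)
  qed (use assms W in \<open>auto intro: factor_map_End Q.End_add_closed End_add_closed\<close>)
qed

lemma factor_map_smult:
  assumes "c \<in> carrier K" "D \<in> carrier E" "D ` W \<subseteq> W"
  shows "(c \<odot>\<^bsub>E\<^esub> D) ` W \<subseteq> W"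
    "factor_map V W (c \<odot>\<^bsub>E\<^esub> D) = c \<odot>\<^bsub>End_space K Q\<^esub> factor_map V W D"
proof -
  show W: "(c \<odot>\<^bsub>E\<^esub> D) ` W \<subseteq> W"
  proof (rule image_subsetI)
    fix w assume "w \<in> W"
    then have "w \<in> carrier V" "D w \<in> W" using assms(3) W_subset by blast+
    then show "(c \<odot>\<^bsub>E\<^esub> D) w \<in> W" using assms(1) by (simp add: End_smult_apply W_smult)
  qed
  show "factor_map V W (c \<odot>\<^bsub>E\<^esub> D) = c \<odot>\<^bsub>End_space K Q\<^esub> factor_map V W D"
  proof (rule Q.End_eqI)
    fix A assume "A \<in> carrier Q"
    then obtain a where "a \<in> carrier V" "A = cls a" by (auto simp: carrier_quot)
    then show "factor_map V W (c \<odot>\<^bsub>E\<^esub> D) A = (c \<odot>\<^bsub>End_space K Q\<^esub> factor_map V W D) A"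
      using assms W by (simp add: factor_map_cls End_smult_closed End_smult_apply Q.End_smult_apply cls_mem cls_smult End_closed)
  qed (use assms W in \<open>auto intro: factor_map_End Q.End_smult_closed End_smult_closed\<close>)
qed

lemma factor_map_derivation:
  assumes D: "D \<in> Der" and W: "D ` W \<subseteq> W"
  shows "factor_map V W D \<in> derivations K Q n \<omega>Q"
proof -
  have DE: "D \<in> carrier E" using D by (simp add: Der_iff)
  have "factor_map V W D (\<omega>Q As) = (\<Oplus>\<^bsub>Q\<^esub>i\<in>{..<n}. \<omega>Q (As[i := factor_map V W D (As ! i)]))"
    if "As \<in> args Q n" for As
  proof -
    obtain as where as: "as \<in> args V n" "As = map cls as" using \<open>As \<in> args Q n\<close> by (auto simp: args_quot)
    have upd: "\<omega>Q (As[i := factor_map V W D (As ! i)]) = cls (\<omega> (as[i := D (as ! i)]))" if "i < n" for i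
    proof -
      have "As[i := factor_map V W D (As ! i)] = map cls (as[i := D (as ! i)])"
        using as that args_nth[OF as(1) that] DE W by (simp add: factor_map_cls map_cls_update args_length)
      then show ?thesis
        using as that by (simp add: factor_op_cls args_update args_nth End_closed[OF DE])
    qed
    have "factor_map V W D (\<omega>Q As) = cls (\<Oplus>\<^bsub>V\<^esub>i\<in>{..<n}. \<omega> (as[i := D (as ! i)]))"
      using as D DE W by (simp add: factor_op_cls factor_map_cls op_closed Der_iff)
    also have "\<dots> = (\<Oplus>\<^bsub>Q\<^esub>i\<in>{..<n}. cls (\<omega> (as[i := D (as ! i)])))"
      using as by (intro cls_finsum[symmetric]) (auto intro!: op_update_closed End_closed[OF DE] args_nth)
    also have "\<dots> = (\<Oplus>\<^bsub>Q\<^esub>i\<in>{..<n}. \<omega>Q (As[i := factor_map V W D (As ! i)]))"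
      by (intro Q.finsum_cong') (use as(1) in \<open>auto simp only: upd intro!: cls_mem op_update_closed End_closed[OF DE] args_nth\<close>)
    finally show ?thesis .
  qed
  then show ?thesis
    using factor_map_End[OF DE W] by (simp add: derivations_def)
qed

text \<open>A central element in the last slot gives 0. So interior derivations map \<open>W\<close>
  into \<open>W\<close> and induce maps of the quotient.\<close>

lemma Inn_kills_W: "D \<in> Inn \<Longrightarrow> z \<in> W \<Longrightarrow> D z = \<zero>\<^bsub>V\<^esub>"
proof -
  let ?N = "{D \<in> carrier E. \<forall>z\<in>W. D z = \<zero>\<^bsub>V\<^esub>}"
  have "Inn \<subseteq> ?N"
  proof (rule Inn_minimal)
    show "submodule K ?N E"
    proof (rule End_submoduleI)
      have W: "z \<in> carrier V" if "z \<in> W" for z using that W_subset by blast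
      show "\<zero>\<^bsub>E\<^esub> \<in> ?N" using W by (simp add: End_zero_closed End_zero_apply)
      fix f assume f: "f \<in> ?N"
      show "f \<oplus>\<^bsub>E\<^esub> g \<in> ?N" if "g \<in> ?N" for g
        using that f W by (simp add: End_add_closed End_add_apply)
      show "c \<odot>\<^bsub>E\<^esub> f \<in> ?N" if "c \<in> carrier K" for c
        using that f W by (simp add: End_smult_closed End_smult_apply)
    qed blast
    fix as assume as: "as \<in> args V (n - 1)"
    have "left_mult V \<omega> as z = \<zero>\<^bsub>V\<^esub>" if "z \<in> W" for z
    proof -
      have "(as @ [\<zero>\<^bsub>V\<^esub>])[n - 1 := z] = as @ [z]"
        using as list_update_length[of as "\<zero>\<^bsub>V\<^esub>" "[]" z] by (simp add: args_def)
      moreover have "\<omega> ((as @ [\<zero>\<^bsub>V\<^esub>])[n - 1 := z]) = \<zero>\<^bsub>V\<^esub>"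
        using as that n_pos by (intro op_W args_snoc) auto
      ultimately show ?thesis using that W_subset by (auto simp: left_mult_def)
    qed
    then show "left_mult V \<omega> as \<in> ?N" using left_mult_derivation[OF as] by (simp add: Der_iff)
  qed
  then show "D \<in> Inn \<Longrightarrow> z \<in> W \<Longrightarrow> D z = \<zero>\<^bsub>V\<^esub>" by blast
qed

lemma Inn_W: "D \<in> Inn \<Longrightarrow> D ` W \<subseteq> W"
  by (auto simp: Inn_kills_W W_zero)

lemma Inn_End: "D \<in> Inn \<Longrightarrow> D \<in> carrier E"
  using Inn_Der Der_subset by blast

lemma left_mult_quot:
  assumes as: "as \<in> args V (n - 1)"
  shows "left_mult Q \<omega>Q (map cls as) = factor_map V W (left_mult V \<omega> as)"
proof (rule extensionalityI)
  show "left_mult Q \<omega>Q (map cls as) \<in> extensional (carrier Q)" by (simp add: left_mult_def)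
  fix A assume A: "A \<in> carrier Q"
  then obtain a where a: "a \<in> carrier V" "A = cls a" by (auto simp: carrier_quot)
  have "left_mult Q \<omega>Q (map cls as) A = \<omega>Q (map cls (as @ [a]))"
    using a A by (simp add: left_mult_def)
  also have "\<dots> = cls (\<omega> (as @ [a]))"
    by (intro factor_op_cls args_snoc n_pos as a)
  also have "\<dots> = factor_map V W (left_mult V \<omega> as) A"
    using a left_mult_Inn[OF as] by (simp add: factor_map_cls Inn_W Inn_End) (simp add: left_mult_def)
  finally show "left_mult Q \<omega>Q (map cls as) A = factor_map V W (left_mult V \<omega> as) A" .
qed (rule factor_map_extensional)

lemma n_lie_quot: "n_lie_algebra K Q n \<omega>Q"
  unfolding n_lie_algebra_def
proof (intro conjI ballI)
  show "vectorspace K Q" by (rule quot_vectorspace)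
  show "multilinear_op K Q n \<omega>Q"
    unfolding multilinear_op_def args_quot carrier_quot
    by (auto simp: factor_op_cls cls_add cls_smult map_cls_update args_update op_closed op_add op_smult)
  show "skew_symmetric_op Q n \<omega>Q"
    unfolding skew_symmetric_op_def args_quot
  proof (intro ballI allI impI)
    fix As i j assume "As \<in> map cls ` args V n" and ij: "i < n" "j < n" "i \<noteq> j"
    then obtain as where as: "as \<in> args V n" "As = map cls as" by blast
    have "As[i := As ! j, j := As ! i] = map cls (as[i := as ! j, j := as ! i])"
      using as ij by (simp add: map_cls_update args_length)
    moreover have "\<omega>Q \<dots> = cls (\<omega> (as[i := as ! j, j := as ! i]))"
      using as ij by (intro factor_op_cls args_update) (auto intro: args_nth)
    ultimately show "\<omega>Q (As[i := As ! j, j := As ! i]) = \<ominus>\<^bsub>Q\<^esub> \<omega>Q As"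
      using as ij by (simp add: op_swap factor_op_cls cls_neg op_closed)
  qed
  fix As assume "As \<in> args Q (n - 1)"
  then obtain as where as: "as \<in> args V (n - 1)" "As = map cls as" by (auto simp: args_quot)
  then show "left_mult Q \<omega>Q As \<in> derivations K Q n \<omega>Q"
    using left_mult_Inn[OF as(1)] Inn_Der Inn_W
    by (auto simp: left_mult_quot intro!: factor_map_derivation)
qed

sublocale Q: n_lie K Q n \<omega>Q
  by unfold_locales (rule n_pos, rule n_lie_quot)

lemma factor_map_zero: "\<zero>\<^bsub>E\<^esub> ` W \<subseteq> W" "factor_map V W \<zero>\<^bsub>E\<^esub> = \<zero>\<^bsub>End_space K Q\<^esub>"
proof -
  show W: "\<zero>\<^bsub>E\<^esub> ` W \<subseteq> W"
  proof (rule image_subsetI)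
    fix w assume "w \<in> W"
    then have "w \<in> carrier V" using W_subset by blast
    then show "\<zero>\<^bsub>E\<^esub> w \<in> W" by (simp add: End_zero_apply W_zero)
  qed
  show "factor_map V W \<zero>\<^bsub>E\<^esub> = \<zero>\<^bsub>End_space K Q\<^esub>"
  proof (rule Q.End_eqI)
    fix A assume A: "A \<in> carrier Q"
    then obtain a where "a \<in> carrier V" "A = cls a" by (auto simp: carrier_quot)
    then show "factor_map V W \<zero>\<^bsub>E\<^esub> A = \<zero>\<^bsub>End_space K Q\<^esub> A"
      using W Q.End_zero_apply[OF A] by (simp add: factor_map_cls End_zero_closed End_zero_apply cls_zero zero_quot)
  qed (use W in \<open>auto intro: factor_map_End End_zero_closed Q.End_zero_closed\<close>)
qed

text \<open>Minimality of the span is used twice: the image of the interior derivations is a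
  submodule containing the left multiplications of the quotient, and the maps that induce interior
  derivations of the quotient form a submodule containing those of \<open>V\<close>.\<close>

lemma Inn_quot: "Q.Inn = factor_map V W ` Inn"
proof
  show "Q.Inn \<subseteq> factor_map V W ` Inn"
  proof (rule Q.Inn_minimal)
    show "submodule K (factor_map V W ` Inn) (End_space K Q)"
    proof (rule Q.End_submoduleI)
      show "factor_map V W ` Inn \<subseteq> carrier (End_space K Q)"
        using factor_map_End Inn_End Inn_W by blast
      show "\<zero>\<^bsub>End_space K Q\<^esub> \<in> factor_map V W ` Inn"
        using Inn_zero factor_map_zero(2) by force
    next
      fix f g assume "f \<in> factor_map V W ` Inn" "g \<in> factor_map V W ` Inn"
      then show "f \<oplus>\<^bsub>End_space K Q\<^esub> g \<in> factor_map V W ` Inn"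
        using factor_map_add(2)[symmetric] Inn_add Inn_End Inn_W by auto
    next
      fix c f assume "c \<in> carrier K" "f \<in> factor_map V W ` Inn"
      then show "c \<odot>\<^bsub>End_space K Q\<^esub> f \<in> factor_map V W ` Inn"
        using factor_map_smult(2)[symmetric] Inn_smult Inn_End Inn_W by auto
    qed
    show "left_mult Q \<omega>Q As \<in> factor_map V W ` Inn" if "As \<in> args Q (n - 1)" for As
      using that left_mult_Inn by (auto simp: args_quot left_mult_quot)
  qed
  let ?N = "{D \<in> carrier E. D ` W \<subseteq> W \<and> factor_map V W D \<in> Q.Inn}"
  have "Inn \<subseteq> ?N"
  proof (rule Inn_minimal)
    show "submodule K ?N E"
    proof (rule End_submoduleI)
      fix f g assume "f \<in> ?N" "g \<in> ?N"
      then show "f \<oplus>\<^bsub>E\<^esub> g \<in> ?N"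
        using factor_map_add[of f g] Q.Inn_add End_add_closed by simp
    next
      fix c f assume "c \<in> carrier K" "f \<in> ?N"
      then show "c \<odot>\<^bsub>E\<^esub> f \<in> ?N"
        using factor_map_smult[of c f] Q.Inn_smult End_smult_closed by simp
    qed (use factor_map_zero Q.Inn_zero End_zero_closed in auto)
    fix as assume as: "as \<in> args V (n - 1)"
    have "map cls as \<in> args Q (n - 1)" unfolding args_quot using as by (rule imageI)
    from Q.left_mult_Inn[OF this] have "factor_map V W (left_mult V \<omega> as) \<in> Q.Inn"
      unfolding left_mult_quot[OF as] .
    then show "left_mult V \<omega> as \<in> ?N"
      using Inn_W[OF left_mult_Inn[OF as]] Inn_End[OF left_mult_Inn[OF as]] by blast
  qed
  then show "factor_map V W ` Inn \<subseteq> Q.Inn" by blast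
qed

end

section \<open>The Jacobian algebra\<close>

lemma poly_space_simps:
  "add (poly_space n) = (+)" "zero (poly_space n) = 0"
  "module.smult (poly_space n) = (\<lambda>c p. const_poly c * p)"
  by (simp_all add: poly_space_def)

lemma poly_vectorspace: "vectorspace class_ring (poly_space n :: ('k::field, 'k mpoly) module)"
proof (rule vs_criteria)
  show "field (class_ring :: 'k ring)" by (rule class_field)
  show "\<forall>v\<in>polys n. \<exists>w\<in>polys n. v \<oplus>\<^bsub>poly_space n\<^esub> w = (\<zero>\<^bsub>poly_space n\<^esub> :: 'k mpoly)"
    by (auto simp: poly_space_simps intro!: bexI[of _ "- _"] polys_closed)
qed (auto simp: poly_space_simps const_poly_add const_poly_mult distrib_left distrib_right add_ac mult_ac
    intro: polys_closed)

locale jacobian =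
  fixes n :: nat and field_type :: "'k::field_char_0 itself"
  assumes n: "n > 1"
begin

abbreviation K where "K \<equiv> class_ring :: 'k ring"
abbreviation U where "U \<equiv> poly_space n :: ('k, 'k mpoly) module"
abbreviation Const where "Const \<equiv> range const_poly :: 'k mpoly set"

sublocale U: vectorspace K U
  by (rule poly_vectorspace)

lemma neg_U: "p \<in> polys n \<Longrightarrow> \<ominus>\<^bsub>U\<^esub> p = - p"
  by (rule U.M.minus_equality) (auto simp: poly_space_simps polys_uminus)

lemma minus_U: "p \<in> polys n \<Longrightarrow> q \<in> polys n \<Longrightarrow> p \<ominus>\<^bsub>U\<^esub> q = p - q"
  by (simp add: a_minus_def neg_U poly_space_simps)

lemma finsum_U: "(\<And>i. i \<in> A \<Longrightarrow> f i \<in> polys n) \<Longrightarrow> (\<Oplus>\<^bsub>U\<^esub>i\<in>A. f i) = sum f A"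
proof (induction A rule: infinite_finite_induct)
  case (insert i A)
  then have "(\<Oplus>\<^bsub>U\<^esub>i\<in>insert i A. f i) = f i \<oplus>\<^bsub>U\<^esub> (\<Oplus>\<^bsub>U\<^esub>i\<in>A. f i)"
    by (intro U.M.finsum_insert) auto
  then show ?case using insert by (simp add: poly_space_simps)
qed (simp_all add: poly_space_simps)

lemma args_U: "us \<in> args U m \<longleftrightarrow> length us = m \<and> set us \<subseteq> polys n"
  by (auto simp: args_def)

lemma span_1: "U.span {1} = Const"
  using U.span_singleton[of 1] by (simp add: poly_space_simps)

lemma End_U_iff:
  "D \<in> carrier U.E \<longleftrightarrow> (\<forall>u\<in>polys n. D u \<in> polys n) \<and>
     (\<forall>u\<in>polys n. \<forall>v\<in>polys n. D (u + v) = D u + D v) \<and>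
     (\<forall>c. \<forall>u\<in>polys n. D (const_poly c * u) = const_poly c * D u) \<and> D \<in> extensional (polys n)"
  unfolding U.End_iff by (simp add: poly_space_simps)

lemma derivations_U_iff:
  "D \<in> derivations K U n (Jac n) \<longleftrightarrow> D \<in> carrier U.E \<and>
     (\<forall>us. length us = n \<longrightarrow> set us \<subseteq> polys n \<longrightarrow> D (Jac n us) = (\<Sum>i<n. Jac n (us[i := D (us ! i)])))"
proof -
  have *: "(\<Oplus>\<^bsub>U\<^esub>i\<in>{..<n}. Jac n (us[i := D (us ! i)])) = (\<Sum>i<n. Jac n (us[i := D (us ! i)]))"
    if "D \<in> carrier U.E" "us \<in> args U n" for us
  proof (rule finsum_U)
    fix i assume "i \<in> {..<n}"
    then have "us[i := D (us ! i)] \<in> args U n"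
      using that by (intro args_update) (auto simp: U.End_closed args_nth)
    then show "Jac n (us[i := D (us ! i)]) \<in> polys n" by (auto simp: args_U intro: polys_Jac)
  qed
  show ?thesis
  proof (cases "D \<in> carrier U.E")
    case True
    have "(\<forall>us\<in>args U n. D (Jac n us) = (\<Oplus>\<^bsub>U\<^esub>i\<in>{..<n}. Jac n (us[i := D (us ! i)]))) \<longleftrightarrow>
        (\<forall>us\<in>args U n. D (Jac n us) = (\<Sum>i<n. Jac n (us[i := D (us ! i)])))"
      using *[OF True] by (intro ball_cong refl) simp
    with True show ?thesis by (simp add: derivations_def Ball_def args_U imp_conjL)
  qed (simp add: derivations_def)
qed

text \<open>Restricted to \<open>polys n\<close> so as to be an element of the space of extensional
  linear maps.\<close>

definition vf :: "(nat \<Rightarrow> 'k mpoly) \<Rightarrow> 'k \<Rightarrow> 'k mpoly \<Rightarrow> 'k mpoly" where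
  "vf s c = (\<lambda>u\<in>polys n. vfield n s u + const_poly c * u)"

lemma vf_End: "(\<And>i. i < n \<Longrightarrow> s i \<in> polys n) \<Longrightarrow> vf s c \<in> carrier U.E"
  unfolding End_U_iff
  by (auto simp: vf_def polys_add polys_mult polys_vfield vfield_add vfield_const_mult distrib_left mult.left_commute)

lemma vf_derivation:
  assumes s: "\<And>i. i < n \<Longrightarrow> s i \<in> polys n" and div: "divergence n s = const_poly ((1 - of_nat n) * c)"
  shows "vf s c \<in> derivations K U n (Jac n)"
  unfolding derivations_U_iff
proof (intro conjI allI impI vf_End s)
  fix us :: "'k mpoly list" assume us: "length us = n" "set us \<subseteq> polys n"
  have "us ! i \<in> polys n" if "i < n" for i using us that nth_mem by blast
  with us polys_Jac[OF us] show "vf s c (Jac n us) = (\<Sum>i<n. Jac n (us[i := vf s c (us ! i)]))"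
    by (simp add: vf_def Jac_vfield_plus_scalar[OF us(1) div])
qed

lemma left_mult_vf:
  assumes "us \<in> args U (n - 1)"
  obtains s where "\<And>i. i < n \<Longrightarrow> s i \<in> polys n" "divergence n s = 0" "left_mult U (Jac n) us = vf s 0"
proof -
  \<comment> \<open>The entry 0 only fills the free slot; its row is overwritten in all cofactors
    used here.\<close>
  let ?us = "us @ [0]"
  have us: "length us = n - 1" "set ?us \<subseteq> polys n" "length ?us = n"
    using assms n by (auto simp: args_U)
  let ?s = "\<lambda>k. rdet n ((grads ?us)(n - 1 := unit_row k))"
  have snoc: "us @ [u] = ?us[n - 1 := u]" for u
    using list_update_length[of us 0 "[]" u] us by simp
  have "Jac n (us @ [u]) = vfield n ?s u" for u
    unfolding snoc[of u] by (rule Jac_update_vfield) (use us(3) n in auto)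
  then have "left_mult U (Jac n) us = vf ?s 0"
    unfolding left_mult_def vf_def by simp
  moreover have "divergence n ?s = 0" using n by (intro divergence_cofactors) simp
  moreover have "?s i \<in> polys n" for i using us by (intro polys_cofactors)
  ultimately show thesis by (intro that[of ?s]) simp_all
qed

lemma Jac_swap:
  assumes "length us = n" "i < n" "j < n" "i \<noteq> j"
  shows "Jac n (us[i := us ! j, j := us ! i]) = - Jac n us"
proof -
  let ?R = "grads us"
  have "Jac n (us[i := us ! j, j := us ! i]) = rdet n (?R(i := ?R j, j := ?R i))"
    unfolding Jac_rdet by (rule rdet_cong) (use assms in \<open>auto simp: grads_def nth_list_update\<close>)
  also have "\<dots> = - rdet n (?R(i := ?R i, j := ?R j))" using assms(2-) by (rule rdet_swap)
  finally show ?thesis by (simp add: Jac_rdet)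
qed

lemma Jac_n_lie: "n_lie_algebra K U n (Jac n)"
  unfolding n_lie_algebra_def
proof (intro conjI ballI)
  show "vectorspace K U" by (rule poly_vectorspace)
  show "multilinear_op K U n (Jac n)"
    unfolding multilinear_op_def
    by (auto simp: poly_space_simps Jac_update_add Jac_update_const_mult args_U polys_Jac)
  show "skew_symmetric_op U n (Jac n)"
    unfolding skew_symmetric_op_def by (auto simp: Jac_swap neg_U args_U polys_Jac)
  fix us assume "us \<in> args U (n - 1)"
  then show "left_mult U (Jac n) us \<in> derivations K U n (Jac n)"
  proof (rule left_mult_vf)
    fix s assume "\<And>i. i < n \<Longrightarrow> s i \<in> polys n" "divergence n s = 0" "left_mult U (Jac n) us = vf s 0"
    then show ?thesis by (simp add: vf_derivation)
  qed
qed

sublocale J: n_lie K U n "Jac n"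
  using n by unfold_locales (auto intro: Jac_n_lie)

lemma center_U: "center U n (Jac n) = Const"
proof
  show "center U n (Jac n) \<subseteq> Const"
  proof
    fix z assume z: "z \<in> center U n (Jac n)"
    \<comment> \<open>Putting \<open>z\<close> in slot \<open>i\<close> among the variables produces
      \<open>\<partial>\<^sub>i z\<close> as the Jacobian.\<close>
    have "pdiff i z = 0" if "i < n" for i
      using J.center_slot[OF z _ that, of "vars n"] that
      by (simp add: args_U set_vars Jac_vars_update poly_space_simps)
    moreover have "z \<in> polys n" using z by (simp add: center_def)
    ultimately show "z \<in> Const" using const_if_pdiff_0 by blast
  qed
  show "Const \<subseteq> center U n (Jac n)"
    using n by (auto simp: center_def args_U poly_space_simps intro!: Jac_const_entry[of _ _ 0])
qed

lemma vf_add: "vf s c \<oplus>\<^bsub>U.E\<^esub> vf t d = vf (\<lambda>i. s i + t i) (c + d)"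
  by (auto simp: End_space_def vf_def poly_space_simps vfield_plus_field const_poly_add algebra_simps)

lemma vf_smult: "d \<odot>\<^bsub>U.E\<^esub> vf s c = vf (\<lambda>i. const_poly d * s i) (d * c)"
  by (auto simp: End_space_def vf_def poly_space_simps vfield_mult_field const_poly_mult distrib_left mult.assoc)

lemma divergence_add: "divergence n (\<lambda>i. s i + t i) = divergence n s + divergence n t"
  for s t :: "nat \<Rightarrow> 'k mpoly"
  by (simp add: divergence_def pdiff_add sum.distrib)

lemma divergence_const_mult: "divergence n (\<lambda>i. const_poly d * s i) = const_poly d * divergence n s"
  for s :: "nat \<Rightarrow> 'k mpoly"
  by (simp add: divergence_def pdiff_const_mult sum_distrib_left)

lemma Inn_sum:
  assumes "\<And>a. a \<in> A \<Longrightarrow> (\<lambda>u\<in>polys n. g a u) \<in> J.Inn"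
  shows "(\<lambda>u\<in>polys n. \<Sum>a\<in>A. g a u) \<in> J.Inn"
proof -
  have 0: "(\<lambda>u\<in>polys n. 0) \<in> J.Inn"
    using J.Inn_zero by (simp add: End_space_def poly_space_simps)
  show ?thesis using assms
  proof (induction A rule: infinite_finite_induct)
    case (insert a A)
    have a: "(\<lambda>u\<in>polys n. g a u) \<in> J.Inn" by (rule insert.prems) simp
    have "(\<lambda>u\<in>polys n. \<Sum>a\<in>A. g a u) \<in> J.Inn" by (rule insert.IH) (rule insert.prems, simp)
    with a have "(\<lambda>u\<in>polys n. g a u) \<oplus>\<^bsub>U.E\<^esub> (\<lambda>u\<in>polys n. \<Sum>a\<in>A. g a u) \<in> J.Inn"
      by (rule J.Inn_add)
    also have "(\<lambda>u\<in>polys n. g a u) \<oplus>\<^bsub>U.E\<^esub> (\<lambda>u\<in>polys n. \<Sum>a\<in>A. g a u) = (\<lambda>u\<in>polys n. \<Sum>a\<in>insert a A. g a u)"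
      using insert.hyps by (auto simp: End_space_def poly_space_simps)
    finally show ?case .
  qed (simp_all add: 0)
qed

lemma bracket_Inn:
  assumes "i < n" "j < n" "i \<noteq> j" "f \<in> polys n"
  shows "(\<lambda>u\<in>polys n. bracket i j f u) \<in> J.Inn"
proof -
  have "(vars n)[i := f] \<in> args U n"
    using set_vars assms by (intro args_update) (auto simp: args_U)
  from J.slot_mult_Inn[OF this assms(2)] show ?thesis
    using assms by (simp add: Jac_vars_update2)
qed

lemma Inn_U: "J.Inn = {vf s 0 | s. (\<forall>i<n. s i \<in> polys n) \<and> divergence n s = 0}" (is "_ = ?N")
proof
  show "J.Inn \<subseteq> ?N"
  proof (rule J.Inn_minimal)
    show "submodule K ?N U.E"
    proof (rule U.End_submoduleI)
      show "?N \<subseteq> carrier U.E" by (auto intro: vf_End)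
      have "\<zero>\<^bsub>U.E\<^esub> = vf (\<lambda>_. 0) 0"
        by (auto simp: End_space_def vf_def vfield_def poly_space_simps)
      then show "\<zero>\<^bsub>U.E\<^esub> \<in> ?N" by (force simp: divergence_def)
      show "f \<oplus>\<^bsub>U.E\<^esub> g \<in> ?N" if f: "f \<in> ?N" and g: "g \<in> ?N" for f g
      proof -
        obtain s where s: "f = vf s 0" "\<forall>i<n. s i \<in> polys n" "divergence n s = 0" using f by blast
        obtain t where t: "g = vf t 0" "\<forall>i<n. t i \<in> polys n" "divergence n t = 0" using g by blast
        show ?thesis using s t
          by (auto simp: vf_add divergence_add intro!: exI[of _ "\<lambda>i. s i + t i"] polys_add)
      qed
      show "c \<odot>\<^bsub>U.E\<^esub> f \<in> ?N" if f: "f \<in> ?N" for c f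
      proof -
        obtain s where s: "f = vf s 0" "\<forall>i<n. s i \<in> polys n" "divergence n s = 0" using f by blast
        then show ?thesis
          by (auto simp: vf_smult divergence_const_mult intro!: exI[of _ "\<lambda>i. const_poly c * s i"] polys_mult)
      qed
    qed
    show "left_mult U (Jac n) us \<in> ?N" if "us \<in> args U (n - 1)" for us
      using that by (rule left_mult_vf) blast
  qed
  show "?N \<subseteq> J.Inn"
  proof
    fix D assume "D \<in> ?N"
    then obtain s where s: "\<And>i. i < n \<Longrightarrow> s i \<in> polys n" "divergence n s = 0" and D: "D = vf s 0" by blast
    let ?g = "\<lambda>i. antideriv 0 (s i)"
    let ?h = "antideriv 1 (s 0 + (\<Sum>i\<in>{1..<n}. pdiff i (?g i)))"
    have g: "?g i \<in> polys n" if "i < n" for i using s n that by (intro polys_antideriv) auto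
    have h: "?h \<in> polys n" using g s n by (intro polys_antideriv polys_closed) auto
    have "D = (\<lambda>u\<in>polys n. \<Sum>i\<in>{1..<n}. bracket 0 i (?g i) u) \<oplus>\<^bsub>U.E\<^esub> (\<lambda>u\<in>polys n. bracket 1 0 ?h u)"
      using divergence_free_decomp[OF n s(2)]
      by (auto simp: D vf_def End_space_def poly_space_simps)
    also have "\<dots> \<in> J.Inn"
      using n g h by (intro J.Inn_add Inn_sum bracket_Inn) auto
    finally show "D \<in> J.Inn" .
  qed
qed

section \<open>The derivation \<Delta> and the derivations of the polynomial algebra\<close>

abbreviation \<delta> :: 'k where "\<delta> \<equiv> of_nat n * inverse (1 - of_nat n)"

lemma one_minus_n: "1 - of_nat n \<noteq> (0 :: 'k)"
  using n by (metis eq_iff_diff_eq_0 less_irrefl of_nat_1 of_nat_eq_iff)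

lemma Delta_vf: "Delta n = vf var_poly \<delta>"
  by (auto simp: Delta_def vf_def vfield_def)

lemma divergence_var: "divergence n var_poly = (of_nat n :: 'k mpoly)"
  by (simp add: divergence_def pdiff_var)

lemma Delta_derivation: "Delta n \<in> J.Der"
  unfolding Delta_vf
proof (rule vf_derivation)
  have "(1 - of_nat n) * \<delta> = of_nat n" using one_minus_n by simp
  then show "divergence n var_poly = const_poly ((1 - of_nat n) * \<delta>)"
    by (simp only: divergence_var const_poly_of_nat)
qed simp

lemma vf_decomp:
  assumes t: "\<And>i. i < n \<Longrightarrow> t i \<in> polys n" and div: "divergence n t = const_poly ((1 - of_nat n) * c)"
  obtains S \<mu> where "S \<in> J.Inn" "vf t c = S \<oplus>\<^bsub>U.E\<^esub> \<mu> \<odot>\<^bsub>U.E\<^esub> Delta n"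
proof -
  \<comment> \<open>Chosen so that \<open>\<mu> * \<delta> = c\<close>. Removing \<mu> times the
    Euler field then also removes the divergence, since
    \<open>\<mu> * n = (1 - n) * c\<close>.\<close>
  define \<mu> where "\<mu> = c * (1 - of_nat n) / of_nat n"
  have n0: "of_nat n \<noteq> (0 :: 'k)" using n by simp
  have c: "\<mu> * \<delta> = c" using n0 one_minus_n by (simp add: \<mu>_def)
  have \<mu>: "- \<mu> * of_nat n = - ((1 - of_nat n) * c)" using n0 by (simp add: \<mu>_def)
  let ?s = "\<lambda>i. t i + const_poly (- \<mu>) * var_poly i"
  have "divergence n ?s = const_poly ((1 - of_nat n) * c) + const_poly (- \<mu> * of_nat n)"
    unfolding divergence_add divergence_const_mult div divergence_var const_poly_of_nat[symmetric] const_poly_mult ..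
  also have "\<dots> = 0" unfolding \<mu> const_poly_add[symmetric] by simp
  finally have "vf ?s 0 \<in> J.Inn"
    unfolding Inn_U using t by (auto intro!: exI[of _ ?s] polys_closed)
  moreover have "vf t c = vf ?s 0 \<oplus>\<^bsub>U.E\<^esub> \<mu> \<odot>\<^bsub>U.E\<^esub> Delta n"
    unfolding Delta_vf vf_smult vf_add c
    by (simp add: const_poly_uminus)
  ultimately show thesis using that by blast
qed

text \<open>The classification determines \<open>D\<close> only up to constants. The error
  \<open>?F\<close> is again a derivation, and as its values are constant it kills all Jacobians,
  which are all polynomials.\<close>

lemma Der_decomp:
  assumes D: "D \<in> J.Der"
  obtains S \<mu> where "S \<in> J.Inn" "D = S \<oplus>\<^bsub>U.E\<^esub> \<mu> \<odot>\<^bsub>U.E\<^esub> Delta n"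
proof -
  have "weak_derivation n D"
    using D n unfolding derivations_U_iff End_U_iff by unfold_locales auto
  then obtain t c where t: "\<And>i. i < n \<Longrightarrow> t i \<in> polys n" and div: "divergence n t = const_poly ((1 - of_nat n) * c)"
    and Dt: "\<And>u. u \<in> polys n \<Longrightarrow> eqc n (D u) (vfield n t u + const_poly c * u)"
    by (rule weak_derivation_cases) blast
  have vf: "vf t c \<in> J.Der" by (rule vf_derivation[OF t div])
  let ?F = "\<lambda>u. D u - vf t c u"
  have DE: "D \<in> carrier U.E" and vE: "vf t c \<in> carrier U.E" using D vf J.Der_subset by auto
  have F: "?F u \<in> Const" if "u \<in> polys n" for u
    using Dt[OF that] that U.End_closed[OF DE that] U.End_closed[OF vE that]
    by (simp add: eqc_iff_const vf_def)
  have "D u = vf t c u" if u: "u \<in> polys n" for u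
  proof -
    \<comment> \<open>The Jacobian of these arguments is \<open>\<partial>\<^sub>0\<close> of the
      antiderivative, that is, \<open>u\<close>.\<close>
    let ?us = "(vars n)[0 := antideriv 0 u]"
    have us: "length ?us = n" "set ?us \<subseteq> polys n"
      using args_update[of "vars n" U n "antideriv 0 u" 0] set_vars polys_antideriv[OF _ u, of 0] n
      by (auto simp: args_U)
    have "?us ! i \<in> polys n" if "i < n" for i using us nth_mem[of i ?us] that by auto
    then have "Jac n (?us[i := ?F (?us ! i)]) = 0" if "i < n" for i
      using F us that by (intro Jac_const_entry[of _ _ i]) auto
    then have "?F (Jac n ?us) = 0"
      using D vf us by (simp add: derivations_U_iff sum_subtractf[symmetric] Jac_update_diff del: Jac_vars_update)
    moreover have "Jac n ?us = u" using n by (simp add: Jac_vars_update pdiff_antideriv)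
    ultimately show ?thesis by simp
  qed
  then have "D = vf t c" by (intro U.End_eqI DE vE) simp
  then show thesis using vf_decomp[OF t div] that by metis
qed

end

subsection \<open>Simplicity modulo constants\<close>

text \<open>Meant for the set of representatives of an ideal modulo constants. A bracket with a
  variable is a partial derivative, so degrees can be lowered inside \<open>J\<close>; from an
  affine polynomial one then climbs back to everything.\<close>

lemma polys_subset_of_stable:
  fixes J :: "'k::field_char_0 mpoly set"
  assumes n: "n > 1" and J: "J \<subseteq> polys n"
    and scale: "\<And>c z. z \<in> J \<Longrightarrow> const_poly c * z \<in> J"
    and left: "\<And>i j z u. i < n \<Longrightarrow> j < n \<Longrightarrow> i \<noteq> j \<Longrightarrow> z \<in> J \<Longrightarrow> u \<in> polys n \<Longrightarrow> bracket i j z u \<in> J"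
    and right: "\<And>i j z u. i < n \<Longrightarrow> j < n \<Longrightarrow> i \<noteq> j \<Longrightarrow> z \<in> J \<Longrightarrow> u \<in> polys n \<Longrightarrow> bracket i j u z \<in> J"
    and p: "p \<in> J" "p \<notin> range const_poly"
  shows "polys n \<subseteq> J"
proof -
  have ex: "\<exists>i<n. i \<noteq> j" for j :: nat
    using n by (intro exI[of _ "if j = 0 then 1 else 0"]) auto
  have pdiff_J: "pdiff j z \<in> J" if "j < n" "z \<in> J" for j z
  proof -
    obtain i where i: "i < n" "i \<noteq> j" using ex by blast
    have "bracket i j (var_poly i) z \<in> J" using i that by (intro right) auto
    then show ?thesis using i by (simp add: bracket_def pdiff_var)
  qed
  let ?deg = "\<lambda>m. \<Sum>k<n. Poly_Mapping.lookup m k"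
  \<comment> \<open>Here \<open>d\<close> bounds the total degree. Either all partial derivatives of
    \<open>p\<close> are constant, or a nonconstant one lies in \<open>J\<close> with smaller
    degree.\<close>
  have affine: "\<exists>z\<in>J. z \<notin> range const_poly \<and> (\<forall>i<n. pdiff i z \<in> range const_poly)"
    if "p \<in> J" "p \<notin> range const_poly" "\<forall>m\<in>Poly_Mapping.keys p. ?deg m \<le> d" for p d
    using that
  proof (induction d arbitrary: p)
    case 0
    then have *: "\<forall>m\<in>Poly_Mapping.keys p. \<forall>i<n. Poly_Mapping.lookup m i = 0" by auto
    have "pdiff i p = 0" if i: "i < n" for i
    proof -
      have "(\<lambda>m. m - Poly_Mapping.single i 1) ` {m \<in> Poly_Mapping.keys p. Poly_Mapping.lookup m i \<noteq> 0} = {}"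
        using * i by auto
      then have "k \<notin> Poly_Mapping.keys (pdiff i p)" for k using keys_pdiff[of i p] by blast
      then show ?thesis by (intro poly_mapping_eqI) (simp add: in_keys_iff)
    qed
    then have "pdiff i p \<in> range const_poly" if "i < n" for i
      using that const_poly_0 by (metis rangeI)
    with 0 show ?case by blast
  next
    case (Suc d)
    show ?case
    proof (cases "\<forall>i<n. pdiff i p \<in> range const_poly")
      case False
      then obtain i where i: "i < n" "pdiff i p \<notin> range const_poly" by blast
      have "?deg m \<le> d" if m: "m \<in> Poly_Mapping.keys (pdiff i p)" for m
      proof -
        obtain k where k: "k \<in> Poly_Mapping.keys p" "Poly_Mapping.lookup k i \<noteq> 0" "m = k - Poly_Mapping.single i 1"
          using subsetD[OF keys_pdiff m] by blast
        have "?deg m < ?deg k"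
          unfolding k(3)
          by (rule sum_strict_mono_ex1) (use i k in \<open>auto simp: lookup_minus lookup_single intro!: bexI[of _ i]\<close>)
        with k Suc.prems(3) show ?thesis by force
      qed
      then show ?thesis
        by (intro Suc.IH[OF pdiff_J[OF i(1) Suc.prems(1)] i(2)] ballI)
    next
      case True
      with Suc.prems(1,2) show ?thesis by (intro bexI[of _ p] conjI)
    qed
  qed
  have "\<forall>m\<in>Poly_Mapping.keys p. ?deg m \<le> Max (?deg ` Poly_Mapping.keys p)" by simp
  from affine[OF p this] obtain z where z: "z \<in> J" "z \<notin> range const_poly"
    and dz: "\<forall>i<n. pdiff i z \<in> range const_poly" by (elim bexE conjE)
  have "\<exists>c. i < n \<longrightarrow> pdiff i z = const_poly c" for i
  proof (cases "i < n")
    case True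
    with dz have "pdiff i z \<in> range const_poly" by simp
    then obtain c where "pdiff i z = const_poly c" by (rule rangeE)
    then show ?thesis by (intro exI impI)
  qed simp
  then have "\<forall>i. \<exists>c. i < n \<longrightarrow> pdiff i z = const_poly c" by (rule allI)
  from choice[OF this] obtain a where "\<forall>i. i < n \<longrightarrow> pdiff i z = const_poly (a i)" by (elim exE)
  then have a: "pdiff i z = const_poly (a i)" if "i < n" for i using that by simp
  have "\<exists>i<n. a i \<noteq> 0"
  proof (rule ccontr)
    assume "\<not> (\<exists>i<n. a i \<noteq> 0)"
    then have "pdiff i z = 0" if "i < n" for i using a that by simp
    then have "z \<in> range const_poly" by (rule const_if_pdiff_0[OF subsetD[OF J z(1)]])
    with z(2) show False by (rule notE)
  qed
  then obtain i where i: "i < n" "a i \<noteq> 0" by blast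
  obtain k where k: "k < n" "k \<noteq> i" using ex by blast
  \<comment> \<open>This bracket is \<open>x_k \<partial>\<^sub>i z = a i * x_k\<close>; rescaling
    puts \<open>x_k\<close> itself into \<open>J\<close>.\<close>
  have "bracket k i (half_square k) z \<in> J" using i k z by (intro right) auto
  then have "var_poly k * const_poly (a i) \<in> J"
    using i k by (simp add: bracket_def pdiff_half_square a)
  from scale[OF this, of "inverse (a i)"] have "(const_poly (inverse (a i)) * const_poly (a i)) * var_poly k \<in> J"
    by (simp add: mult_ac)
  then have var: "var_poly k \<in> J"
    using i(2) by (simp add: const_poly_mult[symmetric])
  show ?thesis
  proof
    fix u :: "'k mpoly" assume "u \<in> polys n"
    then have "bracket k i (var_poly k) (antideriv i u) \<in> J"
      using i k var by (intro left polys_antideriv) auto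
    then show "u \<in> J" using i k by (simp add: bracket_def pdiff_var pdiff_antideriv)
  qed
qed

context jacobian
begin

sublocale C: n_lie_central K U n "Jac n" Const
proof (intro n_lie_central.intro vs_quotient.intro vs_quotient_axioms.intro n_lie_central_axioms.intro)
  have "submodule K Const U"
    unfolding span_1[symmetric] by (rule U.span_is_submodule) simp
  then show "VectorSpace.subspace K Const U"
    by (intro VectorSpace.subspace.intro poly_vectorspace)
qed (rule J.n_lie_axioms poly_vectorspace eq_refl[OF center_U[symmetric]])+

lemma cls_eq: "p \<in> polys n \<Longrightarrow> q \<in> polys n \<Longrightarrow> C.cls p = C.cls q \<longleftrightarrow> p - q \<in> Const"
  by (simp add: C.cls_eq_iff minus_U)

lemma cls_eq_zero: "p \<in> polys n \<Longrightarrow> C.cls p = \<zero>\<^bsub>C.Q\<^esub> \<longleftrightarrow> p \<in> Const"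
  using cls_eq[of p 0] C.cls_zero by (simp add: C.zero_quot poly_space_simps)

lemma simple_quot: "simple_n_lie_algebra K C.Q n C.\<omega>Q"
  unfolding simple_n_lie_algebra_def
proof (intro conjI allI impI C.n_lie_quot)
  \<comment> \<open>The variables alone have Jacobian 1, which is zero in the quotient; with the
    half square the Jacobian is \<open>x_0\<close>.\<close>
  let ?us = "(vars n)[0 := half_square 0] :: 'k mpoly list"
  have us: "?us \<in> args U n" using n set_vars by (intro args_update) (auto simp: args_U)
  have "C.\<omega>Q (map C.cls ?us) = C.cls (var_poly 0)"
    using n by (simp add: C.factor_op_cls[OF us] Jac_vars_update pdiff_half_square)
  moreover have "var_poly 0 \<notin> Const"
  proof
    assume "var_poly 0 \<in> Const"
    then obtain c where "var_poly 0 = (const_poly c :: 'k mpoly)" by blast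
    moreover have "pdiff 0 (var_poly 0) = (1 :: 'k mpoly)" by (simp add: pdiff_var)
    ultimately show False by simp
  qed
  ultimately have "C.\<omega>Q (map C.cls ?us) \<noteq> \<zero>\<^bsub>C.Q\<^esub>" using n by (simp add: cls_eq_zero)
  then show "\<exists>As\<in>args C.Q n. C.\<omega>Q As \<noteq> \<zero>\<^bsub>C.Q\<^esub>"
    using us unfolding C.args_quot by blast
next
  fix I assume I: "n_lie_ideal K C.Q n C.\<omega>Q I"
  have sub: "submodule K I C.Q" using I by (simp add: n_lie_ideal_def)
  note I_sub = submodule.subset[OF sub]
  \<comment> \<open>The preimage of the ideal in the polynomial algebra.\<close>
  let ?J = "{u \<in> polys n. C.cls u \<in> I}"
  have slot: "Jac n (us[i := z]) \<in> ?J" if "us \<in> args U n" "i < n" "z \<in> ?J" for us i z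
  proof -
    have z: "us[i := z] \<in> args U n" using that by (intro args_update) auto
    have "C.\<omega>Q ((map C.cls us)[i := C.cls z]) \<in> I"
      by (rule C.Q.ideal_slot[OF I]) (use that in \<open>auto simp: C.args_quot\<close>)
    then have "C.cls (Jac n (us[i := z])) \<in> I"
      by (simp add: C.map_cls_update C.factor_op_cls[OF z])
    then show ?thesis using J.op_closed[OF z] by simp
  qed
  show "I = {\<zero>\<^bsub>C.Q\<^esub>} \<or> I = carrier C.Q"
  proof (cases "\<exists>p\<in>?J. p \<notin> Const")
    case True
    then obtain p where p: "p \<in> ?J" "p \<notin> Const" by blast
    have vars: "(vars n)[i := u] \<in> args U n" if "u \<in> polys n" for i u
      using that set_vars by (intro args_update) (auto simp: args_U)
    have "polys n \<subseteq> ?J"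
    proof (rule polys_subset_of_stable[OF n _ _ _ _ p])
      show "const_poly c * z \<in> ?J" if "z \<in> ?J" for c z
        using that submodule.smult_closed[OF sub, of c "C.cls z"] C.cls_smult[of c z]
        by (simp add: poly_space_simps polys_mult)
      show "bracket i j z u \<in> ?J" if "i < n" "j < n" "i \<noteq> j" "z \<in> ?J" "u \<in> polys n" for i j z u
        using slot[OF vars[OF that(5), of j] that(1,4)] that
        by (simp add: list_update_swap[OF that(3)[symmetric]] Jac_vars_update2)
      show "bracket i j u z \<in> ?J" if "i < n" "j < n" "i \<noteq> j" "z \<in> ?J" "u \<in> polys n" for i j z u
        using slot[OF vars[OF that(5), of i] that(2,4)] that by (simp add: Jac_vars_update2)
    qed blast
    then have "carrier C.Q \<subseteq> I" by (auto simp: C.carrier_quot)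
    with I_sub show ?thesis by blast
  next
    case False
    have "A = \<zero>\<^bsub>C.Q\<^esub>" if A: "A \<in> I" for A
    proof -
      obtain u where "u \<in> polys n" "A = C.cls u" using A I_sub by (auto simp: C.carrier_quot)
      with A False show ?thesis by (auto simp: cls_eq_zero)
    qed
    with submodule.zero_closed[OF sub] show ?thesis by blast
  qed
qed

subsection \<open>Outer derivations\<close>

abbreviation \<Delta> where "\<Delta> \<equiv> Delta n :: 'k mpoly \<Rightarrow> 'k mpoly"
abbreviation \<Delta>Q where "\<Delta>Q \<equiv> factor_map U Const \<Delta>"

lemma vf_const: "vf s c ` Const \<subseteq> Const"
  by (auto simp: vf_def const_poly_mult[symmetric])

lemma Delta_const: "\<Delta> ` Const \<subseteq> Const"
  unfolding Delta_vf by (rule vf_const)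

lemma Delta_End: "\<Delta> \<in> carrier U.E"
  using Delta_derivation J.Der_subset by blast

lemma DeltaQ_derivation: "\<Delta>Q \<in> C.Q.Der"
  by (rule C.factor_map_derivation[OF Delta_derivation Delta_const])

text \<open>Modulo constants only values can be compared. As
  \<open>\<Delta> x_i = (1 + \<delta>) x_i\<close>, an interior lift would have components
  \<open>(1 + \<delta>) x_i\<close> up to constants, hence divergence
  \<open>n (1 + \<delta>)\<close>.\<close>

lemma DeltaQ_not_Inn: "\<Delta>Q \<notin> C.Q.Inn"
proof
  assume "\<Delta>Q \<in> C.Q.Inn"
  then obtain S where S: "S \<in> J.Inn" "\<Delta>Q = factor_map U Const S" unfolding C.Inn_quot by blast
  then obtain s where s: "S = vf s 0" "\<forall>i<n. s i \<in> polys n" "divergence n s = 0" unfolding Inn_U by blast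
  have "pdiff i (s i) = const_poly (1 + \<delta>)" if i: "i < n" for i
  proof -
    let ?x = "var_poly i :: 'k mpoly"
    have "C.cls (\<Delta> ?x) = C.cls (S ?x)"
      using S(2) C.factor_map_cls[OF Delta_End Delta_const, of ?x]
        C.factor_map_cls[OF C.Inn_End[OF S(1)] C.Inn_W[OF S(1)], of ?x] i by simp
    then have "\<Delta> ?x - S ?x \<in> Const"
      using U.End_closed[OF Delta_End, of ?x] U.End_closed[OF C.Inn_End[OF S(1)], of ?x] i
      by (simp add: cls_eq)
    moreover have "\<Delta> ?x - S ?x = const_poly (1 + \<delta>) * ?x - s i"
      using i by (simp add: Delta_vf s(1) vf_def vfield_var const_poly_add distrib_right)
    ultimately have "const_poly (1 + \<delta>) * ?x - s i \<in> Const" by simp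
    then obtain c where "const_poly (1 + \<delta>) * ?x - s i = const_poly c" by blast
    then have "pdiff i (const_poly (1 + \<delta>) * ?x - s i) = 0" by (simp only: pdiff_const_poly)
    then show ?thesis by (simp only: pdiff_diff pdiff_const_mult pdiff_var refl if_True mult_1_right right_minus_eq)
  qed
  then have "divergence n s = of_nat n * const_poly (1 + \<delta>)" unfolding divergence_def by simp
  then have "const_poly (of_nat n * (1 + \<delta>)) = (0 :: 'k mpoly)"
    using s(3) by (simp only: const_poly_mult const_poly_of_nat)
  then have "1 + \<delta> = 0" using n by (simp only: const_poly_eq_0_iff) simp
  \<comment> \<open>In fact this product is \<open>(1 - n) + n = 1\<close>.\<close>
  then have "(1 + \<delta>) * (1 - of_nat n) = 0" by simp
  then have "(1 - of_nat n) + of_nat n = (0 :: 'k)"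
    using one_minus_n by (simp add: distrib_right mult.assoc)
  then show False by simp
qed

lemma Delta_not_Inn: "\<Delta> \<notin> J.Inn"
  using DeltaQ_not_Inn unfolding C.Inn_quot by blast

text \<open>To lift \<open>D\<close> linearly, each coset is represented by its unique element with
  constant term 0; uniqueness makes the lift \<open>L\<close> additive and homogeneous. Its Leibniz
  rule holds up to constants, since only cosets are compared.\<close>

lemma DerQ_decomp:
  assumes D: "D \<in> C.Q.Der"
  obtains S \<mu> where "S \<in> C.Q.Inn" "D = S \<oplus>\<^bsub>C.Q.E\<^esub> \<mu> \<odot>\<^bsub>C.Q.E\<^esub> \<Delta>Q"
proof -
  have DE: "D \<in> carrier C.Q.E" using D C.Q.Der_subset by blast
  have "\<forall>A\<in>carrier C.Q. \<exists>u. u \<in> polys n \<and> C.cls u = A \<and> Poly_Mapping.lookup u 0 = 0"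
  proof
    fix A assume A: "A \<in> carrier C.Q"
    obtain a where a: "a \<in> polys n" "A = C.cls a" using A by (auto simp: C.carrier_quot)
    let ?u = "a - const_poly (Poly_Mapping.lookup a 0)"
    have "C.cls ?u = A" using a by (simp add: cls_eq polys_diff const_poly_uminus[symmetric])
    moreover have "Poly_Mapping.lookup ?u 0 = 0" by (simp add: lookup_minus const_poly_def)
    ultimately show "\<exists>u. u \<in> polys n \<and> C.cls u = A \<and> Poly_Mapping.lookup u 0 = 0"
      using a by (intro exI[of _ ?u]) (auto intro: polys_diff)
  qed
  from bchoice[OF this] obtain r where
    "\<forall>A\<in>carrier C.Q. r A \<in> polys n \<and> C.cls (r A) = A \<and> Poly_Mapping.lookup (r A) 0 = 0" by (elim exE)
  note r = bspec[OF this]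
  have uniq: "u = v" if uv: "u \<in> polys n" "v \<in> polys n" "C.cls u = C.cls v"
    "Poly_Mapping.lookup u 0 = 0" "Poly_Mapping.lookup v 0 = 0" for u v
  proof -
    have "u - v \<in> Const" using uv cls_eq[of u v] by simp
    then obtain c where c: "u - v = const_poly c" by (rule rangeE)
    have "Poly_Mapping.lookup (u - v) 0 = 0" using uv by (simp add: lookup_minus)
    then have "c = 0" unfolding c by (simp add: const_poly_def)
    with c show ?thesis by simp
  qed
  define L where "L u = r (D (C.cls u))" for u
  have L: "L u \<in> polys n" "C.cls (L u) = D (C.cls u)" "Poly_Mapping.lookup (L u) 0 = 0" if "u \<in> polys n" for u
    using r[of "D (C.cls u)"] C.Q.End_closed[OF DE C.cls_mem] that by (auto simp: L_def)
  have cls_plus: "C.cls (u + v) = C.cls u \<oplus>\<^bsub>C.Q\<^esub> C.cls v" if "u \<in> polys n" "v \<in> polys n" for u v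
    using C.cls_add[of u v] that by (simp add: poly_space_simps)
  have cls_mult: "C.cls (const_poly c * u) = c \<odot>\<^bsub>C.Q\<^esub> C.cls u" if "u \<in> polys n" for c u
    using C.cls_smult[of c u] that by (simp add: poly_space_simps)
  have "weak_derivation n L"
  proof
    show "n > 1" by (rule n)
    show "L u \<in> polys n" if "u \<in> polys n" for u using L that by blast
    show "L (u + v) = L u + L v" if uv: "u \<in> polys n" "v \<in> polys n" for u v
    proof (rule uniq)
      show "C.cls (L (u + v)) = C.cls (L u + L v)"
        using uv by (simp add: L cls_plus polys_add C.Q.End_f_add[OF DE] C.cls_mem)
    qed (use uv L in \<open>auto simp: lookup_add polys_add\<close>)
    show "L (const_poly c * u) = const_poly c * L u" if u: "u \<in> polys n" for c u
    proof (rule uniq)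
      show "C.cls (L (const_poly c * u)) = C.cls (const_poly c * L u)"
        using u by (simp add: L cls_mult polys_mult C.Q.End_f_smult[OF DE] C.cls_mem)
      \<comment> \<open>Multiplication by a constant scales coefficients, so a vanishing constant
        term is preserved.\<close>
      have "const_poly c * p = Poly_Mapping.map ((*) c) p" for p :: "'k mpoly"
        unfolding const_poly_def by (rule mult_map_scale_conv_mult[symmetric])
      then show "Poly_Mapping.lookup (const_poly c * L u) 0 = 0"
        using L(3)[OF u] by (simp add: Poly_Mapping.map.rep_eq)
    qed (use u L in \<open>auto simp: polys_mult\<close>)
    fix us :: "'k mpoly list" assume us: "length us = n" "set us \<subseteq> polys n"
    let ?f = "\<lambda>i. Jac n (us[i := L (us ! i)])"
    have us': "us \<in> args U n" using us by (simp add: args_U)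
    have nth: "us ! i \<in> polys n" if "i < n" for i using us that nth_mem by blast
    have upd: "us[i := L (us ! i)] \<in> args U n" if "i < n" for i
      using us' L(1)[OF nth[OF that]] by (intro args_update)
    then have f: "?f i \<in> polys n" if "i < n" for i using that by (intro polys_Jac) (auto simp: args_U)
    have "C.cls (L (Jac n us)) = D (C.\<omega>Q (map C.cls us))"
      using us' L(2)[OF polys_Jac[OF us]] by (simp add: C.factor_op_cls)
    also have "\<dots> = (\<Oplus>\<^bsub>C.Q\<^esub>i\<in>{..<n}. C.\<omega>Q ((map C.cls us)[i := D (map C.cls us ! i)]))"
      using D us' unfolding C.Q.Der_iff C.args_quot by blast
    also have "\<dots> = (\<Oplus>\<^bsub>C.Q\<^esub>i\<in>{..<n}. C.cls (?f i))"
    proof (rule C.Q.finsum_cong')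
      fix i assume "i \<in> {..<n}"
      then have i: "i < n" by simp
      have "(map C.cls us)[i := D (map C.cls us ! i)] = map C.cls (us[i := L (us ! i)])"
        using i us L(2)[OF nth[OF i]] by (simp add: map_update)
      then show "C.\<omega>Q ((map C.cls us)[i := D (map C.cls us ! i)]) = C.cls (?f i)"
        using C.factor_op_cls[OF upd[OF i]] by simp
    qed (use f in \<open>auto intro: C.cls_mem\<close>)
    also have "\<dots> = C.cls (\<Oplus>\<^bsub>U\<^esub>i\<in>{..<n}. ?f i)" by (rule C.cls_finsum) (use f in auto)
    also have "(\<Oplus>\<^bsub>U\<^esub>i\<in>{..<n}. ?f i) = (\<Sum>i<n. ?f i)" by (rule finsum_U) (use f in auto)
    finally have cls: "C.cls (L (Jac n us)) = C.cls (\<Sum>i<n. ?f i)" .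
    have "(\<Sum>i<n. ?f i) \<in> polys n" by (rule polys_sum) (use f in auto)
    with cls L(1)[OF polys_Jac[OF us]] show "eqc n (L (Jac n us)) (\<Sum>i<n. ?f i)"
      by (simp only: eqc_iff_const cls_eq)
  qed
  then obtain t c where t: "\<And>i. i < n \<Longrightarrow> t i \<in> polys n" and div: "divergence n t = const_poly ((1 - of_nat n) * c)"
    and Lt: "\<And>u. u \<in> polys n \<Longrightarrow> eqc n (L u) (vfield n t u + const_poly c * u)"
    by (rule weak_derivation_cases) blast
  obtain S \<mu> where S: "S \<in> J.Inn" "vf t c = S \<oplus>\<^bsub>U.E\<^esub> \<mu> \<odot>\<^bsub>U.E\<^esub> \<Delta>"
    using vf_decomp[OF t div] by blast
  have vE: "vf t c \<in> carrier U.E" by (rule vf_End) (rule t)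
  have "D = factor_map U Const (vf t c)"
  proof (rule C.Q.End_eqI[OF DE C.factor_map_End[OF vE vf_const]])
    fix A assume "A \<in> carrier C.Q"
    then obtain u where u: "u \<in> polys n" "A = C.cls u" by (auto simp: C.carrier_quot)
    have "L u - vf t c u \<in> Const"
      using Lt[OF u(1)] U.End_closed[OF vE u(1)] L(1)[OF u(1)] u(1) by (simp add: eqc_iff_const vf_def)
    then have "C.cls (L u) = C.cls (vf t c u)"
      using U.End_closed[OF vE u(1)] L(1)[OF u(1)] by (simp add: cls_eq)
    then show "D A = factor_map U Const (vf t c) A"
      using u L(2)[OF u(1)] C.factor_map_cls[OF vE vf_const u(1)] by simp
  qed
  also have "\<dots> = factor_map U Const S \<oplus>\<^bsub>C.Q.E\<^esub> \<mu> \<odot>\<^bsub>C.Q.E\<^esub> \<Delta>Q"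
  proof -
    have "\<mu> \<in> carrier K" by simp
    note m = C.factor_map_smult[OF this Delta_End Delta_const] U.End_smult_closed[OF this Delta_End]
    show ?thesis
      unfolding S(2) C.factor_map_add(2)[OF C.Inn_End[OF S(1)] C.Inn_W[OF S(1)] m(3,1)] m(2) ..
  qed
  finally show thesis using that S(1) unfolding C.Inn_quot by blast
qed

lemma has_dim_Const: "has_dim K (U\<lparr>carrier := Const\<rparr>) 1"
proof -
  interpret S: vectorspace K "U\<lparr>carrier := Const\<rparr>"
    using C.subspace by (rule U.subspace_is_vs)
  show ?thesis
  proof (rule S.has_dim_1I[of 1])
    have 1: "(1 :: 'k mpoly) \<in> Const" using const_poly_1 by (metis rangeI)
    then show "1 \<in> carrier (U\<lparr>carrier := Const\<rparr>)" by simp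
    show "1 \<noteq> \<zero>\<^bsub>U\<lparr>carrier := Const\<rparr>\<^esub>" by (simp add: poly_space_simps)
    show "S.span {1} = carrier (U\<lparr>carrier := Const\<rparr>)"
      using S.span_singleton[of 1] 1 by (simp add: poly_space_simps)
  qed
qed

text \<open>The premise that \<Delta> generates all derivations modulo interior ones stays open
  here; \<open>Der_gen\<close> and \<open>DerQ_gen\<close> have the form that discharges it.\<close>

lemmas Out_U = J.Out_one_dim[OF Delta_derivation Delta_not_Inn]
lemmas Out_Q = C.Q.Out_one_dim[OF DeltaQ_derivation DeltaQ_not_Inn]

lemma Der_gen: "D \<in> J.Der \<Longrightarrow> \<exists>c\<in>carrier K. \<exists>S\<in>J.Inn. D = S \<oplus>\<^bsub>U.E\<^esub> c \<odot>\<^bsub>U.E\<^esub> \<Delta>"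
  by (rule Der_decomp) auto

lemma DerQ_gen: "D \<in> C.Q.Der \<Longrightarrow> \<exists>c\<in>carrier K. \<exists>S\<in>C.Q.Inn. D = S \<oplus>\<^bsub>C.Q.E\<^esub> c \<odot>\<^bsub>C.Q.E\<^esub> \<Delta>Q"
  by (rule DerQ_decomp) auto

end

theorem theorem8p3:
  fixes n :: nat
  assumes "n > 1"
  shows
    "let K = (class_ring :: 'k::field_char_0 ring);
         U = (poly_space n :: ('k, 'k mpoly) module);
         C = LinearCombinations.module.span K U {1};
         Q = quot_space U C;
         \<omega> = Jac n;
         \<omega>Q = factor_op U C \<omega>;
         \<Delta> = Delta n;
         \<Delta>Q = factor_map U C \<Delta>
     in
       n_lie_algebra K U n \<omega> \<and>
       center U n \<omega> = C \<and> has_dim K (U\<lparr>carrier := C\<rparr>) 1 \<and>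
       simple_n_lie_algebra K Q n \<omega>Q \<and>
       \<Delta> \<in> derivations K U n \<omega> \<and>
       outer_class K U n \<omega> \<Delta> \<noteq> \<zero>\<^bsub>Out_space K U n \<omega>\<^esub> \<and>
       LinearCombinations.module.span K (Out_space K U n \<omega>) {outer_class K U n \<omega> \<Delta>}
         = carrier (Out_space K U n \<omega>) \<and>
       \<Delta>Q \<in> derivations K Q n \<omega>Q \<and>
       outer_class K Q n \<omega>Q \<Delta>Q \<noteq> \<zero>\<^bsub>Out_space K Q n \<omega>Q\<^esub> \<and>
       LinearCombinations.module.span K (Out_space K Q n \<omega>Q) {outer_class K Q n \<omega>Q \<Delta>Q}
         = carrier (Out_space K Q n \<omega>Q) \<and>
       has_dim K (Out_space K U n \<omega>) 1 \<and>
       has_dim K (Out_space K Q n \<omega>Q) 1"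
proof -
  interpret jacobian n "TYPE('k)" by (rule jacobian.intro) (rule assms)
  show ?thesis
    unfolding Let_def span_1
    by (intro conjI Jac_n_lie center_U has_dim_Const simple_quot Delta_derivation DeltaQ_derivation
        Out_U Out_Q Der_gen DerQ_gen)
qed

end
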